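(* Fix $\alpha>0$. Let $A$ be any positive real number, and for $N$ large put $\sigma'_A := 1 - \frac{A}{\log_2 N}$. Then, for $N$ sufficiently large, $$\max_{\substack{\ell\in\mathbb{Z}\\ \sqrt{N} \le \ell \le N}} \big|\zeta^{(j)}(\sigma'_A + i\alpha\ell)\big| \ge \big(D_j(A) + o(1)\big)(\log_2 N)^{j+1}$$ uniformly for all positive integers $j \le \frac{\log_3 N}{\log_4 N}$, where $$D_j(A) = \int_0^\infty e^{Au}\, u^j \rho(u)\,\mathrm{d}u$$ and the $o(1)$ term tends to $0$ as $N\to\infty$ uniformly in such $j$.
   Context: $\zeta$ denotes the Riemann zeta function and $\zeta^{(j)}$ its $j$-th derivative. $\log_k$ denotes the $k$-fold iterated natural logarithm (e.g. $\log_2 N=\log\log N$). $\rho$ is the Dickman function, i.e. the continuous function on $(0,\infty)$ with $\rho(u)=1$ for $0< u\le 1$ and $u\rho'(u) = -\rho(u-1)$ for $u>1$. *)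

theory Defs
  imports "HOL-Complex_Analysis.Complex_Analysis"
begin

definition is_dickman :: "(real \<Rightarrow> real) \<Rightarrow> bool" where
  "is_dickman r \<longleftrightarrow>
     continuous_on {0<..} r \<and>
     (\<forall>u. 0 < u \<and> u \<le> 1 \<longrightarrow> r u = 1) \<and>
     (\<forall>u>1. r differentiable at u \<and> u * deriv r u = - r (u - 1))"

text \<open>Normalising the irrelevant values outside \<open>(0,\<infinity>)\<close> to 0 makes the function unique as a
  total function; existence and uniqueness are proved in \<open>dickman_ex1\<close>.\<close>

definition dickman :: "real \<Rightarrow> real" where
  "dickman = (THE r. is_dickman r \<and> (\<forall>u\<le>0. r u = 0))"

text \<open>The analytic continuation of the Dirichlet series from \<open>Re s > 1\<close> to the plane without 1.
  The value at the pole is set to 0 by convention; existence and uniqueness are proved in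
  \<open>riemann_zeta_ex1\<close>.\<close>

definition is_riemann_zeta :: "(complex \<Rightarrow> complex) \<Rightarrow> bool" where
  "is_riemann_zeta f \<longleftrightarrow>
     f holomorphic_on - {1} \<and>
     (\<forall>s. Re s > 1 \<longrightarrow> (\<lambda>n. 1 / of_nat (Suc n) powr s) sums f s)"

definition riemann_zeta :: "complex \<Rightarrow> complex" where
  "riemann_zeta = (THE f. is_riemann_zeta f \<and> f 1 = 0)"

definition iter_ln :: "nat \<Rightarrow> real \<Rightarrow> real" where
  "iter_ln k x = (ln ^^ k) x"

definition D_const :: "nat \<Rightarrow> real \<Rightarrow> real" where
  "D_const j A = (LBINT u:{0<..}. exp (A * u) * u ^ j * dickman u)"

subsection \<open>Well-definedness of the Dickman function\<close>

text \<open>Picard iteration for \<open>r u = 1 - \<integral>\<^sub>1\<^sup>u r (t - 1) / t dt\<close>; the \<open>k\<close>-th iterate is exact for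
  \<open>0 < u \<le> k + 1\<close>.\<close>

definition dickman_iter :: "nat \<Rightarrow> real \<Rightarrow> real" where
  "dickman_iter k = ((\<lambda>r u. if u \<le> 1 then 1 else 1 - integral {1..u} (\<lambda>t. r (t - 1) / t)) ^^ k) (\<lambda>_. 1)"

lemma dickman_iter_Suc:
  "dickman_iter (Suc k) u =
     (if u \<le> 1 then 1 else 1 - integral {1..u} (\<lambda>t. dickman_iter k (t - 1) / t))"
  by (simp add: dickman_iter_def)

lemma continuous_on_shift_div:
  fixes f :: "real \<Rightarrow> real"
  assumes "\<And>x. isCont f x"
  shows "continuous_on {1..b} (\<lambda>t. f (t - 1) / t)"
proof -
  have "continuous_on UNIV f" using assms by (simp add: continuous_at_imp_continuous_on)
  hence "continuous_on {1..b} (\<lambda>t. f (t - 1))"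
    by (rule continuous_on_compose2) (auto intro!: continuous_on_diff)
  thus ?thesis by (rule continuous_on_divide) auto
qed

lemma isCont_dickman_iter: "isCont (dickman_iter k) x"
proof (induction k arbitrary: x)
  case 0
  then show ?case by (simp add: dickman_iter_def)
next
  case (Suc k)
  have cont: "continuous_on {1..b} (\<lambda>t. dickman_iter k (t - 1) / t)" for b
    by (intro continuous_on_shift_div Suc)
  have eq: "dickman_iter (Suc k) u = 1 - integral {1..max 1 u} (\<lambda>t. dickman_iter k (t - 1) / t)" for u
    by (auto simp: dickman_iter_Suc max_def)
  have "continuous_on {1..max 2 (x + 1)} (\<lambda>u. integral {1..u} (\<lambda>t. dickman_iter k (t - 1) / t))"
    by (intro indefinite_integral_continuous_1 integrable_continuous_real cont)
  hence "continuous_on {x - 1..x + 1}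
          (\<lambda>u. integral {1..max 1 u} (\<lambda>t. dickman_iter k (t - 1) / t))"
    by (rule continuous_on_compose2) (auto intro!: continuous_intros)
  hence "continuous_on {x - 1..x + 1} (dickman_iter (Suc k))"
    unfolding eq [abs_def] by (intro continuous_intros)
  thus ?case
    by (rule continuous_on_interior) auto
qed

lemma dickman_iter_stable:
  assumes "u \<le> real k + 1" "k \<le> m"
  shows "dickman_iter m u = dickman_iter k u"
proof -
  have *: "u \<le> real k + 1 \<Longrightarrow> dickman_iter (Suc k) u = dickman_iter k u" for k u
  proof (induction k arbitrary: u)
    case 0
    then show ?case by (simp add: dickman_iter_def)
  next
    case (Suc k)
    have "integral {1..u} (\<lambda>t. dickman_iter (Suc k) (t - 1) / t) =
          integral {1..u} (\<lambda>t. dickman_iter k (t - 1) / t)"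
      using Suc.prems by (intro integral_cong) (subst Suc.IH, auto)
    then show ?case
      unfolding dickman_iter_Suc[of "Suc k"] dickman_iter_Suc[of k] by simp
  qed
  show ?thesis using assms(2,1)
    by (induction m rule: dec_induct) (auto simp: *)
qed

lemma is_dickman_exists: "\<exists>r. is_dickman r \<and> (\<forall>u\<le>0. r u = 0)"
proof -
  define r where "r = (\<lambda>u. if u \<le> 0 then 0 else dickman_iter (nat \<lceil>u\<rceil>) u)"
  have r_eq: "r u = dickman_iter k u" if "0 < u" "u \<le> real k + 1" for u k
  proof -
    have "r u = dickman_iter (max k (nat \<lceil>u\<rceil>)) u"
      using that dickman_iter_stable[of u "nat \<lceil>u\<rceil>" "max k (nat \<lceil>u\<rceil>)"]
      by (simp add: r_def) linarith
    also have "\<dots> = dickman_iter k u"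
      using that by (intro dickman_iter_stable) auto
    finally show ?thesis .
  qed
  have ev: "eventually (\<lambda>v. r v = dickman_iter k v) (nhds u)" if "0 < u" "u < real k + 1" for u k
    using that by (intro eventually_nhds_in_open[of "{0<..<real k + 1}", THEN eventually_mono])
      (auto intro: r_eq)
  have cont: "isCont r u" if "0 < u" for u
  proof -
    obtain k where k: "u < real k" using reals_Archimedean2 by blast
    have "isCont (dickman_iter k) u" by (rule isCont_dickman_iter)
    thus ?thesis using isCont_cong[OF ev[of u k]] k that by simp
  qed
  have der: "(r has_real_derivative (- r (u - 1) / u)) (at u)" if u: "u > 1" for u
  proof -
    obtain k where k: "u < real k" using reals_Archimedean2 by blast
    have cont: "continuous_on {1..real k} (\<lambda>t. dickman_iter k (t - 1) / t)"
      by (intro continuous_on_shift_div isCont_dickman_iter)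
    have "((\<lambda>x. integral {1..x} (\<lambda>t. dickman_iter k (t - 1) / t)) has_real_derivative
            dickman_iter k (u - 1) / u) (at u within {1..real k})"
      using integral_has_real_derivative[OF cont, of u] u k by simp
    hence "((\<lambda>x. integral {1..x} (\<lambda>t. dickman_iter k (t - 1) / t)) has_real_derivative
            dickman_iter k (u - 1) / u) (at u)"
      using u k by (simp add: at_within_Icc_at)
    hence *: "((\<lambda>x. 1 - integral {1..x} (\<lambda>t. dickman_iter k (t - 1) / t)) has_real_derivative
            - r (u - 1) / u) (at u)"
      using u k r_eq[of "u - 1" k] by (auto intro!: derivative_eq_intros)
    have "eventually (\<lambda>v. r v = 1 - integral {1..v} (\<lambda>t. dickman_iter k (t - 1) / t)) (nhds u)"
      using eventually_nhds_in_open[of "{1<..<real k}" u] u k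
      by (auto elim!: eventually_mono simp: r_eq[of _ "Suc k"] dickman_iter_Suc)
    with * show ?thesis by (subst DERIV_cong_ev) auto
  qed
  have "is_dickman r"
    unfolding is_dickman_def
  proof (intro conjI allI impI)
    show "continuous_on {0<..} r"
      by (intro continuous_at_imp_continuous_on) (auto intro: cont)
    show "r u = 1" if "0 < u \<and> u \<le> 1" for u
      using r_eq[of u 0] that by (simp add: dickman_iter_def)
    show "r differentiable at u" if "u > 1" for u
      using der[OF that] by (auto simp: real_differentiable_def)
    show "u * deriv r u = - r (u - 1)" if "u > 1" for u
      using DERIV_imp_deriv[OF der[OF that]] that by simp
  qed
  thus ?thesis by (intro exI[of _ r]) (auto simp: r_def)
qed

lemma is_dickman_unique:
  assumes "is_dickman r" "is_dickman s" "u > 0"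
  shows "r u = s u"
proof -
  have "\<forall>u. 0 < u \<and> u \<le> real (Suc n) \<longrightarrow> r u = s u" for n
  proof (induction n)
    case 0
    then show ?case using assms(1,2) by (auto simp: is_dickman_def)
  next
    case (Suc n)
    define d where "d = (\<lambda>x. r x - s x)"
    have "d u = 0" if u: "real (Suc n) \<le> u" "u \<le> real (Suc (Suc n))" for u
    proof -
      have "d u = d (real (Suc n))"
      proof (rule DERIV_isconst2[of "real (Suc n)" "real (Suc (Suc n))" d])
        show "continuous_on {real (Suc n)..real (Suc (Suc n))} d"
          unfolding d_def using assms(1,2)
          by (intro continuous_intros; auto simp: is_dickman_def elim!: continuous_on_subset)
        fix x assume x: "real (Suc n) < x" "x < real (Suc (Suc n))"
        hence x1: "x > 1" by simp
        have "(r has_real_derivative deriv r x) (at x)" "(s has_real_derivative deriv s x) (at x)"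
          using assms(1,2) x1
          by (auto simp: is_dickman_def DERIV_deriv_iff_real_differentiable)
        moreover have "x * deriv r x = x * deriv s x"
          using assms(1,2) x1 x Suc by (auto simp: is_dickman_def)
        ultimately show "(d has_real_derivative 0) (at x)"
          unfolding d_def using x1 by (auto intro!: derivative_eq_intros)
      qed (use u in auto)
      also have "\<dots> = 0" using Suc by (auto simp: d_def)
      finally show ?thesis .
    qed
    thus ?case using Suc by (metis d_def eq_iff_diff_eq_0 linorder_le_cases)
  qed
  moreover obtain n where "u \<le> real (Suc n)"
    using real_arch_simple[of u] by (metis le_SucI of_nat_le_iff order.trans order_refl)
  ultimately show ?thesis using assms(3) by blast
qed

lemma dickman_ex1: "\<exists>!r. is_dickman r \<and> (\<forall>u\<le>0. r u = 0)"
proof -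
  have "r = s" if "is_dickman r \<and> (\<forall>u\<le>0. r u = 0)" "is_dickman s \<and> (\<forall>u\<le>0. s u = 0)" for r s
  proof
    show "r u = s u" for u
      using that is_dickman_unique[of r s u] by (cases "u \<le> 0") auto
  qed
  thus ?thesis using is_dickman_exists by blast
qed

lemma is_dickman_dickman: "is_dickman dickman"
  using theI'[OF dickman_ex1] by (simp add: dickman_def)

subsection \<open>Well-definedness of the Riemann zeta function\<close>

text \<open>The integral of \<open>p(x - n - 1) x powr -s\<close> over the \<open>n\<close>-th unit interval \<open>[n + 1, n + 2]\<close>.\<close>

definition zterm :: "(real \<Rightarrow> real) \<Rightarrow> nat \<Rightarrow> complex \<Rightarrow> complex" where
  "zterm p n s = integral {0..1} (\<lambda>t. of_real (p t) * of_real (real (Suc n) + t) powr (-s))"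

lemma continuous_on_zterm_powr:
  "continuous_on {0..1} (\<lambda>t. complex_of_real (real (Suc n) + t) powr z)"
  by (intro continuous_on_powr_complex continuous_intros) (auto simp: complex_eq_iff)

lemma zterm_integrable:
  fixes s :: complex
  assumes "continuous_on {0..1} p"
  shows "(\<lambda>t. of_real (p t) * of_real (real (Suc n) + t) powr (-s)) integrable_on {0..1}"
proof -
  have "continuous_on {0..1} (\<lambda>t. of_real (p t) * of_real (real (Suc n) + t) powr (-s))"
    using assms by (intro continuous_on_mult continuous_on_of_real continuous_on_zterm_powr)
  thus ?thesis by (rule integrable_continuous_real)
qed

lemma zterm_holomorphic:
  assumes "continuous_on {0..1} p"
  shows "zterm p n holomorphic_on UNIV"
proof -
  have "(\<lambda>s. integral (cbox 0 1) (\<lambda>t. of_real (p t) * of_real (real (Suc n) + t) powr (-s)))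
          holomorphic_on UNIV"
  proof (rule leibniz_rule_holomorphic)
    fix s :: complex and t :: real assume "t \<in> cbox 0 1"
    hence "complex_of_real (real (Suc n) + t) \<noteq> 0" by (simp only: of_real_eq_0_iff) auto
    thus "((\<lambda>s. of_real (p t) * of_real (real (Suc n) + t) powr (-s)) has_field_derivative
            (of_real (p t) * - (Ln (of_real (real (Suc n) + t)) * of_real (real (Suc n) + t) powr (-s))))
            (at s within UNIV)"
      by (auto intro!: derivative_eq_intros DERIV_chain2[OF has_field_derivative_powr_right]
               simp del: of_real_add)
  next
    have "continuous_on (UNIV \<times> {0..1}) (\<lambda>x::complex \<times> real. p (snd x))"
      by (rule continuous_on_compose2[OF assms continuous_on_snd[OF continuous_on_id]]) auto
    moreover define g where "g = (\<lambda>x::complex \<times> real. complex_of_real (real (Suc n) + snd x))"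
    have g: "continuous_on (UNIV \<times> {0..1}) g"
      unfolding g_def
      by (intro continuous_on_of_real continuous_on_add continuous_on_const continuous_on_snd
            continuous_on_id)
    have g_slit: "g x \<notin> \<real>\<^sub>\<le>\<^sub>0" if "x \<in> UNIV \<times> {0..1}" for x
      using that by (auto simp: g_def complex_nonpos_Reals_iff)
    have "continuous_on (UNIV \<times> {0..1}) (\<lambda>x. Ln (g x))"
      using g g_slit by (rule continuous_on_Ln')
    moreover have "continuous_on (UNIV \<times> {0..1}) (\<lambda>x. exp (- fst x * Ln (g x)))"
      by (intro continuous_on_exp continuous_on_mult continuous_on_minus continuous_on_fst
            continuous_on_id calculation)
    moreover have "g x powr (- fst x) = exp (- fst x * Ln (g x))" if "x \<in> UNIV \<times> {0..1}" for x
      using g_slit[OF that] by (auto simp: powr_def)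
    ultimately have "continuous_on (UNIV \<times> {0..1})
        (\<lambda>x. of_real (p (snd x)) * - (Ln (g x) * g x powr (- fst x)))"
      by (intro continuous_on_mult continuous_on_minus continuous_on_of_real)
         (auto cong: continuous_on_cong)
    thus "continuous_on (UNIV \<times> cbox 0 1) (\<lambda>(s, t). of_real (p t) *
            - (Ln (of_real (real (Suc n) + t)) * of_real (real (Suc n) + t) powr (-s)))"
      by (simp only: case_prod_unfold g_def cbox_interval)
  qed (use zterm_integrable[OF assms] in auto)
  thus ?thesis by (simp add: zterm_def [abs_def])
qed

lemma zterm_bound:
  assumes "continuous_on {0..1} p" "\<And>t. t \<in> {0..1} \<Longrightarrow> \<bar>p t\<bar> \<le> M" "0 \<le> a" "a \<le> Re s"
  shows "cmod (zterm p n s) \<le> M * real (Suc n) powr (-a)"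
proof -
  have "cmod (zterm p n s) \<le> M * real (Suc n) powr (-a) * (1 - 0)"
    unfolding zterm_def
  proof (rule integral_bound)
    show "continuous_on {0..1} (\<lambda>t. of_real (p t) * of_real (real (Suc n) + t) powr (-s))"
      using assms(1) by (intro continuous_on_mult continuous_on_of_real continuous_on_zterm_powr)
    fix t :: real assume t: "t \<in> {0..1}"
    have "cmod (of_real (real (Suc n) + t) powr (-s)) = (real (Suc n) + t) powr (- Re s)"
      using t by (subst norm_powr_real_powr) (auto simp del: of_real_add)
    also have "\<dots> \<le> (real (Suc n) + t) powr (-a)"
      using t assms by (intro powr_mono) auto
    also have "\<dots> \<le> real (Suc n) powr (-a)"
      using t assms by (intro powr_mono2') auto
    finally show "cmod (of_real (p t) * of_real (real (Suc n) + t) powr (-s))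
                    \<le> M * real (Suc n) powr (-a)"
      unfolding norm_mult using assms(2)[OF t] by (intro mult_mono) auto
  qed auto
  thus ?thesis by simp
qed

lemma summable_Suc_powr: "a > 1 \<Longrightarrow> summable (\<lambda>n. real (Suc n) powr (-a))"
  using summable_real_powr_iff[of "-a"] by (subst summable_Suc_iff) auto

lemma zterm_sum:
  assumes "continuous_on {0..1} p"
  obtains g where "g holomorphic_on {s. Re s > 1}" "\<And>s. Re s > 1 \<Longrightarrow> (\<lambda>n. zterm p n s) sums g s"
proof -
  have "bounded (p ` {0..1})"
    by (intro compact_imp_bounded compact_continuous_image assms) auto
  then obtain M where M: "\<And>t. t \<in> {0..1} \<Longrightarrow> \<bar>p t\<bar> \<le> M"
    by (fastforce simp: bounded_iff)
  have "\<exists>g g'. \<forall>s\<in>{s. Re s > 1}. ((\<lambda>n. zterm p n s) sums g s) \<and>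
           ((\<lambda>n. deriv (zterm p n) s) sums g' s) \<and> (g has_field_derivative g' s) (at s)"
  proof (rule series_and_derivative_comparison_local)
    show "(zterm p n has_field_derivative deriv (zterm p n) s) (at s)" for n s
      using zterm_holomorphic[OF assms] by (intro holomorphic_derivI[of _ UNIV]) auto
    fix s :: complex assume s: "s \<in> {s. Re s > 1}"
    define d where "d = (Re s - 1) / 2"
    have "d > 0" using s by (simp add: d_def)
    moreover have "summable (\<lambda>n. M * real (Suc n) powr - (1 + d))"
      using \<open>d > 0\<close> by (intro summable_mult summable_Suc_powr) auto
    moreover have "cmod (zterm p n y) \<le> M * real (Suc n) powr - (1 + d)"
      if "y \<in> ball s d" for n y
    proof (rule zterm_bound[OF assms M])
      have "\<bar>Re s - Re y\<bar> \<le> dist s y"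
        by (metis abs_Re_le_cmod dist_norm minus_complex.sel(1))
      hence "Re s - Re y < d" using that by auto
      thus "1 + d \<le> Re y" unfolding d_def by (simp add: field_simps)
    qed (use \<open>d > 0\<close> in auto)
    ultimately show "\<exists>d h. 0 < d \<and> summable h \<and>
        (\<forall>\<^sub>F n in sequentially. \<forall>y\<in>ball s d \<inter> {s. Re s > 1}. cmod (zterm p n y) \<le> h n)"
      by (intro exI[of _ d] exI[of _ "\<lambda>n. M * real (Suc n) powr - (1 + d)"]) auto
  qed (auto simp: open_halfspace_Re_gt)
  then obtain g g' where g: "\<And>s. Re s > 1 \<Longrightarrow> (\<lambda>n. zterm p n s) sums g s"
      "\<And>s. Re s > 1 \<Longrightarrow> (g has_field_derivative g' s) (at s)" by auto
  hence "g holomorphic_on {s. Re s > 1}"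
    by (subst holomorphic_on_open) (auto simp: open_halfspace_Re_gt)
  with g show ?thesis using that by blast
qed

lemma powr_antideriv:
  fixes s :: complex
  assumes "t \<ge> 0"
  shows "((\<lambda>t. of_real (real (Suc n) + t) powr (-s)) has_vector_derivative
            - (s * of_real (real (Suc n) + t) powr (-s - 1))) (at t)"
proof -
  have "((\<lambda>z::complex. z powr (-s)) has_field_derivative
          (-s) * of_real (real (Suc n) + t) powr (-s - 1)) (at (of_real (real (Suc n) + t)))"
    using assms by (intro has_field_derivative_powr) (auto simp: complex_nonpos_Reals_iff)
  moreover have "((\<lambda>t. complex_of_real (real (Suc n) + t)) has_vector_derivative 1) (at t)"
    by (auto intro!: derivative_eq_intros simp: has_vector_derivative_def scaleR_conv_of_real)
  ultimately show ?thesis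
    using field_vector_diff_chain_at[of "\<lambda>t. complex_of_real (real (Suc n) + t)" 1 t]
    by (fastforce simp: o_def)
qed

lemma zterm_parts:
  assumes "continuous_on {0..1} p" "continuous_on {0..1} P"
      and "\<And>t. t \<in> {0<..<1} \<Longrightarrow> (P has_real_derivative p t) (at t)"
  shows "zterm p n s = of_real (P 1) * of_nat (Suc (Suc n)) powr (-s)
           - of_real (P 0) * of_nat (Suc n) powr (-s) + s * zterm P n (s + 1)"
proof -
  let ?y = "of_real (P 1) * of_nat (Suc (Suc n)) powr (-s)
           - of_real (P 0) * of_nat (Suc n) powr (-s) + s * zterm P n (s + 1)"
  have "((\<lambda>t. of_real (P t) * of_real (real (Suc n) + t) powr (-(s + 1))) has_integral
           zterm P n (s + 1)) {0..1}"
    unfolding zterm_def by (intro integrable_integral zterm_integrable assms)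
  from has_integral_mult_right[OF this, of "-s"]
  have int: "((\<lambda>t. of_real (P t) * - (s * of_real (real (Suc n) + t) powr (-s - 1))) has_integral
           - (s * zterm P n (s + 1))) {0..1}"
    by (simp add: mult_ac)
  have "((\<lambda>t. of_real (p t) * of_real (real (Suc n) + t) powr (-s)) has_integral ?y) {0..1}"
  proof (rule integration_by_parts_interior[of "(*)" 0 1 "\<lambda>t. complex_of_real (P t)" "\<lambda>t. of_real (real (Suc n) + t) powr (-s)"])
    show "bounded_bilinear ((*) :: complex \<Rightarrow> _)" by (rule bounded_bilinear_mult)
    show "continuous_on {0..1} (\<lambda>t. complex_of_real (P t))" using assms by (intro continuous_intros)
    show "continuous_on {0..1} (\<lambda>t. of_real (real (Suc n) + t) powr (-s))"
      by (rule continuous_on_zterm_powr)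
    show "((\<lambda>t. complex_of_real (P t)) has_vector_derivative of_real (p t)) (at t)"
      if "t \<in> {0<..<1}" for t
      using assms(3)[OF that] has_vector_derivative_of_real has_real_derivative_iff_has_vector_derivative by blast
    show "((\<lambda>t. of_real (real (Suc n) + t) powr (-s)) has_vector_derivative
            - (s * of_real (real (Suc n) + t) powr (-s - 1))) (at t)"
      if "t \<in> {0<..<1}" for t using that by (intro powr_antideriv) auto
    show "((\<lambda>t. of_real (P t) * - (s * of_real (real (Suc n) + t) powr (-s - 1))) has_integral
      of_real (P 1) * of_real (real (Suc n) + 1) powr (-s)
      - of_real (P 0) * of_real (real (Suc n) + 0) powr (-s) - ?y) {0..1}"
      using int by (simp add: add_ac)
  qed auto
  thus ?thesis unfolding zterm_def by (rule integral_unique)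
qed

text \<open>Repeated integration by parts continues the sums over unit intervals as long as the weight
  has mean zero.\<close>

lemma zterm_continuation:
  assumes "continuous_on {0..1} p" "integral {0..1} p = 0"
  shows "\<exists>f. f holomorphic_on {s. Re s > 1 - real k} \<and>
             (\<forall>s. Re s > 1 \<longrightarrow> (\<lambda>n. zterm p n s) sums f s)"
  using assms
proof (induction k arbitrary: p)
  case 0
  show ?case using zterm_sum[OF 0(1)] by (metis diff_zero of_nat_0)
next
  case (Suc k)
  define c where "c = integral {0..1} (\<lambda>t. integral {0..t} p)"
  define P where "P = (\<lambda>t. integral {0..t} p - c)"
  have cont0: "continuous_on {0..1} (\<lambda>t. integral {0..t} p)"
    by (intro indefinite_integral_continuous_1 integrable_continuous_real Suc)
  hence cont: "continuous_on {0..1} P" unfolding P_def by (intro continuous_intros)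
  have "integral {0..1} P = 0"
    unfolding P_def using integrable_continuous_real[OF cont0]
    by (subst integral_diff) (auto simp: c_def)
  from Suc.IH[OF cont this] obtain f where f: "f holomorphic_on {s. Re s > 1 - real k}"
      "\<And>s. Re s > 1 \<Longrightarrow> (\<lambda>n. zterm P n s) sums f s" by blast
  have der: "(P has_real_derivative p t) (at t)" if "t \<in> {0<..<1}" for t
  proof -
    have "((\<lambda>t. integral {0..t} p) has_real_derivative p t) (at t within {0..1})"
      using that by (intro integral_has_real_derivative Suc.prems) auto
    hence "((\<lambda>t. integral {0..t} p) has_real_derivative p t) (at t)"
      using that by (simp add: at_within_Icc_at)
    thus ?thesis unfolding P_def by (auto intro!: derivative_eq_intros)
  qed
  have P01: "P 0 = -c" "P 1 = -c" using Suc.prems by (auto simp: P_def)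
  define F where "F = (\<lambda>s. of_real c + s * f (s + 1))"
  have "F holomorphic_on {s. Re s > 1 - real (Suc k)}"
    unfolding F_def
    by (intro holomorphic_intros holomorphic_on_compose_gen[OF _ f(1), unfolded o_def]) auto
  moreover have "(\<lambda>n. zterm p n s) sums F s" if s: "Re s > 1" for s
  proof -
    have "(\<lambda>n. of_nat (Suc n) powr (-s)) \<longlonglongrightarrow> (0::complex)"
      using s by (intro tendsto_neg_powr_complex_of_nat filterlim_Suc) auto
    from sums_mult[OF telescope_sums'[OF this], of "of_real c"]
    have "(\<lambda>n. of_real c * (of_nat (Suc n) powr (-s) - of_nat (Suc (Suc n)) powr (-s)))
            sums (of_real c :: complex)" by simp
    moreover have "(\<lambda>n. s * zterm P n (s + 1)) sums (s * f (s + 1))"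
      using s by (intro sums_mult f) auto
    ultimately have "(\<lambda>n. of_real c * (of_nat (Suc n) powr (-s) - of_nat (Suc (Suc n)) powr (-s))
                       + s * zterm P n (s + 1)) sums F s"
      unfolding F_def by (intro sums_add)
    moreover have "zterm p n s = of_real c * (of_nat (Suc n) powr (-s) - of_nat (Suc (Suc n)) powr (-s))
                       + s * zterm P n (s + 1)" for n
      by (subst zterm_parts[OF Suc.prems(1) cont der]) (auto simp: P01 algebra_simps)
    ultimately show ?thesis by simp
  qed
  ultimately show ?case by blast
qed

lemma zeta_continuation_halfplane:
  "\<exists>f. f holomorphic_on {s. Re s > - real k} - {1} \<and>
       (\<forall>s. Re s > 1 \<longrightarrow> (\<lambda>n. 1 / of_nat (Suc n) powr s) sums f s)"
proof -
  define p :: "real \<Rightarrow> real" where "p = (\<lambda>t. t - 1 / 2)"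
  have cont: "continuous_on {0..1} p" unfolding p_def by (intro continuous_intros)
  have "(p has_integral ((1^2/2 - 1/2) - (0^2/2 - 0/2))) {0..1}"
    unfolding p_def
    by (rule fundamental_theorem_of_calculus)
       (auto intro!: derivative_eq_intros simp flip: has_real_derivative_iff_has_vector_derivative)
  hence "integral {0..1} p = 0" by (simp add: integral_unique)
  from zterm_continuation[OF cont this, of "Suc k + 1"] obtain g
    where g: "g holomorphic_on {s. Re s > 1 - real (Suc k + 1)}"
      "\<And>s. Re s > 1 \<Longrightarrow> (\<lambda>n. zterm p n s) sums g s" by blast
  define F where "F = (\<lambda>s. 1 / (s - 1) + 1 / 2 - s * g (s + 1))"
  have "F holomorphic_on {s. Re s > - real k} - {1}"
    unfolding F_def
    by (intro holomorphic_intros holomorphic_on_compose_gen[OF _ g(1), unfolded o_def]) auto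
  moreover have "(\<lambda>n. 1 / of_nat (Suc n) powr s) sums F s" if s: "Re s > 1" for s
  proof -
    have [simp]: "s \<noteq> 1" using s by auto
    have lim: "(\<lambda>n. of_nat (Suc n) powr (-z)) \<longlonglongrightarrow> (0::complex)" if "Re z > 0" for z
      using that by (intro tendsto_neg_powr_complex_of_nat filterlim_Suc) auto
    define a where "a = (\<lambda>z n. of_nat (Suc n) powr (-z) - of_nat (Suc (Suc n)) powr (-z) :: complex)"
    have a: "a z sums 1" if "Re z > 0" for z
      using telescope_sums'[OF lim[OF that]] by (simp add: a_def)
    have one: "zterm (\<lambda>_. 1) n s = 1 / (s - 1) * a (s - 1) n" for n
    proof -
      have "((\<lambda>t. of_real (real (Suc n) + t) powr (-s)) has_integral
             (-1 / (s - 1) * of_real (real (Suc n) + 1) powr (-(s - 1))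
              - -1 / (s - 1) * of_real (real (Suc n) + 0) powr (-(s - 1)))) {0..1}"
      proof (rule fundamental_theorem_of_calculus)
        fix t :: real assume "t \<in> {0..1}"
        hence "((\<lambda>t. -1 / (s - 1) * of_real (real (Suc n) + t) powr (-(s - 1)))
          has_vector_derivative -1 / (s - 1) * - ((s - 1) * of_real (real (Suc n) + t) powr (-(s-1) - 1))) (at t)"
          by (intro has_vector_derivative_mult_right powr_antideriv) auto
        thus "((\<lambda>t. -1 / (s - 1) * of_real (real (Suc n) + t) powr (-(s - 1)))
          has_vector_derivative of_real (real (Suc n) + t) powr (-s)) (at t within {0..1})"
          by (simp add: has_vector_derivative_at_within)
      qed auto
      thus ?thesis
        unfolding zterm_def of_real_1 mult_1_left
        by (subst integral_unique) (auto simp: a_def add_ac diff_divide_distrib)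
    qed
    have "(p has_real_derivative 1) (at t)" for t
      unfolding p_def by (auto intro!: derivative_eq_intros)
    hence two: "zterm (\<lambda>_. 1) n s = 1/2 * of_nat (Suc (Suc n)) powr (-s)
           + 1/2 * of_nat (Suc n) powr (-s) + s * zterm p n (s + 1)" for n
      using cont by (subst zterm_parts[of _ p]) (auto simp: p_def)
    have "(\<lambda>n. 1 / (s - 1) * a (s - 1) n + 1 / 2 * a s n - s * zterm p n (s + 1)) sums
            (1 / (s - 1) * 1 + 1 / 2 * 1 - s * g (s + 1))"
      using s by (intro sums_add sums_diff sums_mult a g) auto
    moreover have "1 / (s - 1) * a (s - 1) n + 1 / 2 * a s n - s * zterm p n (s + 1)
                    = 1 / of_nat (Suc n) powr s" for n
      unfolding one[symmetric] two
      by (simp add: a_def powr_minus field_simps)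
    ultimately show ?thesis by (simp add: F_def)
  qed
  ultimately show ?thesis by blast
qed

lemma zeta_halfplane_unique:
  assumes "f holomorphic_on {s. Re s > c} - {1}" "g holomorphic_on {s. Re s > c} - {1}"
      and "\<And>s. Re s > 1 \<Longrightarrow> f s = g s" "Re s > c" "s \<noteq> 1"
  shows "f s = g s"
proof (cases "Re s > 1")
  case False
  have conn: "connected ({s. Re s > c} - {1})"
    by (intro connected_open_delete convex_connected convex_halfspace_Re_gt open_halfspace_Re_gt) auto
  have "(\<lambda>s. f s - g s) s = 0"
  proof (rule analytic_continuation_open[of "{s. Re s > 1}" "{s. Re s > c} - {1}" "\<lambda>s. f s - g s" "\<lambda>_. 0"])
    show "{s::complex. Re s > 1} \<noteq> {}" by (auto intro!: exI[of _ 2])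
    show "{s. Re s > 1} \<subseteq> {s. Re s > c} - {1}" using False assms(4) by auto
  qed (use assms conn in \<open>auto intro!: holomorphic_intros open_delete open_halfspace_Re_gt\<close>)
  thus ?thesis by simp
qed (use assms in auto)

lemma is_riemann_zeta_exists: "\<exists>f. is_riemann_zeta f \<and> f 1 = 0"
proof -
  obtain f where f: "\<And>k::nat. f k holomorphic_on {s. Re s > - real k} - {1}"
      "\<And>k s. Re s > 1 \<Longrightarrow> (\<lambda>n. 1 / of_nat (Suc n) powr s) sums f k s"
    using zeta_continuation_halfplane by metis
  have eq: "f k s = f m s" if "Re s > - real k" "k \<le> m" "s \<noteq> 1" for s k m
  proof (rule zeta_halfplane_unique[of "f k" "- real k" "f m"])
    show "f m holomorphic_on {s. Re s > - real k} - {1}"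
      using that by (intro holomorphic_on_subset[OF f(1)[of m]]) auto
    show "f k z = f m z" if "Re z > 1" for z using f(2)[OF that] sums_unique2 by blast
  qed (use f that in auto)
  define F where "F = (\<lambda>s. if s = 1 then 0 else f (nat (\<lfloor>\<bar>Re s\<bar>\<rfloor> + 1)) s)"
  have F_eq: "F s = f k s" if "Re s > - real k" "s \<noteq> 1" for k s
  proof -
    define m where "m = nat (\<lfloor>\<bar>Re s\<bar>\<rfloor> + 1)"
    have "Re s > - real m" unfolding m_def by linarith
    hence "f m s = f k s" using eq[of k s m] eq[of m s k] that by (metis nat_le_linear)
    thus ?thesis using that by (simp add: F_def m_def)
  qed
  have "F field_differentiable at s" if "s \<noteq> 1" for s
  proof -
    obtain k where "- Re s < real k" using reals_Archimedean2 by blast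
    hence s: "s \<in> {s. Re s > - real k} - {1}" using that by auto
    have op: "open ({s. Re s > - real k} - {1})" by (intro open_delete open_halfspace_Re_gt)
    have "F holomorphic_on {s. Re s > - real k} - {1}"
      using f(1)[of k] by (rule holomorphic_transform) (auto simp: F_eq)
    thus ?thesis using s op holomorphic_on_imp_differentiable_at by blast
  qed
  hence "F holomorphic_on - {1}"
    by (auto simp: holomorphic_on_def intro: field_differentiable_at_within)
  moreover have "(\<lambda>n. 1 / of_nat (Suc n) powr s) sums F s" if "Re s > 1" for s
    using f(2)[OF that, of 0] F_eq[of 0 s] that by (cases "s = 1") auto
  ultimately have "is_riemann_zeta F" by (simp add: is_riemann_zeta_def)
  moreover have "F 1 = 0" by (simp add: F_def)
  ultimately show ?thesis by blast
qed

lemma riemann_zeta_ex1: "\<exists>!f. is_riemann_zeta f \<and> f 1 = 0"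
proof -
  have "f s = g s" if "is_riemann_zeta f \<and> f 1 = 0" "is_riemann_zeta g \<and> g 1 = 0" for f g s
  proof (cases "s = 1")
    case False
    show ?thesis
    proof (rule zeta_halfplane_unique[of f "Re s - 1" g])
      show "f holomorphic_on {z. Re s - 1 < Re z} - {1}" "g holomorphic_on {z. Re s - 1 < Re z} - {1}"
        using that by (auto simp: is_riemann_zeta_def elim!: holomorphic_on_subset)
      show "f z = g z" if "Re z > 1" for z
        using \<open>is_riemann_zeta f \<and> _\<close> \<open>is_riemann_zeta g \<and> _\<close> that
        by (auto simp: is_riemann_zeta_def intro: sums_unique2)
    qed (use False in auto)
  qed (use that in auto)
  thus ?thesis using is_riemann_zeta_exists by (metis ext)
qed

lemma is_riemann_zeta_riemann_zeta: "is_riemann_zeta riemann_zeta"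
  using theI'[OF riemann_zeta_ex1] by (simp add: riemann_zeta_def)

end

theory Submission
  imports Defs "HOL-Number_Theory.Prime_Powers" "HOL-Real_Asymp.Real_Asymp"
begin

text \<open>Put \<open>\<Lambda> = log\<^sub>2 N\<close>. Resonance: let \<open>R(t)\<close> be the Dirichlet series of a completely multiplicative
  weight \<open>r\<close> with \<open>r p = 1 - \<Lambda>\<^sup>-\<^sup>2\<close> for the primes \<open>p \<le> Y = log N / \<Lambda>\<close> and \<open>r p = 0\<close> otherwise. Averaging
  \<open>\<zeta>\<^sup>(\<^sup>j\<^sup>)(\<sigma> + i\<alpha>l)\<close> against \<open>\<bar>R(\<alpha>l)\<bar>\<^sup>2\<close> with Fejer weights in \<open>l\<close>, whose Fourier transform is nonnegative, and
  discarding positive terms shows that the maximum is at least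
  \<open>\<Sum> (log n)\<^sup>j r(n) n\<^sup>-\<^sup>\<sigma>\<close> over \<open>Y\<close>-smooth \<open>n\<close>, up to a negligible error; no upper bound for the mean square
  of \<open>R\<close> is needed.

  The sum is a \<open>j\<close>-th derivative of the Euler product \<open>F\<close> over \<open>p \<le> Y\<close>. The function
  \<open>H(w) = F(1 + w/\<Lambda>) / \<Lambda>\<close> has logarithmic derivative \<open>-(1 - e\<^sup>-\<^sup>w)/w\<close> up to a power of \<open>log \<Lambda>\<close> over \<open>\<Lambda>\<close>, by
  \<open>\<Sum>\<^sub>p\<^sub>\<le>\<^sub>x log p / p = log x + O(1)\<close>, and the Laplace transform of the Dickman function has exactly this
  logarithmic derivative. Both are close to \<open>(1 - e\<^sup>-\<^sup>S)/S\<close> at \<open>S = log \<Lambda>\<close>, so they agree near \<open>w = -A\<close> up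
  to a power of \<open>log \<Lambda>\<close> over \<open>\<Lambda>\<close>. Cauchy's inequality costs a factor \<open>j!\<close>, and \<open>j \<le> log\<^sub>3 N / log\<^sub>4 N\<close> is
  precisely what makes \<open>j! / \<Lambda>\<close> small.\<close>

subsection \<open>Euler products over finitely many primes\<close>

text \<open>The prime value \<open>1 - 1 / \<Lambda>^2\<close> answers two demands. It is below 1,
  so \<open>r\<close> itself is summable, with sum at most \<open>\<Lambda>^(2 Y) = N^o(1)\<close>;
  the differences \<open>|l| < sqrt N\<close>, for which the maximum says nothing, then cost only
  \<open>N^(-1/2 + o(1))\<close> by trivial bounds. And it is so close to 1 that replacing
  \<open>r n\<close> by 1 for \<open>n \<le> Y\<close> changes the harmonic sum by O(1). Dividing
  \<open>log N\<close> by \<Lambda> is what makes the powers with exponent \<open>Y\<close> small,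
  and it only shifts \<open>log Y\<close> from \<Lambda> by \<open>O(log \<Lambda>)\<close>, which
  is invisible after rescaling. Equal logarithmic derivatives leave a constant factor open, and it
  has to be fixed at a point where both functions are explicit. On the positive axis the part of the
  series beyond \<open>Y\<close> weighs about \<open>exp (-S)\<close>, so the point \<open>S\<close>
  must move to the right; but the error in the logarithmic derivative accumulates along the way back
  to \<open>-A\<close>. With \<open>S = log \<Lambda>\<close> the first error is
  \<open>1 / \<Lambda>\<close> and the second only a power of \<open>log \<Lambda>\<close> over
  \<Lambda>.\<close>

text \<open>The prime factorization of 0 is empty, so without the case split the value at 0 would be
  1: complete multiplicativity would fail there, and 0 would enter the sums over all
  naturals.\<close>

definition mult_ext :: "(nat \<Rightarrow> 'a :: comm_semiring_1) \<Rightarrow> nat \<Rightarrow> 'a" where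
  "mult_ext g n = (if n = 0 then 0 else prod_mset (image_mset g (prime_factorization n)))"

lemma mult_ext_0 [simp]: "mult_ext g 0 = 0"
  and mult_ext_1 [simp]: "mult_ext g (Suc 0) = 1"
  by (simp_all add: mult_ext_def)

lemma mult_ext_mult: "mult_ext g (m * n) = mult_ext g m * mult_ext g n"
  by (auto simp: mult_ext_def prime_factorization_mult)

lemma mult_ext_prime: "prime p \<Longrightarrow> mult_ext g p = g p"
  by (auto simp: mult_ext_def prime_factorization_prime)

lemma mult_ext_power: "mult_ext g (n ^ k) = mult_ext g n ^ k"
  by (induction k) (simp_all add: mult_ext_mult)

lemma mult_ext_cong:
  assumes "\<And>p. prime p \<Longrightarrow> p dvd n \<Longrightarrow> g p = h p"
  shows "mult_ext g n = mult_ext h n"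
  unfolding mult_ext_def using assms
  by (auto intro!: arg_cong[of _ _ prod_mset] image_mset_cong simp: in_prime_factors_iff)

lemma mult_ext_eq_0:
  assumes "prime p" "p dvd n" "g p = 0"
  shows "mult_ext g n = 0"
  using assms by (elim dvdE) (simp add: mult_ext_mult mult_ext_prime)

lemma mult_ext_times_powr:
  fixes g :: "nat \<Rightarrow> complex"
  assumes "n > 0"
  shows "mult_ext (\<lambda>p. g p * of_nat p powr s) n = mult_ext g n * of_nat n powr s"
proof -
  have "prod_mset (image_mset (\<lambda>p. of_nat p powr s) A) = of_nat (prod_mset A) powr s" for A :: "nat multiset"
    by (induction A) (simp_all add: powr_times_real)
  hence "prod_mset (image_mset (\<lambda>p. of_nat p powr s) (prime_factorization n)) = of_nat n powr s"
    using assms by (simp add: prod_mset_prime_factorization)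
  thus ?thesis using assms by (simp add: mult_ext_def prod_mset.distrib)
qed

lemma mult_ext_of_real:
  "of_real (mult_ext g n) = (mult_ext (\<lambda>p. of_real (g p)) n :: 'a :: {real_algebra_1, comm_semiring_1})"
proof -
  have "of_real (prod_mset (image_mset g A)) = (prod_mset (image_mset (\<lambda>p. of_real (g p)) A) :: 'a)" for A
    by (induction A) auto
  thus ?thesis by (simp add: mult_ext_def)
qed

lemma mult_ext_nonneg:
  fixes g :: "nat \<Rightarrow> real"
  assumes "\<And>p. g p \<ge> 0"
  shows "mult_ext g n \<ge> 0"
proof -
  have "prod_mset (image_mset g A) \<ge> 0" for A using assms by (induction A) auto
  thus ?thesis by (simp add: mult_ext_def)
qed

lemma mult_ext_le_1:
  fixes g :: "nat \<Rightarrow> real"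
  assumes "\<And>p. g p \<ge> 0" "\<And>p. g p \<le> 1"
  shows "mult_ext g n \<le> 1"
proof -
  have "prod_mset (image_mset g A) \<ge> 0 \<and> prod_mset (image_mset g A) \<le> 1" for A
    using assms by (induction A) (auto intro: mult_le_one)
  thus ?thesis by (simp add: mult_ext_def)
qed

text \<open>Summability over the complex numbers is absolute; this makes the double family summable
  and lets Fubini apply.\<close>

lemma has_sum_Times:
  fixes f :: "'a \<Rightarrow> complex" and g :: "'b \<Rightarrow> complex"
  assumes f: "(f has_sum a) A" and g: "(g has_sum b) B"
  shows "((\<lambda>(x, y). f x * g y) has_sum (a * b)) (A \<times> B)"
proof (rule has_sum_SigmaI)
  show "((\<lambda>y. case (x, y) of (x, y) \<Rightarrow> f x * g y) has_sum f x * b) B" for x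
    using has_sum_cmult_right[OF g] by simp
  show "((\<lambda>x. f x * b) has_sum a * b) A" by (rule has_sum_cmult_left[OF f])
  have fs: "(\<lambda>x. norm (f x)) summable_on A" and gs: "(\<lambda>y. norm (g y)) summable_on B"
    using f g by (auto simp: summable_on_iff_abs_summable_on_complex[symmetric] summable_on_def)
  have "(\<lambda>z. norm (case z of (x, y) \<Rightarrow> f x * g y)) summable_on A \<times> B"
  proof (subst Infinite_Sum.abs_summable_on_Sigma_iff, intro conjI ballI)
    show "(\<lambda>y. norm (case (x, y) of (x, y) \<Rightarrow> f x * g y)) summable_on B" for x
      using summable_on_cmult_right[OF gs] by (simp add: norm_mult)
    have "(\<lambda>x. norm (norm (f x) * infsum (\<lambda>y. norm (g y)) B)) summable_on A"
      using summable_on_cmult_left[OF fs, of "infsum (\<lambda>y. norm (g y)) B"]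
      by (simp add: norm_mult infsum_nonneg)
    thus "(\<lambda>x. norm (\<Sum>\<^sub>\<infinity>y\<in>B. norm (case (x, y) of (x, y) \<Rightarrow> f x * g y))) summable_on A"
      by (simp add: norm_mult infsum_cmult_right')
  qed
  thus "(\<lambda>(x, y). f x * g y) summable_on A \<times> B" by (rule Infinite_Sum.abs_summable_summable)
qed

lemma has_sum_geometric_complex:
  assumes "cmod z < 1"
  shows "((\<lambda>k. z ^ k) has_sum (1 / (1 - z))) UNIV"
proof -
  have "summable (\<lambda>k. norm (z ^ k))" using assms by (simp add: norm_power summable_geometric)
  from norm_summable_imp_has_sum[OF this geometric_sums[OF assms]] show ?thesis .
qed

text \<open>Unique factorization, one prime at a time: the numbers not divisible by \<open>p\<close>
  carry the product over \<open>P\<close>, and \<open>n = p^k * m\<close> splits off the geometric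
  series of \<open>g p\<close>. The induction runs over all \<open>g\<close>, since dropping
  \<open>p\<close> means setting \<open>g p\<close> to 0.\<close>

lemma euler_product_finite:
  fixes g :: "nat \<Rightarrow> complex"
  assumes "finite P" "\<And>p. p \<in> P \<Longrightarrow> prime p \<and> cmod (g p) < 1" "\<And>p. prime p \<Longrightarrow> p \<notin> P \<Longrightarrow> g p = 0"
  shows "(mult_ext g has_sum (\<Prod>p\<in>P. 1 / (1 - g p))) UNIV"
  using assms
proof (induction P arbitrary: g rule: finite_induct)
  case empty
  have "mult_ext g n = 0" if "n \<noteq> 1" for n
  proof (cases "n = 0")
    case False
    then obtain p where "prime p" "p dvd n" using \<open>n \<noteq> 1\<close> prime_factor_nat by blast
    thus ?thesis using empty mult_ext_eq_0 by blast
  qed auto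
  moreover have "(mult_ext g has_sum 1) {1}"
    by (simp add: has_sum_finite_iff)
  ultimately show ?case by (subst has_sum_cong_neutral[of "{1}" UNIV _ "mult_ext g"]) auto
next
  case (insert p P)
  define h where "h = g(p := 0)"
  define M where "M = {m. m > 0 \<and> \<not> p dvd m}"
  have p: "prime p" using insert by auto
  have hp: "h p = 0" by (simp add: h_def)
  have hm: "mult_ext h m = mult_ext g m" if "m \<in> M" for m
    using that by (intro mult_ext_cong) (auto simp: h_def M_def)
  have "(mult_ext h has_sum (\<Prod>p\<in>P. 1 / (1 - h p))) UNIV"
    using insert.prems insert.hyps by (intro insert.IH) (auto simp: h_def)
  also have "(\<Prod>p\<in>P. 1 / (1 - h p)) = (\<Prod>p\<in>P. 1 / (1 - g p))"
    using insert.hyps by (intro prod.cong) (auto simp: h_def)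
  also have "(mult_ext h has_sum (\<Prod>p\<in>P. 1 / (1 - g p))) UNIV \<longleftrightarrow> (mult_ext g has_sum (\<Prod>p\<in>P. 1 / (1 - g p))) M"
    by (intro has_sum_cong_neutral) (use mult_ext_eq_0[OF p, of _ h] hm in \<open>auto simp: M_def hp\<close>)
  finally have "((\<lambda>(k, m). g p ^ k * mult_ext g m) has_sum (1 / (1 - g p) * (\<Prod>p\<in>P. 1 / (1 - g p)))) (UNIV \<times> M)"
    using insert.prems by (intro has_sum_Times has_sum_geometric_complex) auto
  also have "1 / (1 - g p) * (\<Prod>p\<in>P. 1 / (1 - g p)) = (\<Prod>p\<in>insert p P. 1 / (1 - g p))"
    using insert.hyps by simp
  finally have *: "((\<lambda>(k, m). g p ^ k * mult_ext g m) has_sum (\<Prod>p\<in>insert p P. 1 / (1 - g p))) (UNIV \<times> M)" .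
  have "((\<lambda>(k, m). g p ^ k * mult_ext g m) has_sum (\<Prod>p\<in>insert p P. 1 / (1 - g p))) (UNIV \<times> M) \<longleftrightarrow>
        (mult_ext g has_sum (\<Prod>p\<in>insert p P. 1 / (1 - g p))) {0<..}"
  proof (rule has_sum_reindex_bij_witness[of _ "\<lambda>n. (multiplicity p n, n div p ^ multiplicity p n)" "\<lambda>(k, m). p ^ k * m"])
    fix x assume "x \<in> (UNIV :: nat set) \<times> M"
    then obtain k m where x: "x = (k, m)" "m > 0" "\<not> p dvd m" by (auto simp: M_def)
    have "multiplicity p (p ^ k * m) = k"
      using p x by (intro multiplicity_eqI) (auto simp: prime_gt_0_nat)
    thus "(\<lambda>n. (multiplicity p n, n div p ^ multiplicity p n)) (case x of (k, m) \<Rightarrow> p ^ k * m) = x"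
      using p x by (auto simp: prime_gt_0_nat)
    show "(case x of (k, m) \<Rightarrow> p ^ k * m) \<in> {0<..}" using x p by (auto simp: prime_gt_0_nat)
    show "mult_ext g (case x of (k, m) \<Rightarrow> p ^ k * m) = (case x of (k, m) \<Rightarrow> g p ^ k * mult_ext g m)"
      using x p by (simp add: mult_ext_mult mult_ext_power mult_ext_prime)
  next
    fix n :: nat assume n: "n \<in> {0<..}"
    show "(case (multiplicity p n, n div p ^ multiplicity p n) of (k, m) \<Rightarrow> p ^ k * m) = n"
      by (simp add: multiplicity_dvd)
    have "\<not> p dvd n div p ^ multiplicity p n"
      using n p by (intro multiplicity_decompose) (auto)
    moreover have "n div p ^ multiplicity p n > 0"
      using n p by (simp add: div_greater_zero_iff multiplicity_dvd dvd_imp_le prime_gt_0_nat)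
    ultimately show "(multiplicity p n, n div p ^ multiplicity p n) \<in> UNIV \<times> M" by (simp add: M_def)
  qed (rule refl)
  also have "\<dots> \<longleftrightarrow> (mult_ext g has_sum (\<Prod>p\<in>insert p P. 1 / (1 - g p))) UNIV"
    by (intro has_sum_cong_neutral) auto
  finally show ?case using * by (rule iffD1)
qed

subsection \<open>The resonance inequality\<close>

text \<open>\<open>L\<close> times the classical Fejer kernel. The cosine form keeps the difference
  \<open>k - k'\<close> visible, which becomes the integer \<open>l\<close> at which zeta is
  evaluated.\<close>

definition fejer :: "nat \<Rightarrow> real \<Rightarrow> real" where
  "fejer L t = (\<Sum>k<L. \<Sum>k'<L. cos ((real k - real k') * t))"

lemma fejer_eq_norm_square: "fejer L t = (cmod (\<Sum>k<L. cis (real k * t)))\<^sup>2"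
proof -
  have "complex_of_real ((cmod (\<Sum>k<L. cis (real k * t)))\<^sup>2) =
          (\<Sum>k<L. cis (real k * t)) * cnj (\<Sum>k<L. cis (real k * t))"
    by (simp only: complex_norm_square)
  also have "\<dots> = (\<Sum>k<L. \<Sum>k'<L. cis ((real k - real k') * t))"
    by (simp add: sum_product cis_cnj cis_mult algebra_simps)
  finally have "Re (complex_of_real ((cmod (\<Sum>k<L. cis (real k * t)))\<^sup>2)) = fejer L t"
    by (simp only: Re_sum fejer_def cis.sel)
  thus ?thesis by simp
qed

lemma fejer_nonneg: "fejer L t \<ge> 0"
  by (simp add: fejer_eq_norm_square)

lemma fejer_0 [simp]: "fejer L 0 = real L ^ 2"
  by (simp add: fejer_def power2_eq_square)

lemma sum_cis_eq_fejer: "(\<Sum>k<L. \<Sum>k'<L. cis ((real k - real k') * t)) = of_real (fejer L t)"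
proof -
  have "(\<Sum>k<L. \<Sum>k'<L. cis ((real k - real k') * t)) = (\<Sum>k<L. cis (real k * t)) * cnj (\<Sum>k<L. cis (real k * t))"
    by (simp add: sum_product cis_cnj cis_mult algebra_simps)
  also have "\<dots> = of_real (fejer L t)"
    by (simp only: complex_norm_square fejer_eq_norm_square)
  finally show ?thesis .
qed

text \<open>For fixed \<open>k\<close> the difference \<open>k' - k\<close> is an integer strictly
  between minus and plus the ceiling of \<open>T\<close>, which leaves at most
  \<open>2 * T + 1\<close> values.\<close>

lemma card_close_pairs_le:
  fixes T :: real
  assumes "T \<ge> 0"
  shows "real (card {(k, k'). k < L \<and> k' < L \<and> \<bar>real k - real k'\<bar> < T}) \<le> real L * (2 * T + 1)"
proof -
  define m where "m = nat \<lceil>T\<rceil>"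
  have sub: "{(k, k'). k < L \<and> k' < L \<and> \<bar>real k - real k'\<bar> < T} \<subseteq>
    (\<lambda>(k, d). (k, nat (int k + d))) ` ({..<L} \<times> {d. \<bar>real_of_int d\<bar> < T})"
  proof clarify
    fix k k' assume "k < L" "k' < L" "\<bar>real k - real k'\<bar> < T"
    thus "(k, k') \<in> (\<lambda>(k, d). (k, nat (int k + d))) ` ({..<L} \<times> {d. \<bar>real_of_int d\<bar> < T})"
      by (intro image_eqI[of _ _ "(k, int k' - int k)"]) auto
  qed
  have eq: "{d. \<bar>real_of_int d\<bar> < T} = {- \<lceil>T\<rceil> <..< \<lceil>T\<rceil>}"
    by (auto simp: less_ceiling_iff abs_less_iff) (linarith | auto)+
  have "card {(k, k'). k < L \<and> k' < L \<and> \<bar>real k - real k'\<bar> < T} \<le> card ({..<L} \<times> {d. \<bar>real_of_int d\<bar> < T})"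
    using sub unfolding eq by (rule surj_card_le[rotated]) auto
  also have "\<dots> = L * nat (2 * \<lceil>T\<rceil> - 1)"
    unfolding eq by (simp add: card_cartesian_product algebra_simps)
  finally have "real (card {(k, k'). k < L \<and> k' < L \<and> \<bar>real k - real k'\<bar> < T}) \<le> real (L * nat (2 * \<lceil>T\<rceil> - 1))"
    by (simp only: of_nat_le_iff)
  also have "\<dots> = real L * real (nat (2 * \<lceil>T\<rceil> - 1))" by simp
  also have "real (nat (2 * \<lceil>T\<rceil> - 1)) \<le> 2 * T + 1"
    using assms by linarith
  finally show ?thesis by (simp add: mult_left_mono)
qed

lemma has_sum_sum:
  fixes f :: "'i \<Rightarrow> 'a \<Rightarrow> 'b :: {topological_comm_monoid_add}"
  assumes "\<And>i. i \<in> I \<Longrightarrow> (f i has_sum s i) A"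
  shows "((\<lambda>x. \<Sum>i\<in>I. f i x) has_sum (\<Sum>i\<in>I. s i)) A"
  using assms by (induction I rule: infinite_finite_induct) (auto intro!: has_sum_add)

text \<open>Complete multiplicativity lets a term of a Dirichlet polynomial be absorbed into the
  weight, \<open>r 1 = 1\<close> bounds the total mass from below, and \<open>r 0 = 0\<close>
  silences the index 0, where \<open>ln\<close> has a default value.\<close>

locale resonator =
  fixes r :: "nat \<Rightarrow> real" and \<alpha> :: real
  assumes r_nonneg: "r n \<ge> 0" and r_1: "r 1 = 1" and r_0: "r 0 = 0"
    and r_mult: "r (m * n) = r m * r n"
    and r_summable: "r summable_on UNIV"
begin

text \<open>The Dirichlet series of \<open>r\<close> at the imaginary point
  \<open>i * \<alpha> * l\<close>; the \<open>cis\<close> factor is \<open>m\<close> to the power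
  \<open>- i * \<alpha> * l\<close>.\<close>

definition R :: "int \<Rightarrow> complex" where
  "R l = (\<Sum>\<^sub>\<infinity>m. of_real (r m) * cis (- \<alpha> * of_int l * ln (real m)))"

text \<open>The contribution of the pair \<open>(m, m')\<close> when the sum of
  \<open>n^(- i \<alpha> (k - k')) * |R (k - k')|^2\<close> over all \<open>k, k' < L\<close> is
  multiplied out.\<close>

definition weight :: "nat \<Rightarrow> nat \<Rightarrow> nat \<times> nat \<Rightarrow> real" where
  "weight L n = (\<lambda>(m, m'). r m * r m' * fejer L (\<alpha> * (ln n + ln m - ln m')))"

lemma has_sum_R:
  "((\<lambda>m. of_real (r m) * cis (- \<alpha> * of_int l * ln (real m))) has_sum R l) UNIV"
proof -
  have "(\<lambda>m. norm (of_real (r m) * cis (- \<alpha> * of_int l * ln (real m)))) summable_on UNIV"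
    using r_summable by (simp add: norm_mult r_nonneg)
  hence "(\<lambda>m. of_real (r m) * cis (- \<alpha> * of_int l * ln (real m))) summable_on UNIV"
    by (rule Infinite_Sum.abs_summable_summable)
  thus ?thesis unfolding R_def by (rule has_sum_infsum)
qed

lemma norm_R_le: "cmod (R l) \<le> infsum r UNIV"
proof (rule norm_infsum_le[OF has_sum_R])
  show "(r has_sum infsum r UNIV) UNIV" using r_summable by (rule has_sum_infsum)
qed (simp add: norm_mult r_nonneg)

lemma has_sum_norm_R_square:
  "((\<lambda>(m, m'). of_real (r m * r m') * cis (- \<alpha> * of_int l * (ln (real m) - ln (real m')))) has_sum
      of_real (cmod (R l) ^ 2)) UNIV"
proof -
  have "((\<lambda>m. cnj (of_real (r m) * cis (- \<alpha> * of_int l * ln (real m)))) has_sum cnj (R l)) UNIV"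
    using has_sum_R by (subst has_sum_cnj_iff)
  from has_sum_Times[OF has_sum_R this]
  have "((\<lambda>(m, m'). of_real (r m) * cis (- \<alpha> * of_int l * ln (real m)) *
          cnj (of_real (r m') * cis (- \<alpha> * of_int l * ln (real m')))) has_sum (R l * cnj (R l))) UNIV"
    by simp
  also have "(\<lambda>(m, m'). of_real (r m) * cis (- \<alpha> * of_int l * ln (real m)) *
          cnj (of_real (r m') * cis (- \<alpha> * of_int l * ln (real m')))) =
      (\<lambda>(m, m'). of_real (r m * r m') * cis (- \<alpha> * of_int l * (ln (real m) - ln (real m'))))"
    by (auto simp: fun_eq_iff cis_cnj cis_mult algebra_simps)
  finally show ?thesis by (simp only: complex_norm_square)
qed

lemma has_sum_weight:
  assumes "n > 0"
  shows "((\<lambda>x. complex_of_real (weight L n x)) has_sum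
    (\<Sum>k<L. \<Sum>k'<L. cis (- \<alpha> * of_int (int k - int k') * ln n) * of_real (cmod (R (int k - int k')) ^ 2))) UNIV"
proof -
  have "((\<lambda>x. \<Sum>k<L. \<Sum>k'<L. cis (- \<alpha> * of_int (int k - int k') * ln n) *
      (\<lambda>(m, m'). of_real (r m * r m') * cis (- \<alpha> * of_int (int k - int k') * (ln (real m) - ln (real m')))) x) has_sum
    (\<Sum>k<L. \<Sum>k'<L. cis (- \<alpha> * of_int (int k - int k') * ln n) * of_real (cmod (R (int k - int k')) ^ 2))) UNIV"
    by (intro has_sum_sum has_sum_cmult_right has_sum_norm_R_square)
  moreover have "(\<Sum>k<L. \<Sum>k'<L. cis (- \<alpha> * of_int (int k - int k') * ln n) *
      (\<lambda>(m, m'). of_real (r m * r m') * cis (- \<alpha> * of_int (int k - int k') * (ln (real m) - ln (real m')))) x) =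
    complex_of_real (weight L n x)" for x
  proof (cases x)
    case (Pair m m')
    have "(\<Sum>k<L. \<Sum>k'<L. cis (- \<alpha> * of_int (int k - int k') * ln n) *
      (of_real (r m * r m') * cis (- \<alpha> * of_int (int k - int k') * (ln (real m) - ln (real m'))))) =
      of_real (r m * r m') * (\<Sum>k<L. \<Sum>k'<L. cis ((real k - real k') * (- \<alpha> * (ln n + ln m - ln m'))))"
      unfolding sum_distrib_left
    proof (intro sum.cong refl)
      fix k k'
      have "cis ((real k - real k') * (- \<alpha> * (ln n + ln m - ln m'))) =
        cis (- \<alpha> * of_int (int k - int k') * ln n) * cis (- \<alpha> * of_int (int k - int k') * (ln (real m) - ln (real m')))"
        by (simp add: cis_mult algebra_simps)
      thus "cis (- \<alpha> * of_int (int k - int k') * ln n) *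
        (of_real (r m * r m') * cis (- \<alpha> * of_int (int k - int k') * (ln (real m) - ln (real m')))) =
        of_real (r m * r m') * cis ((real k - real k') * (- \<alpha> * (ln n + ln m - ln m')))"
        by simp
    qed
    also have "(\<Sum>k<L. \<Sum>k'<L. cis ((real k - real k') * (- \<alpha> * (ln n + ln m - ln m')))) =
        of_real (fejer L (\<alpha> * (ln n + ln m - ln m')))"
      \<comment> \<open>The kernel is even, so the sign in front of \<alpha> disappears.\<close>
      unfolding sum_cis_eq_fejer by (simp add: fejer_def)
    finally show ?thesis using Pair by (simp add: weight_def)
  qed
  ultimately show ?thesis by simp
qed

lemma weight_nonneg: "weight L n x \<ge> 0"
  by (auto simp: weight_def case_prod_unfold r_nonneg fejer_nonneg)

lemma weight_summable: "n > 0 \<Longrightarrow> weight L n summable_on UNIV"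
  using has_sum_imp_summable[OF has_sum_weight[of n L]] weight_nonneg
  by (simp add: summable_on_iff_abs_summable_on_complex)

lemma of_real_infsum_weight:
  assumes "n > 0"
  shows "complex_of_real (infsum (weight L n) UNIV) =
    (\<Sum>k<L. \<Sum>k'<L. cis (- \<alpha> * of_int (int k - int k') * ln n) * of_real (cmod (R (int k - int k')) ^ 2))"
proof -
  have "((\<lambda>x. complex_of_real (weight L n x)) has_sum of_real (infsum (weight L n) UNIV)) UNIV"
    using weight_summable[OF assms, of L] by (intro has_sum_of_real has_sum_infsum)
  thus ?thesis using has_sum_weight[OF assms, of L] has_sum_unique by blast
qed

text \<open>Keeping only the pairs \<open>(m, n k)\<close> costs nothing but the factor \<open>r n\<close>, by complete
  multiplicativity and positivity of the Fejer kernel.\<close>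

lemma infsum_weight_ge:
  assumes "n > 0"
  shows "r n * infsum (weight L 1) UNIV \<le> infsum (weight L n) UNIV"
proof -
  have inj: "inj_on (\<lambda>(m, k). (m, n * k)) UNIV" using assms by (auto simp: inj_on_def)
  have w: "weight L n (m, n * k) = r n * weight L 1 (m, k)" for m k
  proof (cases "k = 0")
    case False
    hence "ln (real (n * k)) = ln (real n) + ln (real k)" using assms by (simp add: ln_mult)
    thus ?thesis using r_mult[of n k] by (simp add: weight_def)
  qed (simp add: weight_def r_0)
  have "r n * infsum (weight L 1) UNIV = infsum (\<lambda>x. r n * weight L 1 x) UNIV"
    by (rule infsum_cmult_right[symmetric]) (use weight_summable[of 1] in auto)
  also have "(\<lambda>x. r n * weight L 1 x) = weight L n \<circ> (\<lambda>(m, k). (m, n * k))"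
    by (auto simp: fun_eq_iff w)
  also have "infsum \<dots> UNIV = infsum (weight L n) (range (\<lambda>(m, k). (m, n * k)))"
    by (rule infsum_reindex[OF inj, symmetric])
  also have "\<dots> \<le> infsum (weight L n) UNIV"
    by (intro infsum_mono_neutral weight_summable assms summable_on_subset_banach[OF weight_summable[OF assms]])
       (auto simp: weight_nonneg)
  finally show ?thesis .
qed

text \<open>The pair \<open>(1, 1)\<close> alone contributes the value of the kernel at 0. This
  turns the absolute error of the close pairs into a multiple of the total mass.\<close>

lemma infsum_weight_1_ge: "real L ^ 2 \<le> infsum (weight L 1) UNIV"
proof -
  have "real L ^ 2 = infsum (weight L 1) {(1, 1)}" using r_1 by (simp add: weight_def)
  also have "\<dots> \<le> infsum (weight L 1) UNIV"
    using weight_summable[of 1 L] by (intro infsum_mono_neutral) (auto simp: weight_nonneg)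
  finally show ?thesis .
qed

text \<open>The polynomial is summed against the weights \<open>|R (k - k')|^2\<close> of total mass
  \<open>W\<close>. From below, each coefficient gains at least \<open>r n * W\<close>. From above,
  pairs at distance at least \<open>T\<close> give at most \<open>V\<close> times their mass, and
  the few closer pairs are bounded trivially. Division by \<open>W\<close> ends the proof. The
  differences are signed, so the bound is also asked for negative \<open>l\<close>.\<close>

lemma resonance_inequality:
  fixes a :: "nat \<Rightarrow> real" and L X :: nat and T V :: real
  assumes a: "\<And>n. a n \<ge> 0" and L: "L > 0" and T: "T \<ge> 0" and V: "V \<ge> 0"
    and bound: "\<And>l :: int. T \<le> \<bar>of_int l\<bar> \<Longrightarrow> \<bar>l\<bar> < int L \<Longrightarrow>
       cmod (\<Sum>n=1..X. of_real (a n) * cis (- \<alpha> * of_int l * ln (real n))) \<le> V"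
  shows "(\<Sum>n=1..X. a n * r n) \<le> V + (2 * T + 1) / real L * (\<Sum>n=1..X. a n) * (infsum r UNIV)\<^sup>2"
proof -
  define W where "W = infsum (weight L 1) UNIV"
  define P where "P = (\<lambda>l::int. \<Sum>n=1..X. of_real (a n) * cis (- \<alpha> * of_int l * ln (real n)))"
  define Q where "Q = (\<lambda>l::int. cmod (R l) ^ 2)"
  define B where "B = (\<Sum>n=1..X. a n) * (infsum r UNIV)\<^sup>2"
  define close where "close = {(k, k'). k < L \<and> k' < L \<and> \<bar>real k - real k'\<bar> < T}"
  have close_fin: "finite close"
    by (rule finite_subset[of _ "{..<L} \<times> {..<L}"]) (auto simp: close_def)
  have W_ge: "W \<ge> real L ^ 2" unfolding W_def by (rule infsum_weight_1_ge)
  have W_eq: "W = (\<Sum>k<L. \<Sum>k'<L. Q (int k - int k'))"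
  proof -
    have "complex_of_real W = of_real (\<Sum>k<L. \<Sum>k'<L. Q (int k - int k'))"
      unfolding W_def by (subst of_real_infsum_weight) (simp_all add: Q_def)
    thus ?thesis by (simp only: of_real_eq_iff)
  qed
  have P_le: "cmod (P l) \<le> (\<Sum>n=1..X. a n)" for l
    unfolding P_def by (rule order_trans[OF norm_sum]) (simp add: norm_mult a)
  have Q_le: "Q l \<le> (infsum r UNIV)\<^sup>2" and Q_nonneg: "Q l \<ge> 0" for l
    unfolding Q_def by (auto intro!: power_mono norm_R_le)
  have B_nonneg: "B \<ge> 0" unfolding B_def by (auto intro!: mult_nonneg_nonneg sum_nonneg a)
  have PQ_le: "cmod (P l * of_real (Q l)) \<le> V * Q l + (if \<bar>of_int l\<bar> < T then B else 0)" if "\<bar>l\<bar> < int L" for l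
  proof (cases "\<bar>of_int l\<bar> < T")
    case True
    have "cmod (P l * of_real (Q l)) \<le> B"
      unfolding B_def using P_le[of l] Q_le[of l] Q_nonneg[of l] by (auto simp: norm_mult intro!: mult_mono sum_nonneg a)
    thus ?thesis using True V Q_nonneg[of l] by (simp add: add_increasing)
  next
    case False
    hence "cmod (P l) \<le> V" unfolding P_def using that by (intro bound) auto
    thus ?thesis using False Q_nonneg[of l] by (simp add: norm_mult mult_right_mono)
  qed
  have "(\<Sum>n=1..X. a n * r n) * W = (\<Sum>n=1..X. a n * (r n * W))"
    by (simp add: sum_distrib_right mult.assoc)
  also have "\<dots> \<le> (\<Sum>n=1..X. a n * infsum (weight L n) UNIV)"
    unfolding W_def by (intro sum_mono mult_left_mono infsum_weight_ge a) auto
  also have "\<dots> = Re (of_real (\<Sum>n=1..X. a n * infsum (weight L n) UNIV))" by simp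
  also have "complex_of_real (\<Sum>n=1..X. a n * infsum (weight L n) UNIV) =
    (\<Sum>n=1..X. of_real (a n) * (\<Sum>k<L. \<Sum>k'<L. cis (- \<alpha> * of_int (int k - int k') * ln n) * of_real (Q (int k - int k'))))"
    unfolding of_real_sum of_real_mult Q_def
    by (intro sum.cong refl) (subst of_real_infsum_weight, auto)
  also have "\<dots> = (\<Sum>k<L. \<Sum>k'<L. P (int k - int k') * of_real (Q (int k - int k')))"
    unfolding P_def sum_distrib_left sum_distrib_right
    by (subst sum.swap, rule sum.cong[OF refl], subst sum.swap) (simp add: mult.assoc)
  also have "Re \<dots> \<le> cmod \<dots>" by (rule complex_Re_le_cmod)
  also have "\<dots> \<le> (\<Sum>k<L. \<Sum>k'<L. V * Q (int k - int k') + (if \<bar>of_int (int k - int k')\<bar> < T then B else 0))"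
    by (intro sum_norm_le PQ_le) auto
  also have "\<dots> = V * W + (\<Sum>(k, k')\<in>{..<L} \<times> {..<L}. if \<bar>real k - real k'\<bar> < T then B else 0)"
    by (simp add: W_eq sum.distrib sum_distrib_left sum.cartesian_product case_prod_unfold)
  also have "(\<Sum>(k, k')\<in>{..<L} \<times> {..<L}. if \<bar>real k - real k'\<bar> < T then B else 0) = (\<Sum>(k, k')\<in>close. B)"
    by (rule sum.mono_neutral_cong_right) (auto simp: close_def split: if_splits)
  also have "\<dots> = real (card close) * B" by (simp add: case_prod_unfold)
  also have "\<dots> \<le> real L * (2 * T + 1) * B"
    unfolding close_def by (intro mult_right_mono card_close_pairs_le T B_nonneg)
  \<comment> \<open>Written with \<open>L^2\<close> so that the lower bound for \<open>W\<close>
    applies.\<close>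
  also have "\<dots> = (2 * T + 1) / real L * B * real L ^ 2" using L by (simp add: power2_eq_square)
  also have "\<dots> \<le> (2 * T + 1) / real L * B * W"
    using W_ge B_nonneg T by (intro mult_left_mono) auto
  finally have "(\<Sum>n=1..X. a n * r n) * W \<le> (V + (2 * T + 1) / real L * B) * W"
    by (simp add: algebra_simps)
  moreover have "W > 0" using W_ge L by (intro less_le_trans[OF _ W_ge]) simp
  ultimately show ?thesis unfolding B_def by (simp add: mult.assoc)
qed

end

subsection \<open>Dirichlet polynomial approximation of zeta\<close>

text \<open>Integral comparison in telescoping form: by the mean value theorem each term is at most
  the difference of consecutive values of \<open>x^(-a) / a\<close>.\<close>

lemma sum_tail_powr_le:
  assumes "a > 0" "M \<ge> 1"
  shows "summable (\<lambda>n. real (Suc (n + M)) powr (-(a + 1)))"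
    and "(\<Sum>n. real (Suc (n + M)) powr (-(a + 1))) \<le> real M powr (-a) / a"
proof -
  define g where "g = (\<lambda>n. real (n + M) powr (-a) / a)"
  have le: "real (Suc (n + M)) powr (-(a + 1)) \<le> g n - g (Suc n)" for n
  proof -
    have "\<exists>z>real (n + M). z < real (Suc (n + M)) \<and>
      real (Suc (n + M)) powr (-a) / (-a) - real (n + M) powr (-a) / (-a) =
        (real (Suc (n + M)) - real (n + M)) * z powr (-a - 1)"
      using assms
      by (intro MVT2[of _ _ "\<lambda>x. x powr (-a) / (-a)"]) (auto intro!: derivative_eq_intros)
    then obtain z where z: "z > real (n + M)" "z < real (Suc (n + M))"
        "real (Suc (n + M)) powr (-a) / (-a) - real (n + M) powr (-a) / (-a) = z powr (-a - 1)"
      by auto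
    have "real (Suc (n + M)) powr (-a - 1) \<le> z powr (-a - 1)"
      using z assms by (intro powr_mono2') auto
    also have "z powr (-a - 1) = g n - g (Suc n)" using z(3) by (simp add: g_def add_ac)
    finally show ?thesis by simp
  qed
  have "g \<longlonglongrightarrow> 0"
    unfolding g_def using assms(1) by real_asymp
  hence sums: "(\<lambda>n. g n - g (Suc n)) sums (g 0 - 0)"
    by (rule telescope_sums')
  have summ: "summable (\<lambda>n. real (Suc (n + M)) powr (-(a + 1)))"
    by (rule summable_comparison_test[OF _ sums_summable[OF sums]]) (use le in auto)
  show "(\<Sum>n. real (Suc (n + M)) powr (-(a + 1))) \<le> real M powr (-a) / a"
    using suminf_le[OF le summ sums_summable[OF sums]] sums_unique[OF sums] by (simp add: g_def)
  show "summable (\<lambda>n. real (Suc (n + M)) powr (-(a + 1)))" by (fact summ)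
qed

lemma zterm_const:
  assumes "s \<noteq> 1"
  shows "zterm (\<lambda>_. 1) n s = (of_nat (Suc n) powr (-(s - 1)) - of_nat (Suc (Suc n)) powr (-(s - 1))) / (s - 1)"
proof -
  have "((\<lambda>t. of_real (real (Suc n) + t) powr (-s)) has_integral
         (-1 / (s - 1) * of_real (real (Suc n) + 1) powr (-(s - 1))
          - -1 / (s - 1) * of_real (real (Suc n) + 0) powr (-(s - 1)))) {0..1}"
  proof (rule fundamental_theorem_of_calculus)
    fix t :: real assume "t \<in> {0..1}"
    hence "((\<lambda>t. -1 / (s - 1) * of_real (real (Suc n) + t) powr (-(s - 1)))
      has_vector_derivative -1 / (s - 1) * - ((s - 1) * of_real (real (Suc n) + t) powr (-(s-1) - 1))) (at t)"
      by (intro has_vector_derivative_mult_right powr_antideriv) auto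
    thus "((\<lambda>t. -1 / (s - 1) * of_real (real (Suc n) + t) powr (-(s - 1)))
      has_vector_derivative of_real (real (Suc n) + t) powr (-s)) (at t within {0..1})"
      using assms by (simp add: has_vector_derivative_at_within)
  qed auto
  thus ?thesis
    unfolding zterm_def of_real_1 mult_1_left
    by (subst integral_unique) (auto simp: add_ac diff_divide_distrib)
qed

text \<open>Integration by parts with the antiderivative \<open>t - 1\<close> of 1: it vanishes at
  the right end, so each unit interval leaves the single boundary term at
  \<open>Suc n\<close>.\<close>

lemma powr_Suc_eq_zterm:
  "of_nat (Suc n) powr (-s) = zterm (\<lambda>_. 1) n s - s * zterm (\<lambda>t. t - 1) n (s + 1)"
  by (subst zterm_parts[of _ "\<lambda>t. t - 1"]) (auto intro!: continuous_intros derivative_eq_intros)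

lemma sum_powr_eq_zterm:
  assumes "s \<noteq> 1"
  shows "(\<Sum>n<M. of_nat (Suc n) powr (-s)) =
    (1 - of_nat (Suc M) powr (1 - s)) / (s - 1) - s * (\<Sum>n<M. zterm (\<lambda>t. t - 1) n (s + 1))"
proof -
  have "(\<Sum>n<M. of_nat (Suc n) powr (1 - s) - of_nat (Suc (Suc n)) powr (1 - s)) =
    1 - of_nat (Suc M) powr (1 - s)"
    by (subst sum_lessThan_telescope') simp
  thus ?thesis unfolding powr_Suc_eq_zterm using assms
    by (simp add: sum_subtractf sum_distrib_left zterm_const sum_divide_distrib[symmetric] del: of_nat_Suc)
qed

lemma tendsto_powr_Suc_0:
  assumes "Re z > 0"
  shows "(\<lambda>n. of_nat (Suc n) powr (-z)) \<longlonglongrightarrow> (0 :: complex)"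
  using assms by (intro tendsto_neg_powr_complex_of_nat filterlim_Suc) auto

text \<open>For \<open>Re s > 1\<close> this is the limit of the formula for partial sums. The
  series at \<open>s + 1\<close> is holomorphic for \<open>Re s > 0\<close>, and the identity
  theorem extends the formula to that half-plane.\<close>

lemma zeta_eq_zterm:
  assumes "Re s > 0" "s \<noteq> 1"
  shows "summable (\<lambda>n. zterm (\<lambda>t. t - 1) n (s + 1))"
    and "riemann_zeta s = 1 / (s - 1) - s * (\<Sum>n. zterm (\<lambda>t. t - 1) n (s + 1))"
proof -
  have "continuous_on {0..1} (\<lambda>t. t - 1 :: real)" by (intro continuous_intros)
  then obtain f where f: "f holomorphic_on {s. Re s > 1}"
      "\<And>s. Re s > 1 \<Longrightarrow> (\<lambda>n. zterm (\<lambda>t. t - 1) n s) sums f s"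
    using zterm_sum by blast
  define F where "F = (\<lambda>s. 1 / (s - 1) - s * f (s + 1))"
  have "riemann_zeta s = F s"
  proof (rule zeta_halfplane_unique[of riemann_zeta 0 F s])
    show "F holomorphic_on {s. Re s > 0} - {1}"
      unfolding F_def
      by (intro holomorphic_intros holomorphic_on_compose_gen[OF _ f(1), unfolded o_def]) auto
    show "riemann_zeta holomorphic_on {s. 0 < Re s} - {1}"
      using is_riemann_zeta_riemann_zeta
      by (auto simp: is_riemann_zeta_def elim!: holomorphic_on_subset)
    fix s assume s: "Re s > 1"
    hence s1: "s \<noteq> 1" by auto
    have "(\<lambda>M. (1 - of_nat (Suc M) powr (-(s - 1))) / (s - 1) - s * (\<Sum>n<M. zterm (\<lambda>t. t - 1) n (s + 1)))
      \<longlonglongrightarrow> (1 - 0) / (s - 1) - s * f (s + 1)"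
      using s s1 f(2)[of "s + 1"] unfolding sums_def
      by (intro tendsto_intros tendsto_powr_Suc_0) auto
    hence "(\<lambda>n. of_nat (Suc n) powr (-s)) sums F s"
      unfolding sums_def sum_powr_eq_zterm[OF s1] by (simp add: F_def)
    moreover have "(\<lambda>n. 1 / of_nat (Suc n) powr s) sums riemann_zeta s"
      using is_riemann_zeta_riemann_zeta s by (auto simp: is_riemann_zeta_def)
    ultimately show "riemann_zeta s = F s"
      by (simp add: powr_minus inverse_eq_divide sums_unique2 del: of_nat_Suc)
  qed (use assms in auto)
  with f(2)[of "s + 1"] assms show "summable (\<lambda>n. zterm (\<lambda>t. t - 1) n (s + 1))"
    "riemann_zeta s = 1 / (s - 1) - s * (\<Sum>n. zterm (\<lambda>t. t - 1) n (s + 1))"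
    by (auto simp: F_def sums_iff)
qed

text \<open>Subtracting the finite formula from the infinite one leaves a boundary term and a tail.
  The tail carries the factor \<open>cmod s\<close>, so \<open>M\<close> has to exceed the height by
  a power; hence the later choice of \<open>M\<close> near \<open>N^2\<close>.\<close>

lemma zeta_approx:
  assumes "Re s > 0" "s \<noteq> 1" "M \<ge> 1"
  shows "cmod (riemann_zeta s - (\<Sum>n=1..M. of_nat n powr (-s))) \<le>
    real (Suc M) powr (1 - Re s) / cmod (s - 1) + cmod s * (real M powr (- Re s) / Re s)"
proof -
  define Z where "Z = (\<lambda>n. zterm (\<lambda>t. t - 1) n (s + 1))"
  have sum_eq: "(\<Sum>n=1..M. of_nat n powr (-s)) = (\<Sum>n<M. of_nat (Suc n) powr (-s))"
    by (rule sum.reindex_bij_witness[of _ Suc "\<lambda>n. n - 1"]) auto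
  have bound: "cmod (Z n) \<le> real (Suc n) powr (-(Re s + 1))" for n
    unfolding Z_def using assms
    by (intro order_trans[OF zterm_bound[of _ 1 "Re s + 1"]]) (auto intro!: continuous_intros)
  have "riemann_zeta s - (\<Sum>n=1..M. of_nat n powr (-s)) =
    of_nat (Suc M) powr (1 - s) / (s - 1) - s * (suminf Z - (\<Sum>n<M. Z n))"
    using assms unfolding sum_eq
    by (subst sum_powr_eq_zterm, simp, subst zeta_eq_zterm(2))
       (auto simp: Z_def algebra_simps diff_divide_distrib simp del: of_nat_Suc)
  also have "suminf Z - (\<Sum>n<M. Z n) = (\<Sum>n. Z (n + M))"
    using suminf_minus_initial_segment[OF zeta_eq_zterm(1)[OF assms(1,2)], of M] by (simp add: Z_def)
  also have "cmod (of_nat (Suc M) powr (1 - s) / (s - 1) - s * (\<Sum>n. Z (n + M))) \<le>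
     cmod (of_nat (Suc M) powr (1 - s)) / cmod (s - 1) + cmod s * cmod (\<Sum>n. Z (n + M))"
    by (rule order_trans[OF norm_triangle_ineq4]) (simp add: norm_divide norm_mult)
  also have "cmod (of_nat (Suc M) powr (1 - s)) = real (Suc M) powr (1 - Re s)"
    by (subst norm_powr_real_powr) (auto simp del: of_nat_Suc)
  also have "cmod (\<Sum>n. Z (n + M)) \<le> (\<Sum>n. real (Suc (n + M)) powr (-(Re s + 1)))"
    using assms by (intro norm_suminf_le sum_tail_powr_le bound) auto
  also have "\<dots> \<le> real M powr (- Re s) / Re s"
    using assms by (intro sum_tail_powr_le) auto
  finally show ?thesis by (simp add: mult_left_mono)
qed

section \<open>Higher derivatives of Dirichlet polynomials and of zeta\<close>

text \<open>The affine argument serves two uses: \<open>a = 0\<close>, \<open>b = 1\<close> for zeta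
  itself, and \<open>a = 1\<close>, \<open>b = 1 / \<Lambda>\<close> for the rescaled smooth
  series.\<close>

lemma higher_deriv_nat_powr:
  assumes "n > 0"
  shows "(deriv ^^ j) (\<lambda>s::complex. of_nat n powr (-(a + b * s))) =
    (\<lambda>s. (- b * of_real (ln (real n))) ^ j * of_nat n powr (-(a + b * s)))"
proof (induction j)
  case (Suc j)
  have "((\<lambda>s. (- b * of_real (ln (real n))) ^ j * of_nat n powr (-(a + b * s))) has_field_derivative
     (- b * of_real (ln (real n))) ^ Suc j * of_nat n powr (-(a + b * s))) (at s)" for s
  proof -
    have "((\<lambda>s. -(a + b * s)) has_field_derivative -b) (at s)"
      by (auto intro!: derivative_eq_intros)
    from DERIV_chain2[OF has_field_derivative_powr_right[of "of_nat n"] this]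
    have "((\<lambda>s. of_nat n powr (-(a + b * s))) has_field_derivative
      of_real (ln (real n)) * of_nat n powr (-(a + b * s)) * (-b)) (at s)"
      using assms by (simp add: Ln_of_nat)
    from DERIV_cmult[OF this, of "(- b * of_real (ln (real n))) ^ j"] show ?thesis
      by (simp add: mult_ac)
  qed
  thus ?case by (simp only: funpow.simps o_def Suc) (auto simp: fun_eq_iff intro!: DERIV_imp_deriv)
qed auto

lemma higher_deriv_dirichlet_poly:
  fixes c :: "nat \<Rightarrow> complex"
  assumes "finite I" "\<And>n. n \<in> I \<Longrightarrow> n > 0"
  shows "(deriv ^^ j) (\<lambda>s. \<Sum>n\<in>I. c n * of_nat n powr (-(a + b * s))) s =
    (\<Sum>n\<in>I. c n * (- b * of_real (ln (real n))) ^ j * of_nat n powr (-(a + b * s)))"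
proof -
  have holo: "(\<lambda>s. c n * of_nat n powr (-(a + b * s))) holomorphic_on UNIV" if "n \<in> I" for n
    using assms(2)[OF that] by (intro holomorphic_intros) auto
  show ?thesis using assms(1) subset_refl[of I]
  proof (induction I rule: finite_subset_induct')
    case (insert n J)
    have "(deriv ^^ j) (\<lambda>s. c n * of_nat n powr (-(a + b * s))) s =
        c n * (- b * of_real (ln (real n))) ^ j * of_nat n powr (-(a + b * s))"
      using assms(2)[OF insert.hyps(2)]
      by (subst higher_deriv_cmult[of _ UNIV]) (auto simp: higher_deriv_nat_powr mult.assoc simp del: minus_add_distrib intro!: holomorphic_intros)
    moreover have "(\<lambda>s. \<Sum>n\<in>J. c n * of_nat n powr (-(a + b * s))) holomorphic_on UNIV"
      using insert.hyps(3) by (intro holomorphic_on_sum holo) auto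
    ultimately show ?case using insert holo[of n]
      by (simp add: higher_deriv_add[of _ UNIV])
  qed simp
qed

text \<open>Cauchy's inequality on the circle of radius 1/16 carries \<open>zeta_approx\<close> over
  to derivatives at the price \<open>fact j * 16 ^ j\<close>. The radius keeps \<open>Re z\<close>
  at least 7/8, whence the exponents 1/8 and -7/8, and keeps the circle away from the pole.\<close>

lemma zeta_higher_deriv_approx:
  assumes "Re s \<ge> 15 / 16" "\<bar>Im s\<bar> \<ge> 1" "M \<ge> 1"
  shows "cmod ((deriv ^^ j) riemann_zeta s - (\<Sum>n=1..M. (- of_real (ln (real n))) ^ j * of_nat n powr (-s))) \<le>
    fact j * 16 ^ j * (real (Suc M) powr (1 / 8) * (2 / \<bar>Im s\<bar>) + (cmod s + 1) * (real M powr (-7/8) * 2))"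
proof -
  define P where "P = (\<lambda>s::complex. \<Sum>n=1..M. 1 * of_nat n powr (-(0 + 1 * s)))"
  define B where "B = real (Suc M) powr (1 / 8) * (2 / \<bar>Im s\<bar>) + (cmod s + 1) * (real M powr (-7/8) * 2)"
  have near: "Re z \<ge> 7 / 8" "cmod (z - 1) \<ge> \<bar>Im s\<bar> / 2" "cmod z \<le> cmod s + 1" "z \<noteq> 1" "Re z > 0"
    if "cmod (s - z) \<le> 1 / 16" for z
  proof -
    have "\<bar>Re (s - z)\<bar> \<le> 1 / 16" "\<bar>Im (s - z)\<bar> \<le> 1 / 16"
      using abs_Re_le_cmod[of "s - z"] abs_Im_le_cmod[of "s - z"] that by linarith+
    hence *: "\<bar>Re s - Re z\<bar> \<le> 1 / 16" "\<bar>Im s - Im z\<bar> \<le> 1 / 16" by simp_all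
    show "Re z \<ge> 7 / 8" "Re z > 0" using * assms by linarith+
    have "\<bar>Im z\<bar> \<ge> \<bar>Im s\<bar> / 2" using * assms by linarith
    moreover have "cmod (z - 1) \<ge> \<bar>Im z\<bar>" using abs_Im_le_cmod[of "z - 1"] by simp
    ultimately show "cmod (z - 1) \<ge> \<bar>Im s\<bar> / 2" by linarith
    thus "z \<noteq> 1" using assms by auto
    show "cmod z \<le> cmod s + 1"
      using norm_triangle_ineq2[of z s] that by (simp add: norm_minus_commute)
  qed
  have holo: "riemann_zeta holomorphic_on - {1}"
    using is_riemann_zeta_riemann_zeta by (simp add: is_riemann_zeta_def)
  have holo_P: "P holomorphic_on UNIV"
    unfolding P_def by (intro holomorphic_intros) auto
  have sub: "cball s (1/16) \<subseteq> - {1}" using near(4) by (auto simp: dist_norm)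
  have holo_E: "(\<lambda>z. riemann_zeta z - P z) holomorphic_on cball s (1/16)"
    using sub holo_P by (intro holomorphic_intros holomorphic_on_subset[OF holo] holomorphic_on_subset[OF holo_P]) auto
  have "cmod ((deriv ^^ j) (\<lambda>z. riemann_zeta z - P z) s) \<le> fact j * B / (1/16) ^ j"
  proof (rule Cauchy_inequality)
    show "(\<lambda>z. riemann_zeta z - P z) holomorphic_on ball s (1/16)"
      by (rule holomorphic_on_subset[OF holo_E]) auto
    show "continuous_on (cball s (1/16)) (\<lambda>z. riemann_zeta z - P z)"
      by (rule holomorphic_on_imp_continuous_on[OF holo_E])
    fix z assume "cmod (s - z) = 1 / 16"
    note nz = near[of z, OF eq_refl[OF this]]
    have "cmod (riemann_zeta z - P z) \<le>
      real (Suc M) powr (1 - Re z) / cmod (z - 1) + cmod z * (real M powr (- Re z) / Re z)"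
      using zeta_approx[of z M] nz assms by (simp add: P_def)
    also have "real (Suc M) powr (1 - Re z) / cmod (z - 1) \<le> real (Suc M) powr (1 / 8) / (\<bar>Im s\<bar> / 2)"
      using nz assms by (intro frac_le powr_mono) auto
    also have "\<dots> = real (Suc M) powr (1 / 8) * (2 / \<bar>Im s\<bar>)" by simp
    also have "cmod z * (real M powr (- Re z) / Re z) \<le> (cmod s + 1) * (real M powr (- (7/8)) / (1 / 2))"
      using nz assms by (intro mult_mono frac_le powr_mono) auto
    finally show "cmod (riemann_zeta z - P z) \<le> B" by (simp add: B_def)
  qed auto
  also have "(deriv ^^ j) (\<lambda>z. riemann_zeta z - P z) s = (deriv ^^ j) riemann_zeta s - (deriv ^^ j) P s"
    using near(4)[of s] by (intro higher_deriv_diff[of _ "- {1}"] holo holomorphic_on_subset[OF holo_P]) auto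
  also have "(deriv ^^ j) P s = (\<Sum>n=1..M. (- of_real (ln (real n))) ^ j * of_nat n powr (-s))"
    unfolding P_def by (subst higher_deriv_dirichlet_poly) auto
  finally show ?thesis by (simp add: B_def power_divide mult_ac)
qed

subsection \<open>Chebyshev and Mertens estimates\<close>

text \<open>The coefficients at \<open>k\<close> and \<open>k + 1\<close> are equal and together at
  most the row sum \<open>2 * 4 ^ k\<close>.\<close>

lemma odd_central_binomial_le: "(2 * k + 1) choose k \<le> 4 ^ k"
proof -
  have "((2 * k + 1) choose k) + ((2 * k + 1) choose (k + 1)) = sum ((choose) (2 * k + 1)) {k, k + 1}"
    by (simp del: binomial_Suc_Suc)
  also have "\<dots> \<le> (\<Sum>i\<le>2 * k + 1. (2 * k + 1) choose i)"
    by (intro sum_mono2) auto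
  also have "\<dots> = 2 ^ (2 * k + 1)" by (rule choose_row_sum)
  also have "\<dots> = 2 * 4 ^ k" by (simp add: power_mult)
  finally show ?thesis
    using binomial_symmetric[of k "2 * k + 1"] by (simp del: binomial_Suc_Suc)
qed

lemma prod_primes_dvd:
  fixes m :: nat
  assumes "finite P" "\<And>p. p \<in> P \<Longrightarrow> prime p" "\<And>p. p \<in> P \<Longrightarrow> p dvd m"
  shows "\<Prod>P dvd m"
  using assms
proof (induction P rule: finite_induct)
  case (insert p P)
  have "coprime p (\<Prod>P)"
    using insert by (intro prod_coprime_right) (auto intro: primes_coprime)
  thus ?case using insert by (auto intro: divides_mult)
qed auto

text \<open>Erdos's induction: for odd \<open>n = 2 * k + 1\<close> the primes above
  \<open>k + 1\<close> and up to \<open>n\<close> all divide \<open>n choose k\<close>, which is at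
  most \<open>4 ^ k\<close>; an even \<open>n > 2\<close> contributes no new prime.\<close>

lemma primorial_le: "\<Prod>{p::nat. prime p \<and> p \<le> n} \<le> 4 ^ n"
proof (induction n rule: less_induct)
  case (less n)
  have small: "p = 2" if "prime p" "p \<le> 2" for p :: nat
    using that prime_ge_2_nat[of p] by simp
  have *: "{p. prime p \<and> p \<le> (0::nat)} = {}" "{p. prime p \<and> p \<le> (1::nat)} = {}"
     "{p. prime p \<and> p \<le> (2::nat)} = {2}"
    using small by (auto dest: prime_ge_2_nat)
  consider "n = 0" | "n = 1" | "n = 2" | "n > 2" "even n" | "n > 2" "odd n" by linarith
  thus ?case
  proof cases
    case 4
    have "(prime p \<and> p \<le> n) = (prime p \<and> p \<le> n - 1)" for p
    proof -
      have "p \<noteq> n" if "prime p" using 4 prime_odd_nat that by blast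
      thus ?thesis by auto
    qed
    hence "{p. prime p \<and> p \<le> n} = {p. prime p \<and> p \<le> n - 1}" by simp
    hence "\<Prod>{p. prime p \<and> p \<le> n} \<le> 4 ^ (n - 1)" using less[of "n - 1"] 4 by simp
    also have "\<dots> \<le> 4 ^ n" by (intro power_increasing) auto
    finally show ?thesis .
  next
    case 5
    then obtain k where k: "n = 2 * k + 1" by (auto elim: oddE)
    have eq: "{p. prime p \<and> p \<le> n} = {p. prime p \<and> p \<le> k + 1} \<union> {p. prime p \<and> k + 1 < p \<and> p \<le> n}"
      using k 5 by auto
    have "\<Prod>{p. prime p \<and> p \<le> n} = \<Prod>{p. prime p \<and> p \<le> k + 1} * \<Prod>{p. prime p \<and> k + 1 < p \<and> p \<le> n}"
      unfolding eq by (intro prod.union_disjoint) auto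
    also have "\<dots> \<le> 4 ^ (k + 1) * 4 ^ k"
    proof (rule mult_mono)
      have "k + 1 < n" using k 5(1) by linarith
      from less[OF this] show "\<Prod>{p. prime p \<and> p \<le> k + 1} \<le> 4 ^ (k + 1)" .
      have "\<Prod>{p. prime p \<and> k + 1 < p \<and> p \<le> n} dvd n choose k"
      proof (rule prod_primes_dvd)
        fix p assume p: "p \<in> {p. prime p \<and> k + 1 < p \<and> p \<le> n}"
        have "p dvd fact n" using p by (simp add: prime_dvd_fact_iff)
        also have "fact n = fact k * fact (k + 1) * (n choose k)"
          using binomial_fact_lemma[of k n] k by simp
        finally show "p dvd n choose k"
          using p by (auto simp: prime_dvd_mult_iff prime_dvd_fact_iff simp del: fact_Suc)
      qed auto
      hence "\<Prod>{p. prime p \<and> k + 1 < p \<and> p \<le> n} \<le> n choose k"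
        by (rule dvd_imp_le) (use k in auto)
      thus "\<Prod>{p. prime p \<and> k + 1 < p \<and> p \<le> n} \<le> 4 ^ k"
        using odd_central_binomial_le[of k] unfolding k by linarith
    qed simp_all
    also have "\<dots> = 4 ^ n" unfolding k by (simp only: power_add[symmetric] mult_2 add_ac)
    finally show ?thesis .
  next
    case 1
    thus ?thesis using *(1) by (simp only:) simp
  next
    case 2
    thus ?thesis using *(2) by (simp only:) simp
  next
    case 3
    thus ?thesis using *(3) by (simp only:) simp
  qed
qed

lemma theta_le: "(\<Sum>p | prime p \<and> p \<le> n. ln (real p)) \<le> real n * ln 4"
proof -
  have "(\<Sum>p | prime p \<and> p \<le> n. ln (real p)) = ln (\<Prod>p | prime p \<and> p \<le> n. real p)"
    by (subst ln_prod) (auto dest: prime_gt_0_nat)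
  also have "(\<Prod>p | prime p \<and> p \<le> n. real p) = real (\<Prod>{p. prime p \<and> p \<le> n})" by simp
  also have "\<dots> \<le> real (4 ^ n)" by (subst of_nat_le_iff) (rule primorial_le)
  hence "ln (real (\<Prod>{p. prime p \<and> p \<le> n})) \<le> ln (real (4 ^ n))"
    by (subst ln_le_cancel_iff) (auto intro!: prod_pos dest: prime_gt_0_nat)
  also have "\<dots> = real n * ln 4" by (simp add: ln_realpow)
  finally show ?thesis .
qed

section \<open>Chebyshev's factorial identity and the weak Mertens estimate\<close>

lemma card_multiples_le:
  assumes "d > 0"
  shows "card {n\<in>{1..m}. d dvd n} = m div d"
proof -
  have "{n\<in>{1..m}. d dvd n} = (\<lambda>k. d * k) ` {1..m div d}"
  proof (intro equalityI subsetI)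
    fix n assume "n \<in> {n\<in>{1..m}. d dvd n}"
    then obtain k where "n = d * k" "1 \<le> n" "n \<le> m" by auto
    thus "n \<in> (\<lambda>k. d * k) ` {1..m div d}" using assms
      by (auto intro!: imageI simp: less_eq_div_iff_mult_less_eq mult_ac Suc_le_eq)
  next
    fix n assume "n \<in> (\<lambda>k. d * k) ` {1..m div d}"
    thus "n \<in> {n\<in>{1..m}. d dvd n}" using assms
      by (auto simp: less_eq_div_iff_mult_less_eq mult_ac Suc_le_eq)
  qed
  moreover have "inj_on (\<lambda>k. d * k) {1..m div d}" using assms by (auto simp: inj_on_def)
  ultimately show ?thesis by (simp add: card_image)
qed

text \<open>Each \<open>ln n\<close> is the sum of \<open>mangoldt\<close> over the divisors of
  \<open>n\<close>; swapping the sums counts the multiples of each \<open>d\<close> up to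
  \<open>m\<close>.\<close>

lemma ln_fact_eq_sum_mangoldt:
  "ln (fact m :: real) = (\<Sum>d=1..m. mangoldt d * real (m div d))"
proof -
  have "ln (fact m :: real) = (\<Sum>n=1..m. ln (real n))"
    unfolding fact_prod of_nat_prod by (rule ln_prod) auto
  also have "\<dots> = (\<Sum>n=1..m. \<Sum>d\<in>{1..m}. if d dvd n then mangoldt d else 0)"
  proof (intro sum.cong refl)
    fix n assume n: "n \<in> {1..m}"
    have "ln (real n) = (\<Sum>d | d dvd n. mangoldt d)" using mangoldt_sum[of n, where 'a=real] n by simp
    also have "{d. d dvd n} = {d\<in>{1..m}. d dvd n}"
      using n by (auto dest: dvd_imp_le intro!: Nat.gr0I simp: Suc_le_eq)
    also have "sum mangoldt \<dots> = (\<Sum>d\<in>{1..m}. if d dvd n then mangoldt d else 0 :: real)"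
      by (subst sum.inter_filter) auto
    finally show "ln (real n) = (\<Sum>d\<in>{1..m}. if d dvd n then mangoldt d else 0)" .
  qed
  also have "\<dots> = (\<Sum>d=1..m. \<Sum>n\<in>{1..m}. if d dvd n then mangoldt d else 0)" by (rule sum.swap)
  also have "\<dots> = (\<Sum>d=1..m. mangoldt d * real (m div d))"
  proof (intro sum.cong refl)
    fix d assume d: "d \<in> {1..m}"
    have "(\<Sum>n\<in>{1..m}. if d dvd n then mangoldt d else 0 :: real) = (\<Sum>n\<in>{n\<in>{1..m}. d dvd n}. mangoldt d)"
      by (subst sum.inter_filter) auto
    also have "\<dots> = mangoldt d * real (m div d)"
      using card_multiples_le[of d m] d by (simp add: mult.commute)
    finally show "(\<Sum>n\<in>{1..m}. if d dvd n then mangoldt d else 0 :: real) = mangoldt d * real (m div d)" .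
  qed
  finally show ?thesis .
qed

lemma ln_le_2_sqrt: "x > 0 \<Longrightarrow> ln x \<le> 2 * sqrt x"
  using ln_le_minus_one[of "sqrt x"] by (simp add: ln_sqrt)

lemma summable_ln_over_square: "summable (\<lambda>n. ln (real n) / real n ^ 2)"
proof (rule summable_comparison_test')
  show "summable (\<lambda>n. 2 * real n powr (-3/2))"
    by (intro summable_mult) (simp add: summable_real_powr_iff)
  fix n :: nat assume n: "n \<ge> 1"
  have "ln (real n) / real n ^ 2 \<le> 2 * sqrt n / real n ^ 2"
    using n ln_le_2_sqrt[of n] by (intro divide_right_mono) auto
  also have "\<dots> = 2 * real n powr (-3/2)"
  proof -
    have "real n powr (-3/2) = real n powr (1/2 - 2)" by simp
    also have "\<dots> = sqrt n / real n ^ 2" using n by (simp only: powr_diff powr_half_sqrt) (simp add: powr_half_sqrt)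
    finally show ?thesis by simp
  qed
  finally show "norm (ln (real n) / real n ^ 2) \<le> 2 * real n powr (-3/2)" using n by simp
qed

text \<open>Only proper prime powers contribute. For each \<open>p\<close> the geometric series from
  exponent 2 on is at most \<open>2 / p^2\<close>, as \<open>1 / p \<le> 1 / 2\<close>, and the
  resulting sum converges, so the bound is independent of \<open>m\<close>.\<close>

lemma sum_mangoldt_non_primes_le:
  "(\<Sum>d\<in>{d\<in>{1..m}. \<not> prime d}. mangoldt d / real d) \<le> 2 * (\<Sum>n. ln (real n) / real n ^ 2)"
proof -
  define P where "P = {p. prime p \<and> p \<le> m}"
  have fin: "finite P" by (simp add: P_def)
  have "(\<Sum>d\<in>{d\<in>{1..m}. \<not> prime d}. mangoldt d / real d) =
        (\<Sum>d\<in>{d\<in>{1..m}. primepow d \<and> \<not> prime d}. mangoldt d / real d)"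
    by (intro sum.mono_neutral_right) (auto simp: mangoldt_def)
  also have "\<dots> \<le> (\<Sum>d\<in>(\<lambda>(p,k). p ^ k) ` (P \<times> {2..m}). mangoldt d / real d)"
  proof (intro sum_mono2)
    show "{d\<in>{1..m}. primepow d \<and> \<not> prime d} \<subseteq> (\<lambda>(p,k). p ^ k) ` (P \<times> {2..m})"
    proof
      fix d assume d: "d \<in> {d\<in>{1..m}. primepow d \<and> \<not> prime d}"
      then obtain p k where pk: "prime p" "k > 0" "d = p ^ k" by (auto simp: primepow_def)
      have "k \<noteq> 1" using d pk by auto
      have "p > 1" using pk prime_gt_1_nat by blast
      \<comment> \<open>The exponent is smaller than the power, hence at most
        \<open>m\<close>.\<close>
      have "k < p ^ k" using \<open>p > 1\<close> by (intro power_gt_expt) simp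
      moreover have "p ^ 1 \<le> p ^ k" using \<open>p > 1\<close> pk by (intro power_increasing) auto
      ultimately show "d \<in> (\<lambda>(p,k). p ^ k) ` (P \<times> {2..m})"
        using d pk \<open>k \<noteq> 1\<close> by (auto intro!: image_eqI[of _ _ "(p,k)"] simp: P_def)
    qed
  qed (use fin in \<open>auto intro!: divide_nonneg_nonneg mangoldt_nonneg\<close>)
  also have "\<dots> \<le> (\<Sum>(p,k)\<in>P \<times> {2..m}. mangoldt (p ^ k) / real (p ^ k))"
    using sum_image_le[of "P \<times> {2..m}" "\<lambda>d. mangoldt d / real d" "\<lambda>(p,k). p ^ k"] fin
    by (auto simp: mangoldt_nonneg case_prod_unfold o_def)
  also have "\<dots> = (\<Sum>p\<in>P. ln p * (\<Sum>k=2..m. (1 / real p) ^ k))"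
    using fin by (subst sum.cartesian_product[symmetric])
      (auto intro!: sum.cong simp: sum_distrib_left mangoldt_primepow P_def power_divide)
  also have "\<dots> \<le> (\<Sum>p\<in>P. ln p * (2 / real p ^ 2))"
  proof (intro sum_mono mult_left_mono)
    fix p assume p: "p \<in> P"
    hence p2: "real p \<ge> 2" using prime_ge_2_nat by (auto simp: P_def)
    define x where "x = 1 / real p"
    have x: "0 \<le> x" "x \<le> 1 / 2" using p2 by (auto simp: x_def field_simps)
    have "(\<Sum>k=2..m. x ^ k) \<le> 2 * x ^ 2"
    proof (cases "m \<ge> 2")
      case True
      have "(1 / 2) * (\<Sum>k=2..m. x ^ k) \<le> (1 - x) * (\<Sum>k=2..m. x ^ k)"
        using x by (intro mult_right_mono sum_nonneg) auto
      also have "\<dots> = x ^ 2 - x ^ Suc m" by (rule sum_gp_multiplied) (use True in auto)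
      also have "\<dots> \<le> x ^ 2" using x by simp
      finally show ?thesis by simp
    qed (use x in auto)
    thus "(\<Sum>k=2..m. (1 / real p) ^ k) \<le> 2 / real p ^ 2" by (simp add: x_def power_divide)
  qed (auto simp: P_def dest: prime_gt_0_nat)
  also have "\<dots> = 2 * (\<Sum>p\<in>P. ln p / real p ^ 2)" by (simp add: sum_distrib_left mult_ac)
  also have "\<dots> \<le> 2 * (\<Sum>n. ln (real n) / real n ^ 2)"
  proof (intro mult_left_mono sum_le_suminf summable_ln_over_square fin ballI)
    show "0 \<le> ln (real n) / real n ^ 2" for n :: nat by (cases "n = 0") auto
  qed auto
  finally show ?thesis .
qed

lemma ln_fact_ge: "real m * ln m - real m \<le> ln (fact m :: real)"
proof (cases "m = 0")
  case False
  have "real m ^ m / fact m \<le> exp (real m)"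
    using sum_le_suminf[OF summable_exp[of "real m"], of "{m}"]
    by (simp add: exp_def divide_inverse mult.commute)
  hence "real m ^ m \<le> exp (real m) * fact m" by (simp add: field_simps)
  hence "ln (real m ^ m) \<le> ln (exp (real m) * fact m)" using False by (subst ln_le_cancel_iff) auto
  thus ?thesis using False by (simp add: ln_mult ln_realpow)
qed auto

lemma ln_fact_le: "ln (fact m :: real) \<le> real m * ln m"
proof (cases "m = 0")
  case False
  have "ln (fact m :: real) \<le> ln (real m ^ m)"
    using fact_le_power[of m] False by (subst ln_le_cancel_iff) auto
  thus ?thesis using False by (simp add: ln_realpow)
qed auto

text \<open>Both bounds come from \<open>ln (fact m) = m * ln m + O(m)\<close>. Above, only primes
  are kept, and replacing \<open>m div p\<close> by \<open>m / p - 1\<close> costs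
  \<open>theta_le\<close>; below, the rounding is dropped and the proper prime powers cost the
  constant \<open>K\<close>.\<close>

lemma mertens_weak:
  obtains C where "\<And>m::nat. m > 0 \<Longrightarrow> \<bar>(\<Sum>p | prime p \<and> p \<le> m. ln p / p) - ln m\<bar> \<le> C"
proof -
  define K where "K = 2 * (\<Sum>n. ln (real n) / real n ^ 2)"
  have "\<bar>(\<Sum>p | prime p \<and> p \<le> m. ln p / p) - ln m\<bar> \<le> max (ln 4) (K + 1)" if m: "m > 0" for m :: nat
  proof -
    define S where "S = (\<Sum>p | prime p \<and> p \<le> m. ln p / p)"
    have P: "{p. prime p \<and> p \<le> m} = {p\<in>{1..m}. prime p}" by (auto dest: prime_ge_1_nat)
    have "real m * S - real m * ln 4 \<le> real m * S - (\<Sum>p | prime p \<and> p \<le> m. ln p)"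
      using theta_le[of m] by simp
    also have "\<dots> = (\<Sum>p | prime p \<and> p \<le> m. ln p * (real m / p - 1))"
      by (simp add: S_def sum_distrib_left sum_subtractf algebra_simps)
    also have "\<dots> \<le> (\<Sum>p | prime p \<and> p \<le> m. mangoldt p * real (m div p))"
    proof (intro sum_mono)
      fix p assume p: "p \<in> {p. prime p \<and> p \<le> m}"
      hence p0: "p > 0" by (auto dest: prime_gt_0_nat)
      have "real m < real (m div p * p + p)"
        by (subst of_nat_less_iff) (use dividend_less_div_times[OF p0, of m] in simp)
      hence "real m / p - 1 \<le> real (m div p)"
        using p0 by (simp add: field_simps)
      thus "ln p * (real m / p - 1) \<le> mangoldt p * real (m div p)"
        using p prime_ge_1_nat by (auto intro!: mult_left_mono)
    qed
    also have "\<dots> \<le> (\<Sum>d=1..m. mangoldt d * real (m div d))"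
      unfolding P by (intro sum_mono2) (auto intro!: mult_nonneg_nonneg mangoldt_nonneg)
    also have "\<dots> \<le> real m * ln m" using ln_fact_le[of m] by (simp add: ln_fact_eq_sum_mangoldt)
    finally have "real m * (S - ln m) \<le> real m * ln 4" by (simp add: algebra_simps)
    hence 1: "S - ln m \<le> ln 4" using m by simp
    have "real m * ln m - real m \<le> (\<Sum>d=1..m. mangoldt d * real (m div d))"
      using ln_fact_ge[of m] by (simp add: ln_fact_eq_sum_mangoldt)
    also have "\<dots> \<le> (\<Sum>d=1..m. mangoldt d * (real m / d))"
      by (intro sum_mono mult_left_mono mangoldt_nonneg) (rule of_nat_div_le_of_nat)
    also have "\<dots> = real m * (\<Sum>d=1..m. mangoldt d / d)" by (simp add: sum_distrib_left mult_ac)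
    finally have "real m * (ln m - 1) \<le> real m * (\<Sum>d=1..m. mangoldt d / d)" by (simp add: algebra_simps)
    hence "ln m - 1 \<le> (\<Sum>d=1..m. mangoldt d / d)" using m by simp
    also have "\<dots> = (\<Sum>d\<in>{p\<in>{1..m}. prime p}. mangoldt d / d) + (\<Sum>d\<in>{d\<in>{1..m}. \<not> prime d}. mangoldt d / d)"
      by (subst sum.union_disjoint[symmetric]) (auto intro!: sum.cong)
    also have "(\<Sum>d\<in>{p\<in>{1..m}. prime p}. mangoldt d / d) = S"
      unfolding S_def P by (intro sum.cong) auto
    also note sum_mangoldt_non_primes_le[of m]
    finally have 2: "ln m - 1 \<le> S + K" by (simp add: K_def)
    show ?thesis using 1 2 unfolding S_def by linarith
  qed
  thus ?thesis using that by blast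
qed

subsection \<open>The Laplace transform of the Dickman function\<close>

text \<open>\<open>dickman\<close> is normalised to 0 on the negative half-line; the value 1 makes it continuous.\<close>

definition dickman1 :: "real \<Rightarrow> real" where
  "dickman1 u = (if u \<le> 1 then 1 else dickman u)"

lemma dickman1_eq_1: "u \<le> 1 \<Longrightarrow> dickman1 u = 1"
  by (simp add: dickman1_def)

lemma dickman1_eq_dickman: "u > 0 \<Longrightarrow> dickman1 u = dickman u"
  using is_dickman_dickman by (auto simp: dickman1_def is_dickman_def)

lemma continuous_on_dickman1: "continuous_on S dickman1"
proof -
  have "isCont dickman1 u" for u
  proof (cases "u > 0")
    case True
    have "isCont dickman u"
      using is_dickman_dickman True by (auto simp: is_dickman_def continuous_on_eq_continuous_at)
    moreover have "eventually (\<lambda>v. dickman1 v = dickman v) (nhds u)"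
      using eventually_nhds_in_open[of "{0<..}" u] True by (auto elim!: eventually_mono simp: dickman1_eq_dickman)
    ultimately show ?thesis using isCont_cong by blast
  next
    case False
    have "eventually (\<lambda>v. dickman1 v = 1) (nhds u)"
      using eventually_nhds_in_open[of "{..<1}" u] False by (auto elim!: eventually_mono simp: dickman1_eq_1)
    thus ?thesis using isCont_cong[of dickman1 "\<lambda>_. 1" u] by simp
  qed
  thus ?thesis by (simp add: continuous_at_imp_continuous_on)
qed

lemma DERIV_dickman1:
  assumes "u > 1"
  shows "(dickman1 has_real_derivative - dickman1 (u - 1) / u) (at u)"
proof -
  have "(dickman has_real_derivative deriv dickman u) (at u)" "u * deriv dickman u = - dickman (u - 1)"
    using is_dickman_dickman assms by (auto simp: is_dickman_def DERIV_deriv_iff_real_differentiable)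
  moreover from this(2) have "deriv dickman u = - dickman1 (u - 1) / u"
    using assms by (simp add: dickman1_eq_dickman field_simps)
  ultimately have "(dickman has_real_derivative - dickman1 (u - 1) / u) (at u)" by simp
  moreover have "eventually (\<lambda>v. dickman1 v = dickman v) (nhds u)"
    using eventually_nhds_in_open[of "{0<..}" u] assms by (auto elim!: eventually_mono simp: dickman1_eq_dickman)
  ultimately show ?thesis by (subst DERIV_cong_ev) auto
qed

lemma DERIV_times_dickman1:
  assumes "u > 1"
  shows "((\<lambda>u. u * dickman1 u) has_real_derivative dickman1 u - dickman1 (u - 1)) (at u)"
  using DERIV_dickman1[OF assms] assms by (auto intro!: derivative_eq_intros)

text \<open>Both sides have derivative \<open>dickman1 u - dickman1 (u - 1)\<close> for
  \<open>u > 1\<close>, and both are 1 at \<open>u = 1\<close>.\<close>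

lemma dickman1_integral_eq:
  assumes "u \<ge> 1"
  shows "u * dickman1 u = integral {u - 1..u} dickman1"
proof -
  define g where "g = (\<lambda>u. integral {0..u} dickman1)"
  have g: "(g has_real_derivative dickman1 x) (at x within {0..b})" if "x \<in> {0..b}" for x b
    unfolding g_def using that by (intro integral_has_real_derivative continuous_on_dickman1)
  have cont_g: "continuous_on {0..b} g" for b
    using g by (meson DERIV_continuous continuous_on_eq_continuous_within)
  define h where "h = (\<lambda>u. u * dickman1 u - (g u - g (u - 1)))"
  have "h u = h 1"
  proof (cases "u = 1")
    case False
    have "continuous_on {1..u} (\<lambda>x. g (x - 1))"
      by (rule continuous_on_compose2[OF cont_g[of u]]) (auto intro!: continuous_intros)
    moreover have "continuous_on {1..u} g"
      by (rule continuous_on_subset[OF cont_g[of u]]) auto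
    ultimately have cont: "continuous_on {1..u} h"
      unfolding h_def by (intro continuous_intros continuous_on_dickman1)
    have der: "(h has_real_derivative 0) (at x)" if x: "1 < x" for x
    proof -
      have 1: "(g has_real_derivative dickman1 y) (at y)" if "y > 0" for y
        using g[of y "y + 1"] that by (simp add: at_within_Icc_at)
      have "((\<lambda>x. g (x - 1)) has_real_derivative dickman1 (x - 1)) (at x)"
        using DERIV_shift[of g "dickman1 (x - 1)" x "-1"] 1[of "x - 1"] x by simp
      from DERIV_diff[OF DERIV_times_dickman1[OF x] DERIV_diff[OF 1[of x] this]] x
      show ?thesis by (simp add: h_def)
    qed
    show ?thesis
      by (rule DERIV_isconst2[of 1 u h]) (use False assms cont der in auto)
  qed auto
  also have "h 1 = 0"
  proof -
    have "g 1 = integral {0..1::real} (\<lambda>_. 1 :: real)" unfolding g_def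
      by (rule Henstock_Kurzweil_Integration.integral_cong) (simp add: dickman1_eq_1)
    thus ?thesis by (simp add: h_def g_def dickman1_eq_1)
  qed
  also have "g u - g (u - 1) = integral {u - 1..u} dickman1"
    unfolding g_def using assms
    by (subst Henstock_Kurzweil_Integration.integral_combine[of 0 "u - 1" u, symmetric])
       (auto intro!: integrable_continuous_real continuous_on_dickman1)
  ultimately show ?thesis by (simp add: h_def)
qed

text \<open>At a first zero \<open>v\<close> the integral over \<open>[v - 1, v]\<close> would
  vanish although the integrand is nonnegative, forcing a zero already at
  \<open>v - 1\<close>.\<close>

lemma dickman1_pos: "dickman1 u > 0"
proof (rule ccontr)
  assume "\<not> dickman1 u > 0"
  define Z where "Z = {u. u \<ge> 1 \<and> dickman1 u \<le> 0}"
  have "u \<in> Z" using \<open>\<not> dickman1 u > 0\<close> dickman1_eq_1[of u] by (auto simp: Z_def not_less intro: linorder_le_cases)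
  define v where "v = Inf Z"
  have "closed Z"
    unfolding Z_def by (intro closed_Collect_conj closed_Collect_le continuous_on_dickman1 continuous_intros)
  moreover have bdd: "bdd_below Z" by (auto simp: Z_def intro: bdd_belowI)
  ultimately have v: "v \<in> Z" unfolding v_def using \<open>u \<in> Z\<close> by (intro closed_contains_Inf) auto
  have pos: "dickman1 w > 0" if "w < v" for w
  proof (rule ccontr)
    assume "\<not> dickman1 w > 0"
    hence "w \<in> Z" using dickman1_eq_1[of w] by (auto simp: Z_def not_less intro: linorder_le_cases)
    thus False using cInf_lower[OF _ bdd, of w] that by (auto simp: v_def)
  qed
  have v1: "v > 1" using v dickman1_eq_1[of 1] by (cases "v = 1") (auto simp: Z_def)
  have "(dickman1 \<longlongrightarrow> dickman1 v) (at_left v)"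
    using continuous_on_dickman1[of UNIV] by (auto simp: continuous_on_def intro: tendsto_within_subset)
  moreover have "eventually (\<lambda>w. dickman1 w \<ge> 0) (at_left v)"
    using pos by (auto simp: eventually_at_left_field intro!: exI[of _ "v - 1"] less_imp_le)
  ultimately have "dickman1 v \<ge> 0" by (rule tendsto_lowerbound) auto
  hence v0: "dickman1 v = 0" using v by (auto simp: Z_def)
  have "integral {v - 1..v} dickman1 = 0" using dickman1_integral_eq[of v] v1 v0 by simp
  moreover have "dickman1 x \<ge> 0" if "x \<in> {v - 1..v}" for x
    using that pos[of x] v0 by (cases "x = v") auto
  ultimately have "dickman1 (v - 1) = 0"
    using integral_eq_0_iff[of "v - 1" v dickman1] continuous_on_dickman1 by auto
  thus False using pos[of "v - 1"] by simp
qed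

lemma dickman1_antimono:
  assumes "x \<le> y"
  shows "dickman1 y \<le> dickman1 x"
proof -
  have *: "dickman1 y \<le> dickman1 x" if "1 \<le> x" "x \<le> y" for x y
  proof (rule DERIV_nonpos_imp_decreasing_open[OF that(2)])
    fix z assume "x < z" "z < y"
    hence "z > 1" using that by simp
    thus "\<exists>w. (dickman1 has_real_derivative w) (at z) \<and> w \<le> 0"
      using DERIV_dickman1[of z] dickman1_pos[of "z - 1"]
      by (intro exI[of _ "- dickman1 (z - 1) / z"]) auto
  qed (rule continuous_on_dickman1)
  show ?thesis
    using *[of x y] *[of 1 y] assms by (cases "y \<le> 1"; cases "x \<le> 1") (auto simp: dickman1_eq_1)
qed

lemma dickman1_le_1: "dickman1 u \<le> 1"
  using dickman1_antimono[of 1 u] dickman1_eq_1[of u] dickman1_eq_1[of 1] by (cases "u \<le> 1") auto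

text \<open>The integral over \<open>[u - 1, u]\<close> is at most the value of the decreasing
  integrand at the left end. Iterated, this yields decay faster than any exponential.\<close>

lemma dickman1_le_shift:
  assumes "u \<ge> 1"
  shows "dickman1 u \<le> dickman1 (u - 1) / u"
proof -
  have "u * dickman1 u \<le> integral {u - 1..u} (\<lambda>_. dickman1 (u - 1))"
    unfolding dickman1_integral_eq[OF assms]
    by (intro integral_le integrable_continuous_real continuous_on_dickman1) (auto intro: dickman1_antimono)
  thus ?thesis using assms by (simp add: field_simps)
qed

text \<open>Past \<open>exp B\<close> each step of length 1 gains a factor \<open>u\<close>, hence
  at least \<open>exp B\<close>; up to the threshold \<open>M\<close> the trivial bound 1 is
  absorbed in \<open>K = exp (B * M)\<close>.\<close>

lemma dickman1_exp_decay:
  assumes "B \<ge> 0"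
  obtains K where "K > 0" "\<And>u. dickman1 u \<le> K * exp (- B * u)"
proof -
  define M where "M = nat \<lceil>exp B\<rceil>"
  have M: "real M \<ge> exp B" by (simp add: M_def of_nat_ceiling)
  have "\<forall>u \<le> real (M + n). dickman1 u \<le> exp (B * real M) * exp (- B * u)" for n
  proof (induction n)
    case 0
    have "dickman1 u \<le> exp (B * real M) * exp (- B * u)" if "u \<le> real M" for u
    proof -
      have "dickman1 u \<le> 1" by (rule dickman1_le_1)
      also have "1 \<le> exp (B * (real M - u))" using that assms by simp
      finally show ?thesis by (simp add: exp_add[symmetric] algebra_simps)
    qed
    thus ?case by simp
  next
    case (Suc n)
    show ?case
    proof (intro allI impI)
      fix u assume u: "u \<le> real (M + Suc n)"
      show "dickman1 u \<le> exp (B * real M) * exp (- B * u)"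
      proof (cases "u \<le> real (M + n)")
        case False
        hence uM: "u \<ge> exp B" using M by simp
        moreover have "exp B \<ge> 1" using assms by simp
        ultimately have u1: "u \<ge> 1" by linarith
        have "dickman1 u \<le> dickman1 (u - 1) / u" by (rule dickman1_le_shift[OF u1])
        also have "\<dots> \<le> (exp (B * real M) * exp (- B * (u - 1))) / exp B"
          using Suc u uM by (intro frac_le) auto
        also have "\<dots> = exp (B * real M) * exp (- B * u)"
          by (simp add: exp_add[symmetric] exp_diff[symmetric] algebra_simps)
        finally show ?thesis .
      qed (use Suc in auto)
    qed
  qed
  hence "dickman1 u \<le> exp (B * real M) * exp (- B * u)" for u
  proof -
    obtain n where "u \<le> real n" using real_arch_simple by blast
    thus ?thesis using \<open>\<And>n. \<forall>u \<le> real (M + n). _ u\<close> by (metis le_add2 of_nat_le_iff order_trans)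
  qed
  thus ?thesis using that[of "exp (B * real M)"] by simp
qed

section \<open>The Laplace transform as an entire function and its differential equation\<close>

text \<open>The power of \<open>- u\<close> is what \<open>j\<close> differentiations in
  \<open>s\<close> bring down.\<close>

definition laplace_kernel :: "nat \<Rightarrow> complex \<Rightarrow> real \<Rightarrow> complex" where
  "laplace_kernel j s u = (- of_real u) ^ j * of_real (dickman1 u) * exp (- of_real u * s)"

definition laplace_trunc :: "nat \<Rightarrow> nat \<Rightarrow> complex \<Rightarrow> complex" where
  "laplace_trunc j n s = integral {0..real n} (laplace_kernel j s)"

text \<open>A series over unit intervals in place of an improper integral, so that the Weierstrass
  test gives uniform convergence on half-planes and derivatives pass to the limit.\<close>

definition laplace_dickman :: "complex \<Rightarrow> complex" where
  "laplace_dickman s = (\<Sum>n. integral {real n..real (Suc n)} (laplace_kernel 0 s))"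

lemma continuous_on_laplace_kernel: "continuous_on S (laplace_kernel j s)"
  unfolding laplace_kernel_def by (intro continuous_intros continuous_on_dickman1)

lemma laplace_kernel_integrable: "laplace_kernel j s integrable_on {a..b}"
  by (intro integrable_continuous_real continuous_on_laplace_kernel)

lemma laplace_trunc_has_field_derivative:
  "(laplace_trunc j n has_field_derivative laplace_trunc (Suc j) n s) (at s)"
proof -
  have "((\<lambda>s. integral (cbox 0 (real n)) (laplace_kernel j s)) has_field_derivative
      integral (cbox 0 (real n)) (laplace_kernel (Suc j) s)) (at s within UNIV)"
  proof (rule leibniz_rule_field_derivative)
    show "((\<lambda>s. laplace_kernel j s t) has_field_derivative laplace_kernel (Suc j) s t) (at s within UNIV)" for s t
      unfolding laplace_kernel_def by (auto intro!: derivative_eq_intros)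
    have c: "continuous_on (UNIV \<times> cbox 0 (real n)) (\<lambda>x::complex \<times> real. dickman1 (snd x))"
      by (rule continuous_on_compose2[OF continuous_on_dickman1 continuous_on_snd[OF continuous_on_id]]) auto
    show "continuous_on (UNIV \<times> cbox 0 (real n)) (\<lambda>(s, t). laplace_kernel (Suc j) s t)"
      unfolding laplace_kernel_def case_prod_unfold by (intro continuous_intros c)
  qed (use laplace_kernel_integrable in auto)
  thus ?thesis by (simp add: laplace_trunc_def [abs_def])
qed

lemma laplace_trunc_higher_deriv: "(deriv ^^ j) (laplace_trunc 0 n) = laplace_trunc j n"
proof (induction j)
  case (Suc j)
  have "(deriv ^^ Suc j) (laplace_trunc 0 n) = deriv (laplace_trunc j n)" by (simp add: Suc)
  also have "\<dots> = laplace_trunc (Suc j) n"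
    using DERIV_imp_deriv[OF laplace_trunc_has_field_derivative] by blast
  finally show ?case .
qed auto

lemma laplace_trunc_holomorphic: "laplace_trunc j n holomorphic_on S"
  using laplace_trunc_has_field_derivative
  by (meson field_differentiable_at_within field_differentiable_def holomorphic_on_def)

lemma laplace_trunc_0_eq_sum:
  "laplace_trunc 0 n s = (\<Sum>k<n. integral {real k..real (Suc k)} (laplace_kernel 0 s))"
proof (induction n)
  case (Suc n)
  thus ?case unfolding laplace_trunc_def
    by (subst Henstock_Kurzweil_Integration.integral_combine[of 0 "real n" "real (Suc n)", symmetric])
       (auto intro: laplace_kernel_integrable)
qed (simp add: laplace_trunc_def)

text \<open>Decay at rate \<open>\<bar>B\<bar> + 1\<close> beats the growth
  \<open>exp (\<bar>B\<bar> * u)\<close> of the exponential in this half-plane and leaves a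
  geometric majorant.\<close>

lemma laplace_trunc_uniform_limit:
  "uniform_limit {s. Re s > - B} (laplace_trunc 0) laplace_dickman sequentially"
proof -
  obtain K where K: "K > 0" "\<And>u. dickman1 u \<le> K * exp (- (\<bar>B\<bar> + 1) * u)"
    using dickman1_exp_decay[of "\<bar>B\<bar> + 1"] by auto
  have "uniform_limit {s. Re s > - B} (\<lambda>n s. \<Sum>k<n. integral {real k..real (Suc k)} (laplace_kernel 0 s))
          (\<lambda>s. \<Sum>k. integral {real k..real (Suc k)} (laplace_kernel 0 s)) sequentially"
  proof (rule Weierstrass_m_test)
    fix n s assume s: "s \<in> {s. Re s > - B}"
    have "norm (integral {real n..real (Suc n)} (laplace_kernel 0 s)) \<le> K * exp (- real n) * (real (Suc n) - real n)"
    proof (rule integral_bound)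
      fix u assume u: "u \<in> {real n..real (Suc n)}"
      hence "u \<ge> 0" by (meson atLeastAtMost_iff of_nat_0_le_iff order_trans)
      have "norm (laplace_kernel 0 s u) = dickman1 u * exp (- (u * Re s))"
        using dickman1_pos[of u] by (simp add: laplace_kernel_def norm_mult)
      also have "\<dots> \<le> (K * exp (- (\<bar>B\<bar> + 1) * u)) * exp (u * \<bar>B\<bar>)"
      proof (intro mult_mono K)
        have "- Re s \<le> \<bar>B\<bar>" using s by auto
        hence "u * - Re s \<le> u * \<bar>B\<bar>" using \<open>u \<ge> 0\<close> by (intro mult_left_mono)
        thus "exp (- (u * Re s)) \<le> exp (u * \<bar>B\<bar>)" by simp
      qed (use K in auto)
      also have "\<dots> = K * exp (- u)" by (simp add: exp_add[symmetric] algebra_simps)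
      also have "\<dots> \<le> K * exp (- real n)" using u K by simp
      finally show "norm (laplace_kernel 0 s u) \<le> K * exp (- real n)" .
    qed (auto intro: continuous_on_laplace_kernel)
    thus "norm (integral {real n..real (Suc n)} (laplace_kernel 0 s)) \<le> K * exp (-1) ^ n"
      by (simp add: exp_of_nat_mult[symmetric])
  next
    show "summable (\<lambda>n. K * exp (-1) ^ n)"
      by (intro summable_mult summable_geometric) auto
  qed
  thus ?thesis by (simp add: laplace_trunc_0_eq_sum [abs_def] laplace_dickman_def [abs_def])
qed

lemma open_halfplane: "open {s. Re s > - B}"
  by (rule open_halfspace_Re_gt)

lemma laplace_trunc_tendsto:
  "(\<lambda>n. laplace_trunc j n s) \<longlonglongrightarrow> (deriv ^^ j) laplace_dickman s"
proof -
  have "(\<lambda>n. (deriv ^^ j) (laplace_trunc 0 n) s) \<longlonglongrightarrow> (deriv ^^ j) laplace_dickman s"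
    by (rule higher_deriv_complex_uniform_limit[OF laplace_trunc_uniform_limit[of "\<bar>Re s\<bar> + 1"]])
       (simp_all only: laplace_trunc_holomorphic open_halfplane always_eventually trivial_limit_sequentially not_False_eq_True mem_Collect_eq, simp_all)
  thus ?thesis by (simp add: laplace_trunc_higher_deriv)
qed

lemma laplace_dickman_holomorphic: "laplace_dickman holomorphic_on S"
proof -
  have "laplace_dickman field_differentiable at s" for s
  proof -
    have "laplace_dickman holomorphic_on {s'. Re s' > - (\<bar>Re s\<bar> + 1)}"
    proof (rule holomorphic_uniform_sequence[OF open_halfplane])
      fix x assume "x \<in> {s'. Re s' > - (\<bar>Re s\<bar> + 1)}"
      then obtain d where "d > 0" "cball x d \<subseteq> {s'. Re s' > - (\<bar>Re s\<bar> + 1)}"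
        using open_halfplane open_contains_cball by blast
      thus "\<exists>d>0. cball x d \<subseteq> {s'. Re s' > - (\<bar>Re s\<bar> + 1)} \<and>
          uniform_limit (cball x d) (laplace_trunc 0) laplace_dickman sequentially"
        using uniform_limit_on_subset[OF laplace_trunc_uniform_limit] by blast
    qed (rule laplace_trunc_holomorphic)
    thus ?thesis
      by (rule holomorphic_on_imp_differentiable_at) (rule open_halfplane, simp)
  qed
  thus ?thesis using field_differentiable_at_within holomorphic_on_def by blast
qed

lemma laplace_dickman_has_field_derivative:
  "(laplace_dickman has_field_derivative deriv laplace_dickman s) (at s)"
  using laplace_dickman_holomorphic[of UNIV] by (intro holomorphic_derivI[of _ UNIV]) auto

text \<open>This integrates the derivative of \<open>u * dickman1 u * exp (- u * s)\<close> up to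
  \<open>n + 1\<close>. The delayed term \<open>dickman1 (u - 1)\<close> becomes, after a shift by
  1, \<open>exp (-s)\<close> times the transform truncated at \<open>n\<close>. The interval
  \<open>[0, 1]\<close> is treated apart because there \<open>u * dickman1 u\<close> has derivative
  1, with no delayed term.\<close>

lemma laplace_trunc_parts:
  "laplace_trunc 0 (Suc n) s - exp (-s) * laplace_trunc 0 n s + s * laplace_trunc 1 (Suc n) s =
     of_real (real (Suc n) * dickman1 (real (Suc n))) * exp (- of_real (real (Suc n)) * s)"
proof -
  define E where "E = (\<lambda>u. exp (- of_real u * s) :: complex)"
  define f where "f = (\<lambda>u. laplace_kernel 0 s u + s * laplace_kernel 1 s u)"
  define e where "e = of_real (real (Suc n) * dickman1 (real (Suc n))) * E (real (Suc n))"
  have E: "(E has_vector_derivative - s * E u) (at u within A)" for u A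
  proof -
    have "((\<lambda>z. exp (- z * s)) has_field_derivative - s * exp (- of_real u * s)) (at (of_real u :: complex))"
      by (auto intro!: derivative_eq_intros)
    thus ?thesis unfolding E_def by (rule has_vector_derivative_real_field)
  qed
  have low: "(f has_integral E 1) {0..1}"
  proof -
    have "((\<lambda>u. (1 - of_real u * s) * E u) has_integral (of_real 1 * E 1 - of_real 0 * E 0)) {0..1}"
    proof (rule fundamental_theorem_of_calculus)
      show "((\<lambda>u. of_real u * E u) has_vector_derivative (1 - of_real u * s) * E u) (at u within {0..1})" for u
        using has_vector_derivative_mult[OF has_vector_derivative_of_real[OF DERIV_ident] E]
        by (simp add: algebra_simps)
    qed auto
    moreover have "f u = (1 - of_real u * s) * E u" if "u \<in> {0..1}" for u
      using that by (simp add: f_def E_def laplace_kernel_def dickman1_eq_1 algebra_simps)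
    ultimately show ?thesis by (subst has_integral_cong[of "{0..1}" f]) auto
  qed
  have high1: "((\<lambda>u. f u - of_real (dickman1 (u - 1)) * E u) has_integral (e - of_real (1 * dickman1 1) * E 1)) {1..real (Suc n)}"
    unfolding e_def
  proof (rule fundamental_theorem_of_calculus_interior)
    show "continuous_on {1..real (Suc n)} (\<lambda>u. of_real (u * dickman1 u) * E u)"
      unfolding E_def by (intro continuous_intros continuous_on_dickman1)
    fix u :: real assume u: "u \<in> {1<..<real (Suc n)}"
    have "((\<lambda>u. complex_of_real (u * dickman1 u)) has_vector_derivative of_real (dickman1 u - dickman1 (u - 1))) (at u)"
      using u by (intro has_vector_derivative_of_real) (use DERIV_times_dickman1[of u] in auto)
    from has_vector_derivative_mult[OF this E]
    show "((\<lambda>u. of_real (u * dickman1 u) * E u) has_vector_derivative f u - of_real (dickman1 (u - 1)) * E u) (at u)"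
      by (simp add: f_def laplace_kernel_def E_def algebra_simps)
  qed auto
  have high2: "((\<lambda>u. of_real (dickman1 (u - 1)) * E u) has_integral exp (-s) * laplace_trunc 0 n s) {1..real (Suc n)}"
  proof -
    have "((\<lambda>u. exp (-s) * laplace_kernel 0 s u) has_integral exp (-s) * laplace_trunc 0 n s) (cbox 0 (real n))"
      unfolding laplace_trunc_def using laplace_kernel_integrable
      by (intro has_integral_mult_right integrable_integral) auto
    from has_integral_affinity[OF this, of 1 "-1"]
    have "((\<lambda>u. exp (-s) * laplace_kernel 0 s (u - 1)) has_integral exp (-s) * laplace_trunc 0 n s) {1..real n + 1}"
      by simp
    moreover have "of_real (dickman1 (u - 1)) * E u = exp (-s) * laplace_kernel 0 s (u - 1)" for u
      by (simp add: laplace_kernel_def E_def exp_add[symmetric] algebra_simps)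
    ultimately show ?thesis by (simp add: add.commute)
  qed
  have "(f has_integral (e - of_real (1 * dickman1 1) * E 1) + exp (-s) * laplace_trunc 0 n s) {1..real (Suc n)}"
    using has_integral_add[OF high1 high2] by simp
  from has_integral_combine[OF _ _ low this]
  have "(f has_integral e + exp (-s) * laplace_trunc 0 n s) {0..real (Suc n)}"
    by (simp add: dickman1_eq_1)
  moreover have "(f has_integral laplace_trunc 0 (Suc n) s + s * laplace_trunc 1 (Suc n) s) {0..real (Suc n)}"
    unfolding f_def laplace_trunc_def
    by (intro has_integral_add has_integral_mult_right integrable_integral laplace_kernel_integrable)
  ultimately have "e + exp (-s) * laplace_trunc 0 n s = laplace_trunc 0 (Suc n) s + s * laplace_trunc 1 (Suc n) s"
    by (rule has_integral_unique)
  thus ?thesis by (simp add: e_def E_def algebra_simps)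
qed

text \<open>The delay equation under the Laplace transform: the limit of the truncated identity, in
  which the decay of \<open>dickman1\<close> removes the boundary term.\<close>

lemma laplace_dickman_ode:
  "s * deriv laplace_dickman s = - (1 - exp (-s)) * laplace_dickman s"
proof -
  have lim: "(\<lambda>n. laplace_trunc 0 (Suc n) s - exp (-s) * laplace_trunc 0 n s + s * laplace_trunc 1 (Suc n) s)
    \<longlonglongrightarrow> laplace_dickman s - exp (-s) * laplace_dickman s + s * deriv laplace_dickman s"
    using laplace_trunc_tendsto[of 0 s] laplace_trunc_tendsto[of 1 s]
    by (intro tendsto_intros LIMSEQ_Suc) auto
  obtain K where K: "K > 0" "\<And>u. dickman1 u \<le> K * exp (- (\<bar>Re s\<bar> + 1) * u)"
    using dickman1_exp_decay[of "\<bar>Re s\<bar> + 1"] by auto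
  have "(\<lambda>n. of_real (real (Suc n) * dickman1 (real (Suc n))) * exp (- of_real (real (Suc n)) * s)) \<longlonglongrightarrow> 0"
  proof (rule Lim_null_comparison)
    show "(\<lambda>n. K * (real (Suc n) * exp (- real (Suc n)))) \<longlonglongrightarrow> 0" by real_asymp
    show "\<forall>\<^sub>F n in sequentially. norm (of_real (real (Suc n) * dickman1 (real (Suc n))) * exp (- of_real (real (Suc n)) * s))
            \<le> K * (real (Suc n) * exp (- real (Suc n)))"
    proof (rule always_eventually, rule allI)
      fix n
      define u where "u = real (Suc n)"
      have "u \<ge> 0" by (simp add: u_def)
      have "norm (of_real (u * dickman1 u) * exp (- of_real u * s)) = u * dickman1 u * exp (- (u * Re s))"
        using dickman1_pos[of u] \<open>u \<ge> 0\<close> by (simp add: norm_mult)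
      also have "\<dots> \<le> u * (K * exp (- (\<bar>Re s\<bar> + 1) * u)) * exp (u * \<bar>Re s\<bar>)"
      proof (intro mult_mono K)
        have "u * - Re s \<le> u * \<bar>Re s\<bar>" using \<open>u \<ge> 0\<close> by (intro mult_left_mono) auto
        thus "exp (- (u * Re s)) \<le> exp (u * \<bar>Re s\<bar>)" by simp
      qed (use K \<open>u \<ge> 0\<close> dickman1_pos[of u] in auto)
      also have "\<dots> = K * (u * exp (-u))" by (simp add: exp_add[symmetric] algebra_simps)
      finally show "norm (of_real (real (Suc n) * dickman1 (real (Suc n))) * exp (- of_real (real (Suc n)) * s))
            \<le> K * (real (Suc n) * exp (- real (Suc n)))" by (simp only: u_def)
    qed
  qed
  with lim have "laplace_dickman s - exp (-s) * laplace_dickman s + s * deriv laplace_dickman s = 0"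
    unfolding laplace_trunc_parts by (rule LIMSEQ_unique)
  thus ?thesis by (simp add: algebra_simps add_eq_0_iff)
qed

text \<open>Differentiation under the integral at \<open>s = - A\<close>, with the sign of
  \<open>(- u)^j\<close>. Most of the work identifies the Lebesgue integral in
  \<open>D_const\<close> with the limit of the truncated integrals.\<close>

lemma higher_deriv_laplace_dickman:
  "(deriv ^^ j) laplace_dickman (- of_real A) = (-1) ^ j * of_real (D_const j A)"
proof -
  \<comment> \<open>\<open>\<bar>A\<bar>\<close> is spent on \<open>exp (A * u)\<close>, one unit on
    \<open>u ^ j \<le> fact j * exp u\<close>, and the other leaves the integrable
    \<open>exp (- u)\<close>.\<close>
  obtain K where K: "K > 0" "\<And>u. dickman1 u \<le> K * exp (- (\<bar>A\<bar> + 2) * u)"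
    using dickman1_exp_decay[of "\<bar>A\<bar> + 2"] by auto
  define f where "f = (\<lambda>u. exp (A * u) * u ^ j * dickman1 u)"
  have cont: "continuous_on S f" for S
    unfolding f_def by (intro continuous_intros continuous_on_dickman1)
  have bound: "\<bar>f u\<bar> \<le> (K * fact j) * exp (-u)" if "u \<ge> 0" for u
  proof -
    have "u ^ j / fact j \<le> exp u"
      using sum_le_suminf[OF summable_exp[of u], of "{j}"] that
      by (simp add: exp_def divide_inverse mult.commute)
    hence "u ^ j \<le> fact j * exp u" by (simp add: field_simps)
    moreover have "A * u \<le> \<bar>A\<bar> * u" using that by (intro mult_right_mono) auto
    ultimately have "f u \<le> exp (\<bar>A\<bar> * u) * (fact j * exp u) * (K * exp (- (\<bar>A\<bar> + 2) * u))"
      unfolding f_def using that K dickman1_pos[of u] by (intro mult_mono) auto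
    also have "\<dots> = (K * fact j) * exp (-u)" by (simp add: exp_add[symmetric] algebra_simps)
    finally show ?thesis using that dickman1_pos[of u] by (simp add: f_def less_imp_le)
  qed
  have meas [measurable]: "f \<in> borel_measurable borel"
    by (rule borel_measurable_continuous_onI[OF cont])
  have int: "set_integrable lborel {0..} f"
  proof -
    have "(\<lambda>x. exp (-1 * x)) absolutely_integrable_on {0::real..}"
      using has_integral_exp_minus_to_infinity[of 1 0]
      by (intro nonnegative_absolutely_integrable_1) (auto simp: integrable_on_def)
    hence "set_integrable lborel {0..} (\<lambda>x. exp (-1 * x) :: real)"
      unfolding set_integrable_def by (subst (asm) integrable_completion) auto
    hence "set_integrable lborel {0..} (\<lambda>x. (K * fact j) * exp (-x))"
      by (intro set_integrable_mult_right) simp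
    thus ?thesis
      by (rule set_integrable_bound)
         (use bound K meas in \<open>auto simp: set_borel_measurable_def abs_mult intro!: AE_I2\<close>)
  qed
  have D: "D_const j A = (LBINT u:{0..}. f u)"
  proof -
    have "D_const j A = (LBINT u:{0<..}. f u)"
      unfolding D_const_def f_def by (intro set_lebesgue_integral_cong) (auto simp: dickman1_eq_dickman)
    also have "\<dots> = (LBINT u:{0..}. f u)"
      by (rule set_integral_cong_set)
         (use meas in \<open>auto simp: set_borel_measurable_def intro!: AE_I[of _ _ "{0}"]\<close>)
    finally show ?thesis .
  qed
  have "((\<lambda>b. LBINT u:{0..b}. f u) \<longlongrightarrow> (LBINT u:{0..}. f u)) at_top"
    by (intro tendsto_set_lebesgue_integral_at_top int) auto
  hence "(\<lambda>n. LBINT u:{0..real n}. f u) \<longlonglongrightarrow> D_const j A"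
    unfolding D by (rule filterlim_compose[OF _ filterlim_real_sequentially])
  moreover have "(LBINT u:{0..real n}. f u) = integral {0..real n} f" for n
    by (intro set_borel_integral_eq_integral borel_integrable_atLeastAtMost' cont)
  ultimately have "(\<lambda>n. (-1) ^ j * complex_of_real (integral {0..real n} f)) \<longlonglongrightarrow> (-1) ^ j * of_real (D_const j A)"
    by (intro tendsto_intros) simp
  moreover have "laplace_trunc j n (- of_real A) = (-1) ^ j * of_real (integral {0..real n} f)" for n
  proof -
    have "laplace_kernel j (- of_real A) = (\<lambda>u. (-1) ^ j * complex_of_real (f u))"
      by (auto simp: fun_eq_iff laplace_kernel_def f_def power_minus[of "of_real _"] mult_ac exp_of_real[symmetric])
    moreover have "f integrable_on {0..real n}" by (intro integrable_continuous_real cont)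
    ultimately show ?thesis
      unfolding laplace_trunc_def
      using integral_linear[of f "{0..real n}" complex_of_real] by (simp add: bounded_linear_of_real o_def)
  qed
  ultimately have "(\<lambda>n. laplace_trunc j n (- of_real A)) \<longlonglongrightarrow> (-1) ^ j * of_real (D_const j A)" by simp
  with laplace_trunc_tendsto show ?thesis by (rule LIMSEQ_unique)
qed

text \<open>On \<open>[0, 1]\<close> the Dickman function is 1, which gives the quotient exactly.
  Beyond 1 it is at most 1, and the unit pieces are dominated by a geometric series with first term
  \<open>exp (-S)\<close> and ratio \<open>exp (-1)\<close>.\<close>

lemma laplace_dickman_approx_at_large:
  assumes "S \<ge> 1"
  shows "cmod (laplace_dickman (of_real S) - (1 - exp (- of_real S)) / of_real S) \<le> 2 * exp (-S)"
proof -
  define I where "I = (\<lambda>n. integral {real n..real (Suc n)} (laplace_kernel 0 (of_real S)))"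
  have I0: "I 0 = (1 - exp (- of_real S)) / of_real S"
  proof -
    have "((\<lambda>u. exp (- of_real u * of_real S)) has_integral
       (- exp (- of_real 1 * of_real S) / of_real S - (- exp (- of_real 0 * of_real S) / of_real S :: complex))) {0..1::real}"
    proof (rule fundamental_theorem_of_calculus)
      fix u :: real
      have "((\<lambda>z. - exp (- z * of_real S) / of_real S) has_field_derivative exp (- of_real u * of_real S))
          (at (of_real u :: complex))"
        using assms by (auto intro!: derivative_eq_intros)
      thus "((\<lambda>u. - exp (- of_real u * of_real S) / of_real S) has_vector_derivative
          (exp (- of_real u * of_real S) :: complex)) (at u within {0..1})"
        by (intro has_vector_derivative_real_field)
    qed auto
    hence "integral {0..1} (\<lambda>u. exp (- of_real u * of_real S) :: complex) = (1 - exp (- of_real S)) / of_real S"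
      by (simp add: integral_unique diff_divide_distrib)
    moreover have "I 0 = integral {0..1} (\<lambda>u. exp (- of_real u * of_real S))"
      unfolding I_def by (simp, intro integral_cong) (auto simp: laplace_kernel_def dickman1_eq_1)
    ultimately show ?thesis by simp
  qed
  have bound: "norm (I (Suc n)) \<le> exp (-S) * exp (-1) ^ n" for n
  proof -
    have "norm (I (Suc n)) \<le> exp (- S - real n) * (real (Suc (Suc n)) - real (Suc n))"
      unfolding I_def
    proof (rule integral_bound)
      fix u assume u: "u \<in> {real (Suc n)..real (Suc (Suc n))}"
      have "norm (laplace_kernel 0 (of_real S) u) = dickman1 u * exp (- (u * S))"
        using dickman1_pos[of u] by (simp add: laplace_kernel_def norm_mult)
      also have "\<dots> \<le> 1 * exp (- S - real n)"
      proof (intro mult_mono dickman1_le_1)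
        have "S + real n \<le> S + real n * S" using mult_left_mono[OF assms, of "real n"] by simp
        also have "\<dots> \<le> u * S" using u assms mult_right_mono[of "real (Suc n)" u S] by (simp add: algebra_simps)
        finally show "exp (- (u * S)) \<le> exp (- S - real n)" by simp
      qed auto
      finally show "norm (laplace_kernel 0 (of_real S) u) \<le> exp (- S - real n)" by simp
    qed (auto intro: continuous_on_laplace_kernel)
    thus ?thesis by (simp add: exp_of_nat_mult[symmetric] exp_add[symmetric])
  qed
  have geo: "(\<lambda>n. exp (-S) * exp (-1) ^ n) sums (exp (-S) * (1 / (1 - exp (-1))))"
    by (intro sums_mult geometric_sums) auto
  have summ: "summable (\<lambda>n. I (Suc n))"
    by (rule summable_comparison_test[OF _ sums_summable[OF geo]]) (use bound in auto)
  have "laplace_dickman (of_real S) - I 0 = (\<Sum>n. I (Suc n))"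
    using suminf_split_head[of I] summ unfolding summable_Suc_iff by (simp add: laplace_dickman_def I_def)
  also have "norm \<dots> \<le> (\<Sum>n. exp (-S) * exp (-1) ^ n)"
    by (rule norm_suminf_le[OF bound sums_summable[OF geo]])
  also have "\<dots> = exp (-S) * (1 / (1 - exp (-1)))" using geo by (simp add: sums_iff)
  also have "\<dots> \<le> exp (-S) * 2"
  proof (intro mult_left_mono)
    have "exp (1 :: real) \<ge> 2" using exp_ge_add_one_self[of 1] by simp
    hence "exp (-1 :: real) \<le> 1 / 2" by (simp add: exp_minus field_simps)
    thus "1 / (1 - exp (-1 :: real)) \<le> 2" by (simp add: field_simps)
  qed auto
  finally show ?thesis by (simp add: I0 mult.commute)
qed

subsection \<open>Sums over primes and the harmonic sum\<close>

lemma norm_exp_diff_le: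
  fixes a b :: complex
  assumes "Re a \<le> R" "Re b \<le> R"
  shows "cmod (exp a - exp b) \<le> exp R * cmod (a - b)"
proof (rule field_differentiable_bound[of "{z. Re z \<le> R}" exp exp])
  show "convex {z. Re z \<le> R}" by (rule convex_halfspace_Re_le)
  show "(exp has_field_derivative exp z) (at z within {z. Re z \<le> R})" for z
    by (auto intro!: derivative_eq_intros)
qed (use assms in auto)

lemma of_nat_powr_eq_exp:
  "n > 0 \<Longrightarrow> of_nat n powr s = exp (s * complex_of_real (ln (real n)))"
  by (simp add: powr_def Ln_of_nat)

lemma norm_of_nat_powr: "n > 0 \<Longrightarrow> cmod (of_nat n powr s) = real n powr Re s"
  by (simp add: norm_powr_real_powr)

lemma sum_inverse_le:
  assumes "Y > 0"
  shows "(\<Sum>n=1..Y. 1 / real n) \<le> 1 + ln (real Y)"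
  using assms
proof (induction Y rule: nat_induct_non_zero)
  case (Suc n)
  have "ln (real n / real (Suc n)) \<le> real n / real (Suc n) - 1"
    using Suc.hyps by (intro ln_le_minus_one) auto
  hence "1 / real (Suc n) \<le> ln (real (Suc n)) - ln (real n)"
    using Suc.hyps by (simp add: ln_div field_simps)
  thus ?case using Suc.IH by simp
qed auto

lemma sum_inverse_ge: "ln (real Y + 1) \<le> (\<Sum>n=1..Y. 1 / real n)"
  using ln_le_harm[of Y] by (simp add: harm_def inverse_eq_divide)

text \<open>Summation by parts moves the cancellation in \<open>a\<close> into its partial sums, so
  only the last value and the variation of \<open>f\<close> are paid for.\<close>

lemma abel_summation_bound:
  fixes a :: "nat \<Rightarrow> real" and f :: "nat \<Rightarrow> complex"
  assumes a: "\<And>m. m \<le> Y \<Longrightarrow> \<bar>\<Sum>n=1..m. a n\<bar> \<le> C" and "Y > 0"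
  shows "cmod (\<Sum>n=1..Y. of_real (a n) * f n) \<le> C * (cmod (f Y) + (\<Sum>n=1..<Y. cmod (f n - f (Suc n))))"
proof -
  define s where "s = (\<lambda>m. \<Sum>n=1..m. a n)"
  have s_le: "\<bar>s m\<bar> \<le> C" if "m \<le> Y" for m using a[OF that] by (simp add: s_def)
  have eq: "(\<Sum>n=1..m. of_real (a n) * f n) = of_real (s m) * f m + (\<Sum>n=1..<m. of_real (s n) * (f n - f (Suc n)))"
    if "m > 0" for m using that
  proof (induction m rule: nat_induct_non_zero)
    case 1
    thus ?case by (simp add: s_def)
  next
    case (Suc m)
    have "s (Suc m) = s m + a (Suc m)" by (simp add: s_def)
    thus ?case using Suc by (simp add: sum.atLeastLessThan_Suc algebra_simps)
  qed
  have "cmod (\<Sum>n=1..Y. of_real (a n) * f n) \<le>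
    cmod (of_real (s Y) * f Y) + cmod (\<Sum>n=1..<Y. of_real (s n) * (f n - f (Suc n)))"
    unfolding eq[OF \<open>Y > 0\<close>] by (rule norm_triangle_ineq)
  also have "\<dots> \<le> C * cmod (f Y) + (\<Sum>n=1..<Y. C * cmod (f n - f (Suc n)))"
    using s_le assms(2)
    by (intro add_mono order_trans[OF norm_sum] sum_mono) (auto simp: norm_mult intro!: mult_right_mono)
  finally show ?thesis by (simp add: sum_distrib_left distrib_left)
qed

text \<open>With \<open>s = 1 + w / \<Lambda>\<close> the main term of
  \<open>sum_powr_eq_zterm\<close> is \<open>(1 - (Y + 1)^(1 - s)) / (s - 1)\<close>, and
  \<open>(Y + 1)^(1 - s) = exp (- t * w)\<close> with \<open>t\<close> within
  \<open>(1 + D) / \<Lambda>\<close> of 1. \<open>\<Lambda> \<ge> 4 * B\<close> keeps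
  \<open>Re s\<close> at least 3/4, so that the remaining series is bounded by a constant.
  \<open>D\<close> records how far \<open>ln Y\<close> may fall short of \<Lambda>.\<close>

lemma harmonic_twist_bound:
  fixes B :: real
  obtains C where "C > 0" "\<And>\<Lambda> D Y w. \<lbrakk>\<Lambda> \<ge> 1; \<Lambda> \<ge> 4 * B; D \<ge> 0; Y > 0; ln (real Y) \<le> \<Lambda>; \<Lambda> \<le> ln (real Y) + D; w \<noteq> 0; Re w \<ge> - B\<rbrakk> \<Longrightarrow>
     cmod ((\<Sum>n=1..Y. of_nat n powr (-(1 + w / of_real \<Lambda>))) / of_real \<Lambda> - (1 - exp (-w)) / w) \<le> C * ((1 + cmod w) * (1 + D) / \<Lambda>)"
proof -
  define Z where "Z = (\<Sum>n. real (Suc n) powr (-7/4))"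
  have summ: "summable (\<lambda>n. real (Suc n) powr (-7/4))" using summable_Suc_powr[of "7/4"] by simp
  have Z0: "Z \<ge> 0" unfolding Z_def by (intro suminf_nonneg summ) auto
  define C where "C = exp (2 * \<bar>B\<bar>) + Z"
  have "cmod ((\<Sum>n=1..Y. of_nat n powr (-(1 + w / of_real \<Lambda>))) / of_real \<Lambda> - (1 - exp (-w)) / w) \<le> C * ((1 + cmod w) * (1 + D) / \<Lambda>)"
    if L1: "\<Lambda> \<ge> 1" and LB: "\<Lambda> \<ge> 4 * B" and D: "D \<ge> 0" and Y: "Y > 0" and lnY: "ln (real Y) \<le> \<Lambda>" "\<Lambda> \<le> ln (real Y) + D"
      and w: "w \<noteq> 0" "Re w \<ge> - B" for \<Lambda> D Y w
  proof -
    define s where "s = 1 + w / of_real \<Lambda>"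
    have s1: "s \<noteq> 1" using w L1 by (auto simp: s_def)
    have Res: "Re s \<ge> 3 / 4"
      using w L1 LB by (simp add: s_def field_simps)
    define t where "t = ln (real (Suc Y)) / \<Lambda>"
    have ln_Suc: "ln (real (Suc Y)) \<le> ln (real Y) + 1" "ln (real (Suc Y)) \<ge> ln (real Y)"
    proof -
      have "ln (real (Suc Y)) \<le> ln (real Y * exp 1)"
      proof (subst ln_le_cancel_iff)
        have "real (Suc Y) \<le> real Y * 2" using Y by simp
        also have "\<dots> \<le> real Y * exp 1" using exp_ge_add_one_self[of 1] by (intro mult_left_mono) auto
        finally show "real (Suc Y) \<le> real Y * exp 1" .
      qed (use Y in auto)
      thus "ln (real (Suc Y)) \<le> ln (real Y) + 1" using Y by (simp add: ln_mult)
      show "ln (real (Suc Y)) \<ge> ln (real Y)" using Y by simp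
    qed
    have t: "0 \<le> t" "t \<le> 2" "\<bar>t - 1\<bar> \<le> (1 + D) / \<Lambda>"
    proof -
      show "0 \<le> t" using L1 by (simp add: t_def)
      show "t \<le> 2" using ln_Suc lnY L1 by (simp add: t_def field_simps)
      have "\<bar>ln (real (Suc Y)) - \<Lambda>\<bar> \<le> 1 + D" using ln_Suc lnY D by linarith
      moreover have "t - 1 = (ln (real (Suc Y)) - \<Lambda>) / \<Lambda>" using L1 by (simp add: t_def field_simps)
      ultimately show "\<bar>t - 1\<bar> \<le> (1 + D) / \<Lambda>" using L1 by (simp add: abs_divide divide_right_mono)
    qed
    have pw: "of_nat (Suc Y) powr (1 - s) = exp (- w * of_real t)"
      unfolding s_def t_def using L1 by (subst of_nat_powr_eq_exp) (auto simp: field_simps)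
    have "(\<Sum>n=1..Y. of_nat n powr (-s)) = (\<Sum>n<Y. of_nat (Suc n) powr (-s))"
      by (rule sum.reindex_bij_witness[of _ Suc "\<lambda>n. n - 1"]) auto
    also have "\<dots> = (1 - exp (- w * of_real t)) / (s - 1) - s * (\<Sum>n<Y. zterm (\<lambda>t. t - 1) n (s + 1))"
      by (subst sum_powr_eq_zterm[OF s1]) (simp only: pw)
    finally have eq: "(\<Sum>n=1..Y. of_nat n powr (-s)) =
      (1 - exp (- w * of_real t)) / (s - 1) - s * (\<Sum>n<Y. zterm (\<lambda>t. t - 1) n (s + 1))" .
    have eq: "(\<Sum>n=1..Y. of_nat n powr (-s)) / of_real \<Lambda> - (1 - exp (-w)) / w =
      (exp (-w) - exp (- w * of_real t)) / w - s * (\<Sum>n<Y. zterm (\<lambda>t. t - 1) n (s + 1)) / of_real \<Lambda>"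
    proof -
      have "s - 1 = w / of_real \<Lambda>" by (simp add: s_def)
      moreover have "(1 - x) / (w / of_real \<Lambda>) / of_real \<Lambda> = (1 - x) / w" for x
        using L1 w by simp
      ultimately show ?thesis using eq by (simp only:) (simp add: diff_divide_distrib)
    qed
    have 1: "cmod ((exp (-w) - exp (- w * of_real t)) / w) \<le> exp (2 * \<bar>B\<bar>) * ((1 + D) / \<Lambda>)"
    proof -
      have "Re (-w) \<le> 2 * \<bar>B\<bar>" using w by auto
      moreover have "Re (- w * of_real t) \<le> 2 * \<bar>B\<bar>"
      proof -
        have "Re (- w * of_real t) = t * (- Re w)" by simp
        also have "\<dots> \<le> t * \<bar>B\<bar>" using t w by (intro mult_left_mono) auto
        also have "\<dots> \<le> 2 * \<bar>B\<bar>" using t by (intro mult_right_mono) auto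
        finally show ?thesis .
      qed
      ultimately have "cmod (exp (-w) - exp (- w * of_real t)) \<le> exp (2 * \<bar>B\<bar>) * cmod (-w - (- w * of_real t))"
        by (rule norm_exp_diff_le)
      also have "-w - (- w * of_real t) = w * of_real (t - 1)" by (simp add: algebra_simps)
      also have "cmod \<dots> = cmod w * \<bar>t - 1\<bar>" by (simp only: norm_mult norm_of_real)
      also have "exp (2 * \<bar>B\<bar>) * (cmod w * \<bar>t - 1\<bar>) \<le> exp (2 * \<bar>B\<bar>) * (cmod w * ((1 + D) / \<Lambda>))"
        using t by (intro mult_left_mono) auto
      finally show ?thesis using w by (simp add: norm_divide field_simps)
    qed
    have 2: "cmod (s * (\<Sum>n<Y. zterm (\<lambda>t. t - 1) n (s + 1)) / of_real \<Lambda>) \<le> (1 + cmod w) * Z / \<Lambda>"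
    proof -
      have "cmod s \<le> 1 + cmod w / \<Lambda>"
        unfolding s_def using L1 norm_triangle_ineq[of 1 "w / of_real \<Lambda>"] by (simp add: norm_divide)
      also have "\<dots> \<le> 1 + cmod w" using L1 mult_right_mono[OF L1, of "cmod w"] by (simp add: field_simps)
      finally have cs: "cmod s \<le> 1 + cmod w" .
      have "cmod (\<Sum>n<Y. zterm (\<lambda>t. t - 1) n (s + 1)) \<le> (\<Sum>n<Y. 1 * real (Suc n) powr (-(7/4)))"
        using Res by (intro order_trans[OF norm_sum] sum_mono zterm_bound) (auto intro!: continuous_intros)
      also have "\<dots> \<le> Z" unfolding Z_def using summ by (simp del: of_nat_Suc, intro sum_le_suminf) auto
      finally show ?thesis using cs L1 Z0
        by (auto simp: norm_mult norm_divide intro!: divide_right_mono mult_mono)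
    qed
    have "cmod ((\<Sum>n=1..Y. of_nat n powr (-s)) / of_real \<Lambda> - (1 - exp (-w)) / w) \<le>
       exp (2 * \<bar>B\<bar>) * ((1 + D) / \<Lambda>) + (1 + cmod w) * Z / \<Lambda>"
      unfolding eq by (rule order_trans[OF norm_triangle_ineq4 add_mono[OF 1 2]])
    also have "\<dots> \<le> exp (2 * \<bar>B\<bar>) * ((1 + cmod w) * (1 + D) / \<Lambda>) + Z * ((1 + cmod w) * (1 + D) / \<Lambda>)"
    proof (intro add_mono mult_left_mono)
      have "1 * (1 + D) / \<Lambda> \<le> (1 + cmod w) * (1 + D) / \<Lambda>"
        using D L1 by (intro divide_right_mono mult_right_mono) auto
      thus "(1 + D) / \<Lambda> \<le> (1 + cmod w) * (1 + D) / \<Lambda>" by simp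
      have "(1 + cmod w) * Z * 1 / \<Lambda> \<le> (1 + cmod w) * Z * (1 + D) / \<Lambda>"
        using D L1 Z0 by (intro divide_right_mono mult_left_mono) auto
      thus "(1 + cmod w) * Z / \<Lambda> \<le> Z * ((1 + cmod w) * (1 + D) / \<Lambda>)" by (simp add: mult_ac)
    qed auto
    finally show ?thesis unfolding C_def s_def distrib_right .
  qed
  moreover have "C > 0" using Z0 by (simp add: C_def add_pos_nonneg)
  ultimately show ?thesis using that by blast
qed

text \<open>The difference \<open>a\<close> of the weight \<open>ln p / p\<close> on primes and the
  weight \<open>1 / n\<close> has bounded partial sums by \<open>mertens_weak\<close>. The twist
  \<open>n^(- w / \<Lambda>)\<close> has size at most \<open>exp \<bar>B\<bar>\<close> and variation
  at most \<open>exp \<bar>B\<bar> * cmod w\<close>, because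
  \<open>ln Y \<le> \<Lambda>\<close>.\<close>

lemma prime_twist_bound:
  fixes B :: real
  obtains C where "C > 0" "\<And>\<Lambda> Y w. \<lbrakk>\<Lambda> \<ge> 1; Y > 0; ln (real Y) \<le> \<Lambda>; Re w \<ge> - B\<rbrakk> \<Longrightarrow>
     cmod ((\<Sum>p | prime p \<and> p \<le> Y. of_real (ln (real p)) * of_nat p powr (-(1 + w / of_real \<Lambda>))) - (\<Sum>n=1..Y. of_nat n powr (-(1 + w / of_real \<Lambda>)))) \<le> C * (1 + cmod w)"
proof -
  obtain C1 where C1: "\<And>m::nat. m > 0 \<Longrightarrow> \<bar>(\<Sum>p | prime p \<and> p \<le> m. ln p / p) - ln m\<bar> \<le> C1"
    using mertens_weak by blast
  define C where "C = C1 + 1"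
  have C1_0: "C1 \<ge> 0" using C1[of 1] by linarith
  define a :: "nat \<Rightarrow> real" where "a = (\<lambda>n. ((if prime n then ln (real n) else 0) - 1) / real n)"
  have prime_sum: "(\<Sum>n=1..m. if prime n then f n else 0) = (\<Sum>p | prime p \<and> p \<le> m. f p)" for f :: "nat \<Rightarrow> 'a :: comm_monoid_add" and m
    by (subst sum.inter_filter[symmetric]) (auto intro!: sum.cong dest: prime_ge_1_nat)
  have a: "\<bar>\<Sum>n=1..m. a n\<bar> \<le> C" for m
  proof (cases "m = 0")
    case False
    have "(\<Sum>n=1..m. a n) = (\<Sum>n=1..m. (if prime n then ln (real n) / real n else 0)) - (\<Sum>n=1..m. 1 / real n)"
      by (subst sum_subtractf[symmetric]) (auto simp: a_def intro!: sum.cong simp: diff_divide_distrib)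
    also have "(\<Sum>n=1..m. (if prime n then ln (real n) / real n else 0)) = (\<Sum>p | prime p \<and> p \<le> m. ln p / p)"
      by (rule prime_sum)
    finally have "(\<Sum>n=1..m. a n) = (\<Sum>p | prime p \<and> p \<le> m. ln p / p) - (\<Sum>n=1..m. 1 / real n)" .
    moreover have "ln (real m) \<le> ln (real m + 1)" using False by simp
    ultimately show ?thesis
      using C1[of m] sum_inverse_le[of m] sum_inverse_ge[of m] False unfolding C_def by linarith
  qed (use C1_0 in \<open>auto simp: C_def\<close>)
  have "cmod ((\<Sum>p | prime p \<and> p \<le> Y. of_real (ln (real p)) * of_nat p powr (-(1 + w / of_real \<Lambda>))) - (\<Sum>n=1..Y. of_nat n powr (-(1 + w / of_real \<Lambda>)))) \<le> C * exp \<bar>B\<bar> * (1 + cmod w)"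
    if L1: "\<Lambda> \<ge> 1" and Y: "Y > 0" and lnY: "ln (real Y) \<le> \<Lambda>" and w: "Re w \<ge> - B" for \<Lambda> Y w
  proof -
    define h where "h = (\<lambda>n. - w / of_real \<Lambda> * of_real (ln (real n)))"
    define f where "f = (\<lambda>n. exp (h n))"
    have pw: "of_nat n powr (-(1 + w / of_real \<Lambda>)) = f n / of_nat n" if "n > 0" for n
    proof -
      have "of_nat n powr (-(1 + w / of_real \<Lambda>)) = exp (- of_real (ln (real n)) + h n)"
        using that by (simp add: of_nat_powr_eq_exp h_def algebra_simps)
      also have "\<dots> = f n / exp (of_real (ln (real n)))"
        by (simp add: exp_diff f_def)
      also have "exp (of_real (ln (real n))) = complex_of_real (real n)"
        using that by (subst exp_of_real) simp
      finally show ?thesis by simp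
    qed
    have Re_h: "Re (h n) \<le> \<bar>B\<bar>" if "1 \<le> n" "n \<le> Y" for n
    proof -
      have "Re (h n) = (- Re w) * (ln (real n) / \<Lambda>)" by (simp add: h_def)
      also have "\<dots> \<le> \<bar>B\<bar> * (ln (real n) / \<Lambda>)"
        using that L1 w by (intro mult_right_mono) auto
      also have "\<dots> \<le> \<bar>B\<bar> * 1"
      proof (intro mult_left_mono)
        have "ln (real n) \<le> ln (real Y)" using that by simp
        thus "ln (real n) / \<Lambda> \<le> 1" using lnY L1 by simp
      qed auto
      finally show ?thesis by simp
    qed
    have "(\<Sum>p | prime p \<and> p \<le> Y. of_real (ln (real p)) * of_nat p powr (-(1 + w / of_real \<Lambda>))) =
       (\<Sum>n=1..Y. if prime n then of_real (ln (real n)) * of_nat n powr (-(1 + w / of_real \<Lambda>)) else 0)"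
      by (rule prime_sum[symmetric])
    hence "(\<Sum>p | prime p \<and> p \<le> Y. of_real (ln (real p)) * of_nat p powr (-(1 + w / of_real \<Lambda>))) - (\<Sum>n=1..Y. of_nat n powr (-(1 + w / of_real \<Lambda>)))
       = (\<Sum>n=1..Y. of_real (a n) * f n)"
      by (simp add: sum_subtractf[symmetric] del: minus_add_distrib, intro sum.cong)
         (auto simp: a_def pw field_simps simp del: minus_add_distrib)
    also have "cmod \<dots> \<le> C * (cmod (f Y) + (\<Sum>n=1..<Y. cmod (f n - f (Suc n))))"
      by (rule abel_summation_bound[OF a Y])
    also have "\<dots> \<le> C * (exp \<bar>B\<bar> + exp \<bar>B\<bar> * cmod w)"
    proof (intro mult_left_mono add_mono)
      show "cmod (f Y) \<le> exp \<bar>B\<bar>" using Re_h[of Y] Y by (simp add: f_def)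
      have "(\<Sum>n=1..<Y. cmod (f n - f (Suc n))) \<le> (\<Sum>n=1..<Y. exp \<bar>B\<bar> * (cmod w / \<Lambda>) * (ln (real (Suc n)) - ln (real n)))"
      proof (intro sum_mono)
        fix n assume n: "n \<in> {1..<Y}"
        have "cmod (f n - f (Suc n)) \<le> exp \<bar>B\<bar> * cmod (h n - h (Suc n))"
          unfolding f_def using n by (intro norm_exp_diff_le Re_h) auto
        also have "h n - h (Suc n) = w / of_real \<Lambda> * of_real (ln (real (Suc n)) - ln (real n))"
          by (simp add: h_def algebra_simps)
        also have "cmod \<dots> = cmod w / \<Lambda> * (ln (real (Suc n)) - ln (real n))"
          using L1 n unfolding norm_mult norm_of_real by (simp add: norm_divide)
        finally show "cmod (f n - f (Suc n)) \<le> exp \<bar>B\<bar> * (cmod w / \<Lambda>) * (ln (real (Suc n)) - ln (real n))"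
          by (simp add: mult_ac)
      qed
      also have "\<dots> = exp \<bar>B\<bar> * (cmod w / \<Lambda>) * ln (real Y)"
        using Y by (subst sum_distrib_left[symmetric], subst sum_Suc_diff') auto
      also have "\<dots> \<le> exp \<bar>B\<bar> * (cmod w / \<Lambda>) * \<Lambda>"
        using lnY L1 by (intro mult_left_mono) auto
      also have "\<dots> = exp \<bar>B\<bar> * cmod w" using L1 by simp
      finally show "(\<Sum>n=1..<Y. cmod (f n - f (Suc n))) \<le> exp \<bar>B\<bar> * cmod w" .
    qed (use C1_0 in \<open>auto simp: C_def\<close>)
    finally show ?thesis by (simp add: algebra_simps)
  qed
  moreover have "C * exp \<bar>B\<bar> > 0" using C1_0 by (simp add: C_def)
  ultimately show ?thesis using that by blast
qed

subsection \<open>The Dirichlet series of smooth numbers\<close>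

text \<open>On \<open>Y\<close>-smooth numbers this is \<open>c\<close> to the number of prime
  factors counted with multiplicity, elsewhere 0. For \<open>0 \<le> c < 1\<close> it is summable
  without any power of \<open>n\<close>, as a resonator has to be.\<close>

definition smooth_weight :: "nat \<Rightarrow> real \<Rightarrow> nat \<Rightarrow> real" where
  "smooth_weight Y c = mult_ext (\<lambda>p. if prime p \<and> p \<le> Y then c else 0)"

definition smooth_zeta :: "nat \<Rightarrow> real \<Rightarrow> complex \<Rightarrow> complex" where
  "smooth_zeta Y c z = (\<Prod>p | prime p \<and> p \<le> Y. 1 / (1 - of_real c * of_nat p powr (-z)))"

lemma finite_primes_le: "finite {p :: nat. prime p \<and> p \<le> Y}"
  by simp

lemma prime_powr_norm_less_1:
  assumes "prime p" "Re z > 0" "0 \<le> c" "c \<le> 1"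
  shows "cmod (of_real c * of_nat p powr (-z)) < 1"
proof -
  have "p > 1" using assms prime_gt_1_nat by blast
  hence "cmod (of_nat p powr (-z)) < 1"
    using assms by (simp add: norm_of_nat_powr powr_less_one)
  moreover have "c * cmod (of_nat p powr (-z)) \<le> 1 * cmod (of_nat p powr (-z))"
    using assms by (intro mult_right_mono) auto
  moreover have "cmod (of_real c * of_nat p powr (-z)) = c * cmod (of_nat p powr (-z))"
    using assms by (simp add: norm_mult)
  ultimately show ?thesis by linarith
qed

lemma smooth_weight_times_powr:
  "complex_of_real (smooth_weight Y c n) * of_nat n powr s =
     mult_ext (\<lambda>p. of_real (if prime p \<and> p \<le> Y then c else 0) * of_nat p powr s) n"
  by (cases "n = 0") (simp_all add: smooth_weight_def mult_ext_times_powr mult_ext_of_real)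

lemma has_sum_smooth_zeta:
  assumes "Re z > 0" "0 \<le> c" "c \<le> 1"
  shows "((\<lambda>n. of_real (smooth_weight Y c n) * of_nat n powr (-z)) has_sum smooth_zeta Y c z) UNIV"
proof -
  have "(mult_ext (\<lambda>p. of_real (if prime p \<and> p \<le> Y then c else 0) * of_nat p powr (-z)) has_sum
    (\<Prod>p | prime p \<and> p \<le> Y. 1 / (1 - of_real (if prime p \<and> p \<le> Y then c else 0) * of_nat p powr (-z)))) UNIV"
    using prime_powr_norm_less_1[OF _ assms]
    by (intro euler_product_finite) auto
  also have "(\<Prod>p | prime p \<and> p \<le> Y. 1 / (1 - of_real (if prime p \<and> p \<le> Y then c else 0) * of_nat p powr (-z))) = smooth_zeta Y c z"
    unfolding smooth_zeta_def by (intro prod.cong) auto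
  finally show ?thesis by (simp only: smooth_weight_times_powr)
qed

lemma smooth_weight_has_sum:
  assumes "0 \<le> c" "c < 1"
  shows "(smooth_weight Y c has_sum (\<Prod>p | prime p \<and> p \<le> Y. 1 / (1 - c))) UNIV"
proof -
  have "(mult_ext (\<lambda>p. of_real (if prime p \<and> p \<le> Y then c else 0)) has_sum
    (\<Prod>p | prime p \<and> p \<le> Y. 1 / (1 - complex_of_real (if prime p \<and> p \<le> Y then c else 0)))) UNIV"
    using assms by (intro euler_product_finite) auto
  also have "(\<Prod>p | prime p \<and> p \<le> Y. 1 / (1 - complex_of_real (if prime p \<and> p \<le> Y then c else 0))) =
     of_real (\<Prod>p | prime p \<and> p \<le> Y. 1 / (1 - c))"
    unfolding of_real_prod by (intro prod.cong) auto
  finally show ?thesis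
    unfolding smooth_weight_def by (subst has_sum_of_real_iff[where 'a=complex, symmetric]) (simp only: mult_ext_of_real)
qed

lemma smooth_weight_nonneg: "0 \<le> c \<Longrightarrow> 0 \<le> smooth_weight Y c n"
  unfolding smooth_weight_def by (intro mult_ext_nonneg) auto

lemma smooth_weight_le_1: "0 \<le> c \<Longrightarrow> c \<le> 1 \<Longrightarrow> smooth_weight Y c n \<le> 1"
  unfolding smooth_weight_def by (intro mult_ext_le_1) auto

text \<open>All prime factors of \<open>n \<le> Y\<close> are admissible, so the weight is
  \<open>(1 - \<delta>) ^ k\<close> with \<open>k\<close> prime factors. Bernoulli's inequality
  applies, and \<open>2 ^ k \<le> n\<close> gives \<open>k \<le> 2 * ln n\<close>.\<close>

lemma smooth_weight_ge:
  assumes "0 < n" "n \<le> Y" "0 \<le> \<delta>" "\<delta> \<le> 1"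
  shows "smooth_weight Y (1 - \<delta>) n \<ge> 1 - 2 * \<delta> * ln (real n)"
proof -
  define k where "k = size (prime_factorization n)"
  have "smooth_weight Y (1 - \<delta>) n = mult_ext (\<lambda>_. 1 - \<delta>) n"
    unfolding smooth_weight_def
    using assms by (intro mult_ext_cong) (auto dest: dvd_imp_le)
  also have "\<dots> = (1 - \<delta>) ^ k" using assms by (simp add: mult_ext_def k_def image_mset_const_eq)
  also have "\<dots> \<ge> 1 - real k * \<delta>" using Bernoulli_inequality[of "-\<delta>" k] assms by simp
  finally have ge: "smooth_weight Y (1 - \<delta>) n \<ge> 1 - real k * \<delta>" .
  have pm: "2 ^ size A \<le> prod_mset A" if "\<And>p. p \<in># A \<Longrightarrow> p \<ge> 2" for A :: "nat multiset"
    using that by (induction A) (auto intro: mult_le_mono)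
  have "2 ^ k \<le> prod_mset (prime_factorization n)"
    unfolding k_def by (rule pm) (auto simp: in_prime_factors_iff dest: prime_ge_2_nat)
  hence "2 ^ k \<le> n" using assms by (simp add: prod_mset_prime_factorization)
  hence "real (2 ^ k) \<le> real n" by (simp only: of_nat_le_iff)
  hence "ln (2 ^ k) \<le> ln (real n)" using assms by (subst ln_le_cancel_iff) auto
  hence "real k * ln 2 \<le> ln (real n)" by (simp add: ln_realpow)
  moreover have "ln (2 :: real) \<ge> 1 / 2" using ln_le_minus_one[of "1 / 2"] by (simp add: ln_div)
  hence "real k * (1 / 2) \<le> real k * ln 2" by (intro mult_left_mono) auto
  ultimately have "real k \<le> 2 * ln (real n)" by linarith
  hence "real k * \<delta> \<le> 2 * ln (real n) * \<delta>" using assms by (intro mult_right_mono)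
  with ge show ?thesis by (simp add: mult_ac)
qed

section \<open>Logarithmic derivative of the smooth Euler product\<close>

text \<open>Minus the logarithmic derivative of \<open>smooth_zeta Y c\<close>, with one geometric
  series per prime.\<close>

definition log_deriv :: "nat \<Rightarrow> real \<Rightarrow> complex \<Rightarrow> complex" where
  "log_deriv Y c z = (\<Sum>p | prime p \<and> p \<le> Y. of_real (ln (real p)) *
     (of_real c * of_nat p powr (-z) / (1 - of_real c * of_nat p powr (-z))))"

lemma DERIV_smooth_zeta:
  assumes "Re z > 0" "0 \<le> c" "c \<le> 1"
  shows "(smooth_zeta Y c has_field_derivative - log_deriv Y c z * smooth_zeta Y c z) (at z)"
proof -
  let ?e = "\<lambda>p z. 1 / (1 - of_real c * of_nat p powr (-z))"
  let ?l = "\<lambda>p. of_real (ln (real p)) * (of_real c * of_nat p powr (-z) / (1 - of_real c * of_nat p powr (-z)))"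
  have one: "(?e p has_field_derivative - ?l p * ?e p z) (at z)" if "prime p" for p
  proof -
    have "((\<lambda>z. of_nat p powr (-z)) has_field_derivative of_real (ln (real p)) * of_nat p powr (-z) * (-1)) (at z)"
      using DERIV_chain2[OF has_field_derivative_powr_right[of "of_nat p"] DERIV_minus[OF DERIV_ident]] that
      by (simp add: Ln_of_nat prime_gt_0_nat)
    moreover have "1 - of_real c * of_nat p powr (-z) \<noteq> 0"
      using prime_powr_norm_less_1[OF that assms] by auto
    ultimately show ?thesis
      by (auto intro!: derivative_eq_intros simp: field_simps power2_eq_square)
  qed
  have "((\<lambda>z. \<Prod>p\<in>P. ?e p z) has_field_derivative - (\<Sum>p\<in>P. ?l p) * (\<Prod>p\<in>P. ?e p z)) (at z)"
    if "finite P" "\<And>p. p \<in> P \<Longrightarrow> prime p" for P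
    using that
  proof (induction P rule: finite_induct)
    case (insert p P)
    have "((\<lambda>z. ?e p z * (\<Prod>p\<in>P. ?e p z)) has_field_derivative
       (- ?l p * ?e p z) * (\<Prod>p\<in>P. ?e p z) + (- (\<Sum>p\<in>P. ?l p) * (\<Prod>p\<in>P. ?e p z)) * ?e p z) (at z)"
      using insert by (intro DERIV_mult one) auto
    moreover have "(- ?l p * ?e p z) * (\<Prod>p\<in>P. ?e p z) + (- (\<Sum>p\<in>P. ?l p) * (\<Prod>p\<in>P. ?e p z)) * ?e p z
       = - (\<Sum>p\<in>insert p P. ?l p) * (\<Prod>p\<in>insert p P. ?e p z)"
    proof -
      have "(- l * e) * x + (- S * x) * e = - (l + S) * (e * x)" for l e x S :: complex
        by (simp add: algebra_simps)
      thus ?thesis unfolding sum.insert[OF insert.hyps] prod.insert[OF insert.hyps] .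
    qed
    ultimately show ?case using insert.hyps by simp
  qed simp
  from this[OF finite_primes_le] show ?thesis
    by (simp add: smooth_zeta_def [abs_def] log_deriv_def)
qed

lemma smooth_zeta_nonzero:
  assumes "Re z > 0" "0 \<le> c" "c \<le> 1"
  shows "smooth_zeta Y c z \<noteq> 0"
proof -
  have "of_real c * of_nat p powr (-z) \<noteq> 1" if "prime p" for p
    using prime_powr_norm_less_1[OF that assms] by (metis less_irrefl norm_one)
  thus ?thesis unfolding smooth_zeta_def by (subst prod_zero_iff) auto
qed

text \<open>Per prime, with \<open>z = p^(-s)\<close> and \<open>c = 1 - \<delta>\<close>, the
  difference is \<open>(c z)^2 / (1 - c z) - \<delta> z\<close>. The squares converge absolutely
  because \<open>Re s \<ge> 3 / 4\<close>; the linear parts sum to at most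
  \<open>\<delta> * exp B * (\<Lambda> + C1)\<close>, which is where
  \<open>\<delta> \<le> 1 / \<Lambda>\<close> enters.\<close>

lemma log_deriv_bound:
  fixes B :: real
  assumes "B \<ge> 0"
  obtains C where "C > 0" "\<And>\<Lambda> Y w \<delta>. \<lbrakk>\<Lambda> \<ge> 1; \<Lambda> \<ge> 4 * B; Y > 0; ln (real Y) \<le> \<Lambda>; Re w \<ge> - B; 0 \<le> \<delta>; \<delta> \<le> 1 / \<Lambda>\<rbrakk> \<Longrightarrow>
     cmod (log_deriv Y (1 - \<delta>) (1 + w / of_real \<Lambda>) - (\<Sum>p | prime p \<and> p \<le> Y. of_real (ln (real p)) * of_nat p powr (-(1 + w / of_real \<Lambda>)))) \<le> C"
proof -
  obtain C1 where C1: "\<And>m::nat. m > 0 \<Longrightarrow> \<bar>(\<Sum>p | prime p \<and> p \<le> m. ln p / p) - ln m\<bar> \<le> C1"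
    using mertens_weak by blast
  have C1_0: "C1 \<ge> 0" using C1[of 1] by linarith
  define Z where "Z = (\<Sum>n. ln (real n) * real n powr (-3/2))"
  have summ: "summable (\<lambda>n. ln (real n) * real n powr (-3/2))"
  proof (rule summable_comparison_test')
    show "summable (\<lambda>n. 4 * real n powr (-5/4))"
      by (intro summable_mult) (simp add: summable_real_powr_iff)
    fix n :: nat assume n: "n \<ge> 1"
    have "ln (real n) \<le> 4 * real n powr (1/4)"
      using ln_powr_bound[of "real n" "1/4"] n by simp
    hence "ln (real n) * real n powr (-3/2) \<le> 4 * real n powr (1/4) * real n powr (-3/2)"
      by (intro mult_right_mono) auto
    also have "\<dots> = 4 * real n powr (-5/4)" using n by (simp add: powr_add[symmetric])
    finally show "norm (ln (real n) * real n powr (-3/2)) \<le> 4 * real n powr (-5/4)" using n by simp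
  qed
  have term_nonneg: "0 \<le> ln (real n) * real n powr (-3/2)" for n by (cases "n = 0") auto
  have Z0: "Z \<ge> 0" unfolding Z_def by (intro suminf_nonneg summ term_nonneg)
  define C where "C = exp B * (1 + C1) + 4 * Z"
  have "cmod (log_deriv Y (1 - \<delta>) (1 + w / of_real \<Lambda>) - (\<Sum>p | prime p \<and> p \<le> Y. of_real (ln (real p)) * of_nat p powr (-(1 + w / of_real \<Lambda>)))) \<le> C"
    if L1: "\<Lambda> \<ge> 1" and LB: "\<Lambda> \<ge> 4 * B" and Y: "Y > 0" and lnY: "ln (real Y) \<le> \<Lambda>" and w: "Re w \<ge> - B"
      and \<delta>: "0 \<le> \<delta>" "\<delta> \<le> 1 / \<Lambda>" for \<Lambda> Y w \<delta>
  proof -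
    define s where "s = 1 + w / of_real \<Lambda>"
    have Res: "Re s = 1 + Re w / \<Lambda>" by (simp add: s_def)
    have Re34: "Re s \<ge> 3 / 4" using w L1 LB by (simp add: Res field_simps)
    have "1 / \<Lambda> \<le> 1" using L1 by simp
    hence \<delta>1: "\<delta> \<le> 1" using \<delta> by linarith
    have bound: "cmod (of_real (ln (real p)) * (of_real (1 - \<delta>) * of_nat p powr (-s) / (1 - of_real (1 - \<delta>) * of_nat p powr (-s)))
          - of_real (ln (real p)) * of_nat p powr (-s)) \<le> \<delta> * exp B * (ln (real p) / real p) + 4 * (ln (real p) * real p powr (-3/2))"
      if p: "prime p" "p \<le> Y" for p
    proof -
      define z where "z = of_nat p powr (-s)"
      define c where "c = 1 - \<delta>"
      have c: "0 \<le> c" "c \<le> 1" using \<delta> \<delta>1 by (auto simp: c_def)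
      have p2: "real p \<ge> 2" using prime_ge_2_nat[OF p(1)] by simp
      have nz: "cmod z = real p powr (- Re s)" using p2 by (simp add: z_def norm_of_nat_powr)
      have z34: "cmod z \<le> real p powr (-3/4)" unfolding nz using p2 Re34 by (intro powr_mono) auto
      have zB: "cmod z \<le> exp B / real p"
      proof -
        have "real p powr (- Re s) = real p powr (-1) * real p powr (- Re w / \<Lambda>)"
          by (subst powr_add[symmetric]) (simp add: Res)
        also have "real p powr (- Re w / \<Lambda>) = exp (- Re w * (ln (real p) / \<Lambda>))"
          using p2 by (simp add: powr_def)
        also have "- Re w * (ln (real p) / \<Lambda>) \<le> B * (ln (real p) / \<Lambda>)"
          using w p2 L1 by (intro mult_right_mono) auto
        also have "B * (ln (real p) / \<Lambda>) \<le> B * 1"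
        proof (intro mult_left_mono assms)
          have "ln (real p) \<le> ln (real Y)" using p p2 by simp
          thus "ln (real p) / \<Lambda> \<le> 1" using lnY L1 by simp
        qed
        finally have "real p powr (- Re s) \<le> real p powr (-1) * exp (B * 1)" by (simp add: divide_right_mono)
        also have "\<dots> = exp B / real p" using p2 by (simp add: powr_minus_divide)
        finally show ?thesis using nz by simp
      qed
      \<comment> \<open>As \<open>p \<ge> 2\<close>,
        \<open>p^(-3/4) \<le> 2^(-1/2) \<le> 3/4\<close>; this keeps the denominator away from
        0.\<close>
      have cz: "cmod (of_real c * z) \<le> 3 / 4"
      proof -
        have "real p powr (-3/4) \<le> 2 powr (-3/4)" using p2 by (intro powr_mono2') auto
        also have "(2 :: real) powr (-3/4) \<le> 2 powr (-1/2)" by (intro powr_mono) auto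
        also have "(2 :: real) powr (-1/2) = 1 / sqrt 2" by (simp add: powr_minus powr_half_sqrt inverse_eq_divide)
        also have "\<dots> \<le> 3 / 4" using real_le_rsqrt[of "4/3" 2] by (simp add: field_simps power2_eq_square)
        finally have "cmod z \<le> 3 / 4" using z34 by linarith
        moreover have "c * cmod z \<le> 1 * cmod z" using c by (intro mult_right_mono) auto
        ultimately show ?thesis using c by (simp add: norm_mult)
      qed
      have den: "cmod (1 - of_real c * z) \<ge> 1 / 4"
        using norm_triangle_ineq2[of 1 "of_real c * z"] cz by simp
      hence den0: "1 - of_real c * z \<noteq> 0" by auto
      have "of_real c * z / (1 - of_real c * z) - z = (of_real c * z)^2 / (1 - of_real c * z) - of_real \<delta> * z"
        using den0 by (simp add: c_def field_simps power2_eq_square)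
      also have "cmod \<dots> \<le> (cmod z)^2 / (1 / 4) + \<delta> * cmod z"
      proof (rule order_trans[OF norm_triangle_ineq4], intro add_mono)
        have "c * cmod z \<le> 1 * cmod z" using c by (intro mult_right_mono) auto
        hence "(c * cmod z)^2 \<le> (cmod z)^2" using c by (intro power_mono) auto
        thus "cmod ((of_real c * z)^2 / (1 - of_real c * z)) \<le> (cmod z)^2 / (1 / 4)"
          unfolding norm_divide norm_power norm_mult using den c by (intro frac_le) auto
      qed (use \<delta> in \<open>auto simp: norm_mult\<close>)
      also have "\<dots> \<le> (real p powr (-3/4))^2 / (1 / 4) + \<delta> * (exp B / real p)"
        using z34 zB \<delta> by (intro add_mono divide_right_mono power_mono mult_left_mono) auto
      also have "(real p powr (-3/4))^2 = real p powr (-3/2)"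
        by (simp add: power2_eq_square powr_add[symmetric])
      finally have "cmod (of_real c * z / (1 - of_real c * z) - z) \<le> 4 * real p powr (-3/2) + \<delta> * exp B / real p" by simp
      hence "ln (real p) * cmod (of_real c * z / (1 - of_real c * z) - z) \<le> ln (real p) * (4 * real p powr (-3/2) + \<delta> * exp B / real p)"
        using p2 by (intro mult_left_mono) auto
      also have "ln (real p) * cmod (of_real c * z / (1 - of_real c * z) - z) =
        cmod (of_real (ln (real p)) * (of_real c * z / (1 - of_real c * z)) - of_real (ln (real p)) * z)"
        using p2 unfolding right_diff_distrib[symmetric] norm_mult by simp
      finally show ?thesis by (simp add: c_def z_def algebra_simps)
    qed
    have "log_deriv Y (1 - \<delta>) s - (\<Sum>p | prime p \<and> p \<le> Y. of_real (ln (real p)) * of_nat p powr (-s)) =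
      (\<Sum>p | prime p \<and> p \<le> Y. of_real (ln (real p)) * (of_real (1 - \<delta>) * of_nat p powr (-s) / (1 - of_real (1 - \<delta>) * of_nat p powr (-s)))
          - of_real (ln (real p)) * of_nat p powr (-s))"
      by (simp only: log_deriv_def sum_subtractf)
    also have "cmod \<dots> \<le> (\<Sum>p | prime p \<and> p \<le> Y. \<delta> * exp B * (ln (real p) / real p) + 4 * (ln (real p) * real p powr (-3/2)))"
      by (intro sum_norm_le bound) auto
    also have "\<dots> = \<delta> * exp B * (\<Sum>p | prime p \<and> p \<le> Y. ln (real p) / real p) + 4 * (\<Sum>p | prime p \<and> p \<le> Y. ln (real p) * real p powr (-3/2))"
      by (simp add: sum.distrib sum_distrib_left)
    also have "\<dots> \<le> exp B * (1 + C1) + 4 * Z"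
    proof (intro add_mono mult_left_mono)
      have "(\<Sum>p | prime p \<and> p \<le> Y. ln (real p) / real p) \<le> \<Lambda> + C1" using C1[OF Y] lnY by linarith
      hence "\<delta> * (\<Sum>p | prime p \<and> p \<le> Y. ln (real p) / real p) \<le> \<delta> * (\<Lambda> + C1)" using \<delta> by (intro mult_left_mono)
      also have "\<delta> * (\<Lambda> + C1) \<le> 1 + C1"
      proof -
        have "\<delta> * \<Lambda> \<le> 1" using \<delta> L1 by (simp add: field_simps)
        moreover have "\<delta> * C1 \<le> 1 * C1" using \<delta>1 C1_0 by (intro mult_right_mono)
        ultimately show ?thesis by (simp add: distrib_left)
      qed
      finally have "exp B * (\<delta> * (\<Sum>p | prime p \<and> p \<le> Y. ln (real p) / real p)) \<le> exp B * (1 + C1)"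
        by (intro mult_left_mono) auto
      thus "\<delta> * exp B * (\<Sum>p | prime p \<and> p \<le> Y. ln (real p) / real p) \<le> exp B * (1 + C1)" by (simp add: mult_ac)
      show "(\<Sum>p | prime p \<and> p \<le> Y. ln (real p) * real p powr (-3/2)) \<le> Z"
        unfolding Z_def by (intro sum_le_suminf summ finite_primes_le) (use term_nonneg in auto)
    qed auto
    finally show ?thesis by (simp add: C_def s_def)
  qed
  moreover have "C > 0" using Z0 C1_0 by (simp add: C_def add_pos_nonneg)
  ultimately show ?thesis using that by blast
qed

lemma log_deriv_approx:
  fixes B :: real
  assumes "B \<ge> 0"
  obtains C where "C > 0" "\<And>\<Lambda> D Y w \<delta>. \<lbrakk>\<Lambda> \<ge> 1; \<Lambda> \<ge> 4 * B; D \<ge> 0; Y > 0; ln (real Y) \<le> \<Lambda>; \<Lambda> \<le> ln (real Y) + D; w \<noteq> 0; Re w \<ge> - B; 0 \<le> \<delta>; \<delta> \<le> 1 / \<Lambda>\<rbrakk> \<Longrightarrow>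
     cmod (log_deriv Y (1 - \<delta>) (1 + w / of_real \<Lambda>) / of_real \<Lambda> - (1 - exp (-w)) / w) \<le> C * ((1 + cmod w) * (1 + D) / \<Lambda>)"
proof -
  obtain Ch where Ch: "Ch > 0" "\<And>\<Lambda> D Y w. \<lbrakk>\<Lambda> \<ge> 1; \<Lambda> \<ge> 4 * B; D \<ge> 0; Y > 0; ln (real Y) \<le> \<Lambda>; \<Lambda> \<le> ln (real Y) + D; w \<noteq> 0; Re w \<ge> - B\<rbrakk> \<Longrightarrow>
     cmod ((\<Sum>n=1..Y. of_nat n powr (-(1 + w / of_real \<Lambda>))) / of_real \<Lambda> - (1 - exp (-w)) / w) \<le> Ch * ((1 + cmod w) * (1 + D) / \<Lambda>)"
    using harmonic_twist_bound[where B=B] by blast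
  obtain Cp where Cp: "Cp > 0" "\<And>\<Lambda> Y w. \<lbrakk>\<Lambda> \<ge> 1; Y > 0; ln (real Y) \<le> \<Lambda>; Re w \<ge> - B\<rbrakk> \<Longrightarrow>
     cmod ((\<Sum>p | prime p \<and> p \<le> Y. of_real (ln (real p)) * of_nat p powr (-(1 + w / of_real \<Lambda>))) - (\<Sum>n=1..Y. of_nat n powr (-(1 + w / of_real \<Lambda>)))) \<le> Cp * (1 + cmod w)"
    using prime_twist_bound[where B=B] by blast
  obtain Cl where Cl: "Cl > 0" "\<And>\<Lambda> Y w \<delta>. \<lbrakk>\<Lambda> \<ge> 1; \<Lambda> \<ge> 4 * B; Y > 0; ln (real Y) \<le> \<Lambda>; Re w \<ge> - B; 0 \<le> \<delta>; \<delta> \<le> 1 / \<Lambda>\<rbrakk> \<Longrightarrow>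
     cmod (log_deriv Y (1 - \<delta>) (1 + w / of_real \<Lambda>) - (\<Sum>p | prime p \<and> p \<le> Y. of_real (ln (real p)) * of_nat p powr (-(1 + w / of_real \<Lambda>)))) \<le> Cl"
    using log_deriv_bound[OF assms] by blast
  have "cmod (log_deriv Y (1 - \<delta>) (1 + w / of_real \<Lambda>) / of_real \<Lambda> - (1 - exp (-w)) / w) \<le> (Ch + Cp + Cl) * ((1 + cmod w) * (1 + D) / \<Lambda>)"
    if that: "\<Lambda> \<ge> 1" "\<Lambda> \<ge> 4 * B" "D \<ge> 0" "Y > 0" "ln (real Y) \<le> \<Lambda>" "\<Lambda> \<le> ln (real Y) + D" "w \<noteq> 0" "Re w \<ge> - B" "0 \<le> \<delta>" "\<delta> \<le> 1 / \<Lambda>"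
    for \<Lambda> D Y w \<delta>
  proof -
    define l where "l = log_deriv Y (1 - \<delta>) (1 + w / of_real \<Lambda>)"
    define p where "p = (\<Sum>p | prime p \<and> p \<le> Y. of_real (ln (real p)) * of_nat p powr (-(1 + w / of_real \<Lambda>)))"
    define h where "h = (\<Sum>n=1..Y. of_nat n powr (-(1 + w / of_real \<Lambda>)))"
    define q where "q = (1 - exp (-w)) / w"
    define \<eta> where "\<eta> = (1 + cmod w) * (1 + D) / \<Lambda>"
    have 1: "cmod (h / of_real \<Lambda> - q) \<le> Ch * \<eta>" using Ch(2) that by (simp add: h_def q_def \<eta>_def)
    have 2: "cmod (p - h) \<le> Cp * (1 + cmod w)" unfolding p_def h_def using Cp(2) that by blast
    have 3: "cmod (l - p) \<le> Cl" unfolding l_def p_def using Cl(2) that by blast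
    have "l / of_real \<Lambda> - q = (l - p) / of_real \<Lambda> + (p - h) / of_real \<Lambda> + (h / of_real \<Lambda> - q)"
      by (simp add: diff_divide_distrib)
    also have "cmod \<dots> \<le> cmod (l - p) / \<Lambda> + cmod (p - h) / \<Lambda> + cmod (h / of_real \<Lambda> - q)"
      using that(1) by (intro order_trans[OF norm_triangle_ineq] add_mono) (auto simp: norm_divide)
    also have "\<dots> \<le> Cl * \<eta> + Cp * \<eta> + Ch * \<eta>"
    proof (intro add_mono 1)
      have "1 * 1 \<le> (1 + cmod w) * (1 + D)" using that by (intro mult_mono) auto
      hence "Cl * 1 \<le> Cl * ((1 + cmod w) * (1 + D))" using Cl by (intro mult_left_mono) auto
      hence "cmod (l - p) / \<Lambda> \<le> Cl * ((1 + cmod w) * (1 + D)) / \<Lambda>" using 3 that(1) by (intro divide_right_mono) auto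
      thus "cmod (l - p) / \<Lambda> \<le> Cl * \<eta>" by (simp add: \<eta>_def)
      have "(1 + cmod w) * 1 \<le> (1 + cmod w) * (1 + D)" using that by (intro mult_left_mono) auto
      hence "Cp * (1 + cmod w) \<le> Cp * ((1 + cmod w) * (1 + D))" using Cp by (intro mult_left_mono) auto
      hence "cmod (p - h) / \<Lambda> \<le> Cp * ((1 + cmod w) * (1 + D)) / \<Lambda>" using 2 that(1) by (intro divide_right_mono) auto
      thus "cmod (p - h) / \<Lambda> \<le> Cp * \<eta>" by (simp add: \<eta>_def)
    qed
    also have "Cl * \<eta> + Cp * \<eta> + Ch * \<eta> = (Ch + Cp + Cl) * \<eta>" by (simp add: distrib_right)
    finally show ?thesis unfolding l_def q_def \<eta>_def .
  qed
  moreover have "Ch + Cp + Cl > 0" using Ch Cp Cl by simp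
  ultimately show ?thesis using that by blast
qed

section \<open>Tails of the smooth Dirichlet series and its values right of 1\<close>

lemma has_sum_tail_bound:
  fixes f :: "nat \<Rightarrow> complex"
  assumes f: "(f has_sum s) UNIV" and f0: "f 0 = 0"
    and g: "(g has_sum t) {X<..}" and le: "\<And>n. n > X \<Longrightarrow> cmod (f n) \<le> g n"
  shows "cmod (s - (\<Sum>n=1..X. f n)) \<le> t"
proof -
  have "(f has_sum (\<Sum>n=1..X. f n)) {0..X}"
    by (intro has_sum_finiteI) (auto simp: f0 sum.atLeast_Suc_atMost)
  from has_sum_Diff[OF f this] have "(f has_sum (s - (\<Sum>n=1..X. f n))) (UNIV - {0..X})" by simp
  also have "UNIV - {0..X} = {X<..}" by auto
  finally show ?thesis by (rule norm_infsum_le[OF _ g]) (use le in auto)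
qed

lemma has_sum_tail_powr:
  assumes "a > 0" "X \<ge> 1"
  obtains t where "((\<lambda>n. real n powr (-(a + 1))) has_sum t) {X<..}" "t \<le> real X powr (-a) / a"
proof -
  have summ: "summable (\<lambda>n. real (Suc (n + X)) powr (-(a + 1)))" by (rule sum_tail_powr_le[OF assms])
  have "((\<lambda>n. real (Suc (n + X)) powr (-(a + 1))) has_sum (\<Sum>n. real (Suc (n + X)) powr (-(a + 1)))) UNIV"
    using summ by (intro norm_summable_imp_has_sum summable_sums) auto
  also have "?this \<longleftrightarrow> ((\<lambda>n. real n powr (-(a + 1))) has_sum (\<Sum>n. real (Suc (n + X)) powr (-(a + 1)))) {X<..}"
    by (rule has_sum_reindex_bij_witness[of _ "\<lambda>n. n - Suc X" "\<lambda>n. Suc (n + X)"]) auto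
  finally show ?thesis using sum_tail_powr_le(2)[OF assms] that by blast
qed

text \<open>Every \<open>n \<le> Y\<close> is smooth, so up to \<open>Y\<close> the series is the
  harmonic sum apart from the factors \<open>r n\<close>, whose total effect is at most 4 because
  \<open>\<delta> \<le> 1 / \<Lambda>\<^sup>2\<close>. Beyond \<open>Y\<close> the terms are at most
  those of zeta; divided by \<Lambda>, they give the exponential.\<close>

lemma smooth_zeta_real_approx:
  obtains C where "C > 0" "\<And>\<Lambda> D Y S \<delta>. \<lbrakk>\<Lambda> \<ge> 1; D \<ge> 0; Y > 0; ln (real Y) \<le> \<Lambda>; \<Lambda> \<le> ln (real Y) + D; S \<ge> 1; 0 \<le> \<delta>; \<delta> \<le> 1 / \<Lambda>\<^sup>2\<rbrakk> \<Longrightarrow>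
     cmod (smooth_zeta Y (1 - \<delta>) (1 + of_real S / of_real \<Lambda>) / of_real \<Lambda> - (1 - exp (- of_real S)) / of_real S)
       \<le> C * ((1 + S) * (1 + D) / \<Lambda>) + exp (- S + S * D / \<Lambda>)"
proof -
  obtain Ch where Ch: "Ch > 0" "\<And>\<Lambda> D Y w. \<lbrakk>\<Lambda> \<ge> 1; \<Lambda> \<ge> 4 * 0; D \<ge> 0; Y > 0; ln (real Y) \<le> \<Lambda>; \<Lambda> \<le> ln (real Y) + D; w \<noteq> 0; Re w \<ge> - 0\<rbrakk> \<Longrightarrow>
     cmod ((\<Sum>n=1..Y. of_nat n powr (-(1 + w / of_real \<Lambda>))) / of_real \<Lambda> - (1 - exp (-w)) / w) \<le> Ch * ((1 + cmod w) * (1 + D) / \<Lambda>)"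
    using harmonic_twist_bound[where B=0] by blast
  have "cmod (smooth_zeta Y (1 - \<delta>) (1 + of_real S / of_real \<Lambda>) / of_real \<Lambda> - (1 - exp (- of_real S)) / of_real S)
       \<le> (Ch + 4) * ((1 + S) * (1 + D) / \<Lambda>) + exp (- S + S * D / \<Lambda>)"
    if L1: "\<Lambda> \<ge> 1" and D: "D \<ge> 0" and Y: "Y > 0" and lnY: "ln (real Y) \<le> \<Lambda>" "\<Lambda> \<le> ln (real Y) + D" and S: "S \<ge> 1"
      and \<delta>: "0 \<le> \<delta>" "\<delta> \<le> 1 / \<Lambda>\<^sup>2"
    for \<Lambda> D Y S \<delta>
  proof -
    define a where "a = S / \<Lambda>"
    have a: "a > 0" using S L1 by (simp add: a_def)
    define z where "z = complex_of_real (1 + a)"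
    have z: "1 + of_real S / of_real \<Lambda> = z" by (simp add: z_def a_def)
    have "1 / \<Lambda>\<^sup>2 \<le> 1" using L1 by simp
    hence \<delta>1: "\<delta> \<le> 1" using \<delta> by linarith
    define r where "r = smooth_weight Y (1 - \<delta>)"
    have r: "0 \<le> r n" "r n \<le> 1" for n
      using \<delta> \<delta>1 by (auto simp: r_def intro!: smooth_weight_nonneg smooth_weight_le_1)
    define h where "h = (\<Sum>n=1..Y. of_nat n powr (-z))"
    define F where "F = smooth_zeta Y (1 - \<delta>) z"
    define G where "G = (\<Sum>n=1..Y. of_real (r n) * of_nat n powr (-z))"
    have nz: "cmod (of_nat n powr (-z)) = real n powr (-(a + 1))" if "n > 0" for n
    proof -
      have "Re (-z) = -(a + 1)" by (simp add: z_def)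
      thus ?thesis using that by (simp only: norm_of_nat_powr)
    qed
    obtain t where t: "((\<lambda>n. real n powr (-(a + 1))) has_sum t) {Y<..}" "t \<le> real Y powr (-a) / a"
      using has_sum_tail_powr[OF a, of Y] Y by auto
    have "cmod (F - G) \<le> t" unfolding F_def G_def r_def
    proof (rule has_sum_tail_bound[OF has_sum_smooth_zeta _ t(1)])
      fix n assume "n > Y"
      thus "cmod (of_real (smooth_weight Y (1 - \<delta>) n) * of_nat n powr (-z)) \<le> real n powr (-(a + 1))"
        using r[of n] mult_right_mono[of "r n" 1 "real n powr (-(a + 1))"]
        by (simp add: norm_mult nz r_def[symmetric])
    qed (use a \<delta> \<delta>1 in \<open>auto simp: z_def\<close>)
    also note t(2)
    also have "real Y powr (-a) / a \<le> \<Lambda> * exp (- S + S * D / \<Lambda>)"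
    proof -
      have "real Y powr (-a) = exp (- (a * ln (real Y)))" using Y by (simp add: powr_def)
      also have "- (a * ln (real Y)) \<le> - S + S * D / \<Lambda>"
      proof -
        have "a * \<Lambda> \<le> a * (ln (real Y) + D)" using lnY a by (intro mult_left_mono) auto
        moreover have "a * \<Lambda> = S" using L1 by (simp add: a_def)
        ultimately show ?thesis by (simp add: a_def distrib_left)
      qed
      finally have "real Y powr (-a) \<le> exp (- S + S * D / \<Lambda>)" by simp
      moreover have "1 / a \<le> \<Lambda>" using S L1 by (simp add: a_def field_simps)
      ultimately have "(1 / a) * real Y powr (-a) \<le> \<Lambda> * exp (- S + S * D / \<Lambda>)"
        using L1 by (intro mult_mono) auto
      thus ?thesis by simp
    qed
    finally have 1: "cmod (F - G) \<le> \<Lambda> * exp (- S + S * D / \<Lambda>)" .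
    have 2: "cmod (G - h) \<le> 4"
    proof -
      have "G - h = (\<Sum>n=1..Y. of_real (r n - 1) * of_nat n powr (-z))"
        by (simp add: G_def h_def sum_subtractf algebra_simps)
      also have "cmod \<dots> \<le> (\<Sum>n=1..Y. 2 * \<delta> * \<Lambda> * (1 / real n))"
      proof (intro sum_norm_le)
        fix n assume n: "n \<in> {1..Y}"
        have "1 - r n \<le> 2 * \<delta> * ln (real n)"
          using smooth_weight_ge[of n Y \<delta>] n \<delta> \<delta>1 by (simp add: r_def)
        also have "ln (real n) \<le> ln (real Y)" using n by simp
        also have "ln (real Y) \<le> \<Lambda>" by fact
        finally have "1 - r n \<le> 2 * \<delta> * \<Lambda>" using \<delta> by (simp add: mult_left_mono)
        moreover have "real n powr (-(a + 1)) \<le> real n powr (-1)" using n a by (intro powr_mono) auto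
        ultimately have "(1 - r n) * real n powr (-(a + 1)) \<le> 2 * \<delta> * \<Lambda> * real n powr (-1)"
          using r[of n] \<delta> L1 by (intro mult_mono) auto
        moreover have "\<bar>r n - 1\<bar> = 1 - r n" using r[of n] by simp
        ultimately show "cmod (of_real (r n - 1) * of_nat n powr (-z)) \<le> 2 * \<delta> * \<Lambda> * (1 / real n)"
          using n nz[of n] unfolding norm_mult norm_of_real by (simp add: powr_minus_divide)
      qed
      also have "\<dots> = 2 * \<delta> * \<Lambda> * (\<Sum>n=1..Y. 1 / real n)" by (simp add: sum_distrib_left)
      also have "\<dots> \<le> 2 * \<delta> * \<Lambda> * (1 + \<Lambda>)"
        using sum_inverse_le[OF Y] lnY \<delta> L1 by (intro mult_left_mono) auto
      also have "\<dots> \<le> 2 * (1 / \<Lambda>\<^sup>2) * \<Lambda> * (\<Lambda> + \<Lambda>)"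
        using \<delta> L1 by (intro mult_mono) auto
      also have "\<dots> = 4" using L1 by (simp add: field_simps power2_eq_square)
      finally show ?thesis .
    qed
    have 3: "cmod (h / of_real \<Lambda> - (1 - exp (- of_real S)) / of_real S) \<le> Ch * ((1 + S) * (1 + D) / \<Lambda>)"
      using Ch(2)[of \<Lambda> D Y "of_real S"] L1 D Y lnY S unfolding z h_def by simp
    have "F / of_real \<Lambda> - (1 - exp (- of_real S)) / of_real S =
      (F - G) / of_real \<Lambda> + (G - h) / of_real \<Lambda> + (h / of_real \<Lambda> - (1 - exp (- of_real S)) / of_real S)"
      by (simp add: diff_divide_distrib)
    also have "cmod \<dots> \<le> cmod (F - G) / \<Lambda> + cmod (G - h) / \<Lambda> + cmod (h / of_real \<Lambda> - (1 - exp (- of_real S)) / of_real S)"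
      using L1 by (intro order_trans[OF norm_triangle_ineq] add_mono) (auto simp: norm_divide)
    also have "\<dots> \<le> (\<Lambda> * exp (- S + S * D / \<Lambda>)) / \<Lambda> + 4 * ((1 + S) * (1 + D) / \<Lambda>) + Ch * ((1 + S) * (1 + D) / \<Lambda>)"
    proof (intro add_mono 3 divide_right_mono 1)
      have "1 * 1 \<le> (1 + S) * (1 + D)" using S D by (intro mult_mono) auto
      hence "cmod (G - h) / \<Lambda> \<le> 4 * ((1 + S) * (1 + D)) / \<Lambda>" using 2 L1 by (intro divide_right_mono) auto
      thus "cmod (G - h) / \<Lambda> \<le> 4 * ((1 + S) * (1 + D) / \<Lambda>)" by simp
    qed (use L1 in auto)
    also have "\<dots> = (Ch + 4) * ((1 + S) * (1 + D) / \<Lambda>) + exp (- S + S * D / \<Lambda>)"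
      using L1 by (simp only: distrib_right) simp
    finally show ?thesis unfolding z F_def .
  qed
  moreover have "Ch + 4 > 0" using Ch by simp
  ultimately show ?thesis using that by blast
qed

text \<open>Rankin's trick: for \<open>n > X\<close>,
  \<open>n^(-3/4) \<le> n^(-1/4) * X^(-1/2)\<close>, and the full series at 1/4 is an Euler product
  of at most \<open>Y\<close> factors, each at most 8 because
  \<open>2^(-1/4) \<le> 7/8\<close>.\<close>

lemma smooth_zeta_truncation:
  assumes z: "Re z \<ge> 3 / 4" and c: "0 \<le> c" "c \<le> 1" and X: "X \<ge> 1"
  shows "cmod (smooth_zeta Y c z - (\<Sum>n=1..X. of_real (smooth_weight Y c n) * of_nat n powr (-z))) \<le> 8 ^ Y / sqrt (real X)"
proof -
  define r where "r = smooth_weight Y c"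
  have r: "0 \<le> r n" for n using c by (simp add: r_def smooth_weight_nonneg)
  define F where "F = smooth_zeta Y c (of_real (1/4))"
  have hs: "((\<lambda>n. complex_of_real (r n * real n powr (-(1/4)))) has_sum F) UNIV"
  proof -
    have "((\<lambda>n. of_real (r n) * of_nat n powr (- complex_of_real (1/4))) has_sum F) UNIV"
      unfolding F_def r_def using c by (intro has_sum_smooth_zeta) auto
    moreover have "of_real (r n) * of_nat n powr (- complex_of_real (1/4)) = complex_of_real (r n * real n powr (-(1/4)))" for n
      using powr_of_real[of "real n" "-(1/4)"] by simp
    ultimately show ?thesis by (simp only:)
  qed
  from has_sum_Re[OF this] have hs_re: "((\<lambda>n. r n * real n powr (-(1/4))) has_sum Re F) UNIV" by simp
  hence summ: "(\<lambda>n. r n * real n powr (-(1/4))) summable_on UNIV" by (rule has_sum_imp_summable)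
  have F_le: "Re F \<le> 8 ^ Y"
  proof -
    have "Re F \<le> cmod F" by (rule complex_Re_le_cmod)
    also have "cmod F = (\<Prod>p | prime p \<and> p \<le> Y. cmod (1 / (1 - of_real c * of_nat p powr (- complex_of_real (1/4)))))"
      by (simp add: F_def smooth_zeta_def prod_norm)
    also have "\<dots> \<le> (\<Prod>p | prime p \<and> p \<le> Y. 8)"
    proof (intro prod_mono conjI)
      fix p assume p: "p \<in> {p. prime p \<and> p \<le> Y}"
      hence p2: "real p \<ge> 2" using prime_ge_2_nat by force
      have "real p powr (-(1/4)) \<le> 2 powr (-(1/4))" using p2 by (intro powr_mono2') auto
      also have "\<dots> \<le> 7 / 8"
      proof -
        have "((7/8 :: real) ^ 4) \<ge> 1 / 2" by (simp add: power4_eq_xxxx)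
        hence "(1 / 2) powr (1/4) \<le> ((7/8 :: real) ^ 4) powr (1/4)" by (intro powr_mono2) auto
        also have "(7/8 :: real) ^ 4 = (7/8) powr real 4" by (rule powr_realpow[symmetric]) simp
        also have "\<dots> powr (1/4) = 7 / 8" by (simp only: powr_powr) simp
        also have "(1 / 2 :: real) powr (1/4) = 2 powr (-(1/4))"
          by (simp only: powr_minus powr_divide powr_one_eq_one inverse_eq_divide)
        finally show ?thesis .
      qed
      finally have "cmod (of_nat p powr (- complex_of_real (1/4))) \<le> 7 / 8"
        using p2 by (simp add: norm_of_nat_powr)
      moreover from this have "c * cmod (of_nat p powr (- complex_of_real (1/4))) \<le> 1 * (7 / 8)"
        using c by (intro mult_mono) auto
      ultimately have "cmod (of_real c * of_nat p powr (- complex_of_real (1/4))) \<le> 7 / 8"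
        using c by (simp add: norm_mult)
      hence "cmod (1 - of_real c * of_nat p powr (- complex_of_real (1/4))) \<ge> 1 / 8"
        using norm_triangle_ineq2[of 1 "of_real c * of_nat p powr (- complex_of_real (1/4))"] by simp
      hence "1 / cmod (1 - of_real c * of_nat p powr (- complex_of_real (1/4))) \<le> 1 / (1 / 8)"
        by (intro divide_left_mono) auto
      thus "cmod (1 / (1 - of_real c * of_nat p powr (- complex_of_real (1/4)))) \<le> 8"
        by (simp add: norm_divide)
    qed auto
    also have "\<dots> = 8 ^ card {p. prime p \<and> p \<le> Y}" by simp
    also have "\<dots> \<le> 8 ^ Y"
    proof (intro power_increasing)
      have "card {p. prime p \<and> p \<le> Y} \<le> card {1..Y}" by (intro card_mono) (auto dest: prime_ge_1_nat)
      thus "card {p. prime p \<and> p \<le> Y} \<le> Y" by simp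
    qed auto
    finally show ?thesis .
  qed
  define t where "t = infsum (\<lambda>n. r n * real n powr (-(1/4)) * real X powr (-(1/2))) {X<..}"
  have "(\<lambda>n. r n * real n powr (-(1/4)) * real X powr (-(1/2))) summable_on {X<..}"
    using summ by (intro summable_on_cmult_left) (rule summable_on_subset_banach, auto)
  hence "((\<lambda>n. r n * real n powr (-(1/4)) * real X powr (-(1/2))) has_sum t) {X<..}"
    unfolding t_def by (rule has_sum_infsum)
  hence "cmod (smooth_zeta Y c z - (\<Sum>n=1..X. of_real (r n) * of_nat n powr (-z))) \<le> t"
    unfolding r_def
  proof (rule has_sum_tail_bound[OF has_sum_smooth_zeta, rotated 4])
    fix n assume n: "n > X"
    have "real n powr (- Re z) \<le> real n powr (-(1/4) + -(1/2))" using n z X by (intro powr_mono) auto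
    also have "\<dots> = real n powr (-(1/4)) * real n powr (-(1/2))" by (rule powr_add)
    also have "\<dots> \<le> real n powr (-(1/4)) * real X powr (-(1/2))"
      using n X by (intro mult_left_mono powr_mono2') auto
    finally have "r n * real n powr (- Re z) \<le> r n * (real n powr (-(1/4)) * real X powr (-(1/2)))"
      using r[of n] by (intro mult_left_mono)
    thus "cmod (of_real (smooth_weight Y c n) * of_nat n powr (-z)) \<le>
       smooth_weight Y c n * real n powr (-(1/4)) * real X powr (-(1/2))"
      using n r[of n] by (simp add: norm_mult norm_of_nat_powr r_def mult.assoc)
  qed (use z c in auto)
  also have "t \<le> Re F * real X powr (-(1/2))"
    unfolding t_def
  proof (rule order_trans[OF infsum_mono_neutral])
    show "(\<lambda>n. r n * real n powr (-(1/4)) * real X powr (-(1/2))) summable_on UNIV"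
      by (intro summable_on_cmult_left summ)
    show "(\<Sum>\<^sub>\<infinity>n. r n * real n powr (-(1/4)) * real X powr (-(1/2))) \<le> Re F * real X powr (-(1/2))"
      using infsumI[OF has_sum_cmult_left[OF hs_re, of "real X powr (-(1/2))"]] by simp
  qed (use r \<open>(\<lambda>n. r n * real n powr (-(1/4)) * real X powr (-(1/2))) summable_on {X<..}\<close> in auto)
  also have "\<dots> \<le> 8 ^ Y * real X powr (-(1/2))" by (intro mult_right_mono F_le) auto
  also have "\<dots> = 8 ^ Y / sqrt (real X)" by (simp only: powr_minus_divide powr_half_sqrt[OF of_nat_0_le_iff] times_divide_eq_right mult_1_right)
  finally show ?thesis by (simp add: r_def)
qed

section \<open>Comparison of the Euler product with the Laplace transform\<close>

text \<open>Minus the logarithmic derivative of \<open>laplace_dickman\<close>, as an entire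
  function; 1 is the value that removes the singularity at 0.\<close>

definition expm1_quot :: "complex \<Rightarrow> complex" where
  "expm1_quot w = (if w = 0 then 1 else (1 - exp (-w)) / w)"

lemma expm1_quot_holomorphic: "expm1_quot holomorphic_on S"
proof -
  have "expm1_quot holomorphic_on UNIV"
  proof (rule no_isolated_singularity[where K = "{0}"])
    show "expm1_quot holomorphic_on UNIV - {0}"
      by (rule holomorphic_transform[of "\<lambda>w. (1 - exp (-w)) / w"])
         (auto intro!: holomorphic_intros simp: expm1_quot_def)
    have "isCont expm1_quot w" for w
    proof (cases "w = 0")
      case True
      have "((\<lambda>w. 1 - exp (-w)) has_field_derivative 1) (at (0 :: complex))"
        by (auto intro!: derivative_eq_intros)
      hence "(\<lambda>w. (1 - exp (-w)) / w) \<midarrow>0\<rightarrow> (1 :: complex)"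
        by (simp add: has_field_derivative_iff)
      hence "expm1_quot \<midarrow>0\<rightarrow> 1"
        by (rule Lim_transform_eventually) (auto simp: eventually_at_filter expm1_quot_def)
      thus ?thesis using True by (simp add: isCont_def expm1_quot_def)
    next
      case False
      have "isCont (\<lambda>w. (1 - exp (-w)) / w) w" using False by (intro continuous_intros) auto
      moreover have "eventually (\<lambda>w. expm1_quot w = (1 - exp (-w)) / w) (nhds w)"
        using False by (intro eventually_mono[OF t1_space_nhds]) (auto simp: expm1_quot_def)
      ultimately show ?thesis using isCont_cong[of expm1_quot "\<lambda>w. (1 - exp (-w)) / w" w] by simp
    qed
    thus "continuous_on UNIV expm1_quot" by (simp add: continuous_at_imp_continuous_on)
  qed auto
  thus ?thesis by (rule holomorphic_on_subset) auto
qed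

text \<open>The point 0, where \<open>laplace_dickman_ode\<close> degenerates, is treated as a removable singularity.\<close>

lemma log_derivative_comparison:
  fixes f h g q :: "complex \<Rightarrow> complex"
  assumes U: "open U" "convex U" and u: "a \<in> U" "w \<in> U"
    and h: "\<And>z. z \<in> U \<Longrightarrow> (h has_field_derivative - g z * h z) (at z)" "\<And>z. z \<in> U \<Longrightarrow> h z \<noteq> 0"
    and f: "\<And>z. z \<in> U \<Longrightarrow> z \<noteq> 0 \<Longrightarrow> (f has_field_derivative - q z * f z) (at z)" "f holomorphic_on U"
    and g: "g holomorphic_on U" and q: "q holomorphic_on U"
    and le: "\<And>z. z \<in> U \<Longrightarrow> z \<noteq> 0 \<Longrightarrow> cmod (g z - q z) \<le> e"
  obtains k where "f w / h w = f a / h a * exp k" "cmod k \<le> e * cmod (w - a)"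
proof -
  have "(\<lambda>z. g z - q z) holomorphic_on U" using g q by (intro holomorphic_intros)
  then obtain K where K: "\<And>z. z \<in> U \<Longrightarrow> (K has_field_derivative (g z - q z)) (at z within U)"
    using holomorphic_convex_primitive'[OF U(2,1)] by blast
  have K': "(K has_field_derivative (g z - q z)) (at z)" if "z \<in> U" for z
    using K[OF that] at_within_open[OF that U(1)] by simp
  have h_holo: "h holomorphic_on U"
    using h(1) by (meson field_differentiable_at_within field_differentiable_def holomorphic_on_def)
  have K_holo: "K holomorphic_on U"
    using K' by (meson field_differentiable_at_within field_differentiable_def holomorphic_on_def)
  \<comment> \<open>The logarithmic derivative of \<open>f / h\<close> is \<open>g - q\<close>, the
    derivative of \<open>K\<close>, so \<open>T\<close> is constant.\<close>
  define T where "T = (\<lambda>z. f z / h z * exp (- K z))"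
  have "\<exists>c. \<forall>z\<in>U. T z = c"
  proof (rule DERIV_zero_connected_constant[of U "{0}"])
    show "connected U" using U by (intro convex_connected)
    have "T holomorphic_on U"
      unfolding T_def using f(2) h_holo K_holo h(2) by (intro holomorphic_intros) auto
    thus "continuous_on U T" by (rule holomorphic_on_imp_continuous_on)
    show "\<forall>z\<in>U - {0}. (T has_field_derivative 0) (at z)"
    proof
      fix z assume "z \<in> U - {0}"
      hence z: "z \<in> U" "z \<noteq> 0" by auto
      note [derivative_intros] = h(1)[OF z(1)] f(1)[OF z] K'[OF z(1)]
      show "(T has_field_derivative 0) (at z)"
        unfolding T_def using h(2)[OF z(1)]
        by (auto intro!: derivative_eq_intros simp: field_simps power2_eq_square)
    qed
  qed (use U in auto)
  hence "T w = T a" using u by auto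
  have "f w / h w = T w * exp (K w)" by (simp add: T_def mult.assoc exp_add[symmetric])
  also have "\<dots> = f a / h a * exp (K w - K a)"
    unfolding \<open>T w = T a\<close> by (simp add: T_def mult.assoc exp_add[symmetric])
  finally have eq: "f w / h w = f a / h a * exp (K w - K a)" .
  have le': "cmod (g z - q z) \<le> e" if "z \<in> U" for z
  proof (cases "z = 0")
    case True
    have "isCont (\<lambda>z. g z - q z) 0"
      using g q U(1) that True
      by (intro continuous_intros) (meson continuous_on_eq_continuous_at holomorphic_on_imp_continuous_on)+
    hence "(\<lambda>z. cmod (g z - q z)) \<midarrow>0\<rightarrow> cmod (g 0 - q 0)"
      unfolding isCont_def by (intro tendsto_norm)
    moreover have "eventually (\<lambda>z. cmod (g z - q z) \<le> e) (at 0)"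
      using eventually_at_in_open[OF U(1), of 0] that True by (auto elim!: eventually_mono intro: le)
    ultimately show ?thesis using True by (intro tendsto_upperbound[of _ _ "at 0"]) auto
  qed (use le that in auto)
  have "cmod (K w - K a) \<le> e * cmod (w - a)"
    by (rule field_differentiable_bound[OF U(2) K le' u(2,1)])
  with eq that show ?thesis by blast
qed

lemma norm_exp_minus_1_le:
  assumes "cmod k \<le> 1"
  shows "cmod (exp k - 1) \<le> 3 * cmod k"
proof -
  have "Re k \<le> 1" using assms complex_Re_le_cmod[of k] by linarith
  hence "cmod (exp k - exp 0) \<le> exp 1 * cmod (k - 0)" by (intro norm_exp_diff_le) auto
  also have "\<dots> \<le> 3 * cmod k" using exp_le by (simp add: mult_right_mono)
  finally show ?thesis by simp
qed

text \<open>On a convex region containing the disc around \<open>- A\<close> and the point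
  \<open>S\<close>, the logarithmic derivatives differ by \<open>O(S (1 + D) / \<Lambda>)\<close>;
  over a distance \<open>O(S)\<close> this accumulates to
  \<open>O(S\<^sup>2 (1 + D) / \<Lambda>)\<close>. At \<open>S\<close> both functions are within
  \<open>O(S (1 + D) / \<Lambda>)\<close> of a quotient of size \<open>1 / S\<close>, so the
  relative error there has the same order; \<open>exp S = \<Lambda>\<close> makes the exponential
  errors \<open>O(1 / \<Lambda>)\<close>.\<close>

lemma smooth_zeta_approx_laplace:
  fixes A :: real
  assumes "A > 0"
  obtains C where "C > 0" "\<And>\<Lambda> D Y S \<delta> w. \<lbrakk>\<Lambda> \<ge> 4 * (A + 2); D \<ge> 0; Y > 0; ln (real Y) \<le> \<Lambda>; \<Lambda> \<le> ln (real Y) + D;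
     0 \<le> \<delta>; \<delta> \<le> 1 / \<Lambda>\<^sup>2; S \<ge> 1; exp S = \<Lambda>; S * D \<le> \<Lambda>; C * (S\<^sup>2 * (1 + D) / \<Lambda>) \<le> 1; cmod (w + of_real A) \<le> 1\<rbrakk> \<Longrightarrow>
     cmod (smooth_zeta Y (1 - \<delta>) (1 + w / of_real \<Lambda>) / of_real \<Lambda> - laplace_dickman w) \<le> C * (S\<^sup>2 * (1 + D) / \<Lambda>)"
proof -
  \<comment> \<open>The closed unit disc around \<open>- A\<close> then lies strictly inside
    \<open>Re w > - B\<close>.\<close>
  define B where "B = A + 2"
  have B: "B > 0" "B \<ge> 0" using assms by (simp_all add: B_def)
  obtain C1 where C1: "C1 > 0" "\<And>\<Lambda> D Y w \<delta>. \<lbrakk>\<Lambda> \<ge> 1; \<Lambda> \<ge> 4 * B; D \<ge> 0; Y > 0; ln (real Y) \<le> \<Lambda>; \<Lambda> \<le> ln (real Y) + D; w \<noteq> 0; Re w \<ge> - B; 0 \<le> \<delta>; \<delta> \<le> 1 / \<Lambda>\<rbrakk> \<Longrightarrow>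
     cmod (log_deriv Y (1 - \<delta>) (1 + w / of_real \<Lambda>) / of_real \<Lambda> - (1 - exp (-w)) / w) \<le> C1 * ((1 + cmod w) * (1 + D) / \<Lambda>)"
    using log_deriv_approx[OF B(2)] by blast
  obtain C2 where C2: "C2 > 0" "\<And>\<Lambda> D Y S \<delta>. \<lbrakk>\<Lambda> \<ge> 1; D \<ge> 0; Y > 0; ln (real Y) \<le> \<Lambda>; \<Lambda> \<le> ln (real Y) + D; S \<ge> 1; 0 \<le> \<delta>; \<delta> \<le> 1 / \<Lambda>\<^sup>2\<rbrakk> \<Longrightarrow>
     cmod (smooth_zeta Y (1 - \<delta>) (1 + of_real S / of_real \<Lambda>) / of_real \<Lambda> - (1 - exp (- of_real S)) / of_real S)
       \<le> C2 * ((1 + S) * (1 + D) / \<Lambda>) + exp (- S + S * D / \<Lambda>)"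
    using smooth_zeta_real_approx by blast
  have "compact (laplace_dickman ` cball (- of_real A) 1)"
    by (intro compact_continuous_image holomorphic_on_imp_continuous_on laplace_dickman_holomorphic) auto
  then obtain K where K: "K > 0" "\<And>w. w \<in> cball (- of_real A) 1 \<Longrightarrow> cmod (laplace_dickman w) \<le> K"
    using compact_imp_bounded bounded_pos by (metis image_eqI)
  \<comment> \<open>\<open>c3\<close> belongs to the exponent \<open>k\<close>, \<open>c4\<close> to
    the distance of the two functions at \<open>S\<close>, \<open>c5\<close> to the deviation of
    their quotient at \<open>w\<close> from 1. The summands of \<open>C\<close> turn the hypothesis
    that \<open>C\<close> times the error is at most 1 into the smallness conditions used below;
    \<open>2 * K * c5\<close> is the final constant.\<close>
  define c3 where "c3 = 2 * C1 * (B + 3) * (B + 2)"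
  define c4 where "c4 = 5 + 2 * C2"
  define c5 where "c5 = 12 * c4 + 3 * c3"
  define C where "C = 2 * K * c5 + 2 * c5 + 4 * c4 + c3"
  have pos: "c3 > 0" "c4 > 0" "c5 > 0"
    using B C1(1) C2(1) by (auto simp: c3_def c4_def c5_def intro!: add_pos_pos mult_pos_pos)
  have "cmod (smooth_zeta Y (1 - \<delta>) (1 + w / of_real \<Lambda>) / of_real \<Lambda> - laplace_dickman w) \<le> C * (S\<^sup>2 * (1 + D) / \<Lambda>)"
    if LB: "\<Lambda> \<ge> 4 * (A + 2)" and D: "D \<ge> 0" and Y: "Y > 0" and lnY: "ln (real Y) \<le> \<Lambda>" "\<Lambda> \<le> ln (real Y) + D"
     and \<delta>: "0 \<le> \<delta>" "\<delta> \<le> 1 / \<Lambda>\<^sup>2" and S: "S \<ge> 1" "exp S = \<Lambda>" "S * D \<le> \<Lambda>" and small: "C * (S\<^sup>2 * (1 + D) / \<Lambda>) \<le> 1"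
     and w: "cmod (w + of_real A) \<le> 1"
    for \<Lambda> D Y S \<delta> w
  proof -
    have L1: "\<Lambda> \<ge> 1" using LB assms by simp
    have LB': "\<Lambda> \<ge> 4 * B" using LB by (simp add: B_def)
    have "1 / \<Lambda>\<^sup>2 \<le> 1 / \<Lambda>" using L1 by (simp add: field_simps power2_eq_square)
    hence \<delta>': "\<delta> \<le> 1 / \<Lambda>" using \<delta> by linarith
    have "1 / \<Lambda> \<le> 1" using L1 by simp
    hence \<delta>1: "\<delta> \<le> 1" using \<delta>' by linarith
    define \<eta> where "\<eta> = S\<^sup>2 * (1 + D) / \<Lambda>"
    have \<eta>0: "\<eta> \<ge> 0" using S D L1 by (simp add: \<eta>_def)
    have smalls: "c5 * \<eta> \<le> 1 / 2" "c4 * \<eta> \<le> 1 / 4" "c3 * \<eta> \<le> 1"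
    proof -
      have "0 \<le> 2 * K * c5 * \<eta>" "0 \<le> 2 * c5 * \<eta>" "0 \<le> 4 * c4 * \<eta>" "0 \<le> c3 * \<eta>"
        using K pos \<eta>0 by auto
      moreover have "2 * K * c5 * \<eta> + 2 * c5 * \<eta> + 4 * c4 * \<eta> + c3 * \<eta> \<le> 1"
        using small by (simp add: C_def \<eta>_def[symmetric] distrib_right)
      ultimately show "c5 * \<eta> \<le> 1 / 2" "c4 * \<eta> \<le> 1 / 4" "c3 * \<eta> \<le> 1" by linarith+
    qed
    define H where "H = (\<lambda>w. smooth_zeta Y (1 - \<delta>) (1 + w / of_real \<Lambda>) / of_real \<Lambda>)"
    define G where "G = (\<lambda>w. log_deriv Y (1 - \<delta>) (1 + w / of_real \<Lambda>) / of_real \<Lambda>)"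
    define R where "R = S + B + 1"
    define U where "U = {w. Re w > - B} \<inter> ball 0 R"
    have Re_pos: "Re (1 + w / of_real \<Lambda>) > 0" if "w \<in> U" for w
    proof -
      have "Re w > - B" using that by (simp add: U_def)
      hence "Re w > - \<Lambda>" using LB' B by linarith
      thus ?thesis using L1 by (simp add: field_simps)
    qed
    have U: "open U" "convex U"
      unfolding U_def by (auto intro!: open_Int open_halfspace_Re_gt convex_Int convex_halfspace_Re_gt)
    have wU: "w \<in> U"
    proof -
      have "\<bar>Re (w + of_real A)\<bar> \<le> 1" using w abs_Re_le_cmod order_trans by blast
      hence "Re w \<ge> - A - 1" by simp
      moreover have "cmod w \<le> 1 + A"
        using norm_triangle_ineq4[of "w + of_real A" "of_real A"] w assms by simp
      ultimately show ?thesis using S by (simp add: U_def B_def R_def)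
    qed
    have SU: "of_real S \<in> U" using S B by (simp add: U_def R_def)
    have H_der: "(H has_field_derivative - G z * H z) (at z)" if "z \<in> U" for z
    proof -
      have "((\<lambda>z. 1 + z / of_real \<Lambda>) has_field_derivative 1 / of_real \<Lambda>) (at z)"
        using L1 by (auto intro!: derivative_eq_intros)
      from DERIV_cdivide[OF DERIV_chain2[OF DERIV_smooth_zeta[OF Re_pos[OF that], of "1 - \<delta>" Y] this], of "of_real \<Lambda>"]
      show ?thesis using \<delta> \<delta>1 by (simp add: H_def G_def mult_ac)
    qed
    have H_nz: "H z \<noteq> 0" if "z \<in> U" for z
      using smooth_zeta_nonzero[OF Re_pos[OF that], of "1 - \<delta>" Y] \<delta> \<delta>1 L1 by (simp add: H_def)
    have Lap_der: "(laplace_dickman has_field_derivative - expm1_quot z * laplace_dickman z) (at z)" if "z \<noteq> 0" for z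
    proof -
      have "deriv laplace_dickman z = - expm1_quot z * laplace_dickman z"
        using laplace_dickman_ode[of z] that by (simp add: expm1_quot_def field_simps)
      thus ?thesis using laplace_dickman_has_field_derivative[of z] by simp
    qed
    have G_holo: "G holomorphic_on U"
    proof -
      have "1 - of_real (1 - \<delta>) * of_nat p powr (-(1 + z / of_real \<Lambda>)) \<noteq> 0" if "z \<in> U" "prime p" for z p
        using prime_powr_norm_less_1[OF that(2) Re_pos[OF that(1)], of "1 - \<delta>"] \<delta> \<delta>1 by auto
      thus ?thesis unfolding G_def log_deriv_def using L1
        by (intro holomorphic_intros) (auto dest: prime_gt_0_nat)
    qed
    define e where "e = C1 * ((1 + R) * (1 + D) / \<Lambda>)"
    have le: "cmod (G z - expm1_quot z) \<le> e" if "z \<in> U" "z \<noteq> 0" for z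
    proof -
      have "cmod (G z - expm1_quot z) \<le> C1 * ((1 + cmod z) * (1 + D) / \<Lambda>)"
        using C1(2)[of \<Lambda> D Y z \<delta>] that L1 LB' D Y lnY \<delta> \<delta>' by (simp add: G_def expm1_quot_def U_def)
      also have "\<dots> \<le> e" unfolding e_def
        using C1(1) that L1 D by (intro mult_left_mono divide_right_mono mult_right_mono) (auto simp: U_def)
      finally show ?thesis .
    qed
    obtain k where k: "laplace_dickman w / H w = laplace_dickman (of_real S) / H (of_real S) * exp k"
        "cmod k \<le> e * cmod (w - of_real S)"
      using log_derivative_comparison[OF U SU wU H_der H_nz Lap_der laplace_dickman_holomorphic G_holo
        expm1_quot_holomorphic le] by metis
    have k_le: "cmod k \<le> c3 * \<eta>"
    proof -
      have "cmod (w - of_real S) \<le> 2 * R"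
        using norm_triangle_ineq4[of w "of_real S"] wU SU by (simp add: U_def)
      moreover have "e \<ge> 0" using C1 D L1 B S by (simp add: e_def R_def)
      ultimately have "cmod k \<le> e * (2 * R)" using k(2) by (meson mult_left_mono order_trans)
      also have "\<dots> = 2 * C1 * (1 + R) * R * ((1 + D) / \<Lambda>)" by (simp add: e_def)
      also have "\<dots> \<le> 2 * C1 * ((B + 3) * S) * ((B + 2) * S) * ((1 + D) / \<Lambda>)"
      proof -
        have "B \<le> B * S" using mult_left_mono[OF S(1) B(2)] by simp
        hence "1 + R \<le> (B + 3) * S" "R \<le> (B + 2) * S" using S(1) by (auto simp: R_def algebra_simps)
        moreover have "R \<ge> 0" using B S by (simp add: R_def)
        ultimately show ?thesis using C1(1) D L1 B S by (intro mult_right_mono mult_mono) auto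
      qed
      also have "\<dots> = c3 * \<eta>" by (simp add: c3_def \<eta>_def power2_eq_square)
      finally show ?thesis .
    qed
    define Q where "Q = (1 - exp (- of_real S)) / complex_of_real S"
    define d where "d = S * (1 + D) / \<Lambda>"
    have d0: "d \<ge> 0" "1 / \<Lambda> \<le> d"
    proof -
      have "1 * 1 \<le> S * (1 + D)" using S D by (intro mult_mono) auto
      thus "1 / \<Lambda> \<le> d" using L1 unfolding d_def by (intro divide_right_mono) auto
      thus "d \<ge> 0" using L1 by (meson divide_nonneg_nonneg order_trans zero_le_one)
    qed
    have dS: "S * d = \<eta>" by (simp add: d_def \<eta>_def power2_eq_square)
    have expS: "exp (-S) = 1 / \<Lambda>" using S(2) by (simp add: exp_minus inverse_eq_divide)
    have HQ: "cmod (H (of_real S) - Q) \<le> 2 * C2 * d + 3 * d"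
    proof -
      have "exp (- S + S * D / \<Lambda>) \<le> 3 * (1 / \<Lambda>)"
      proof -
        have "exp (S * D / \<Lambda>) \<le> exp 1" using S L1 by simp
        also have "\<dots> \<le> 3" by (rule exp_le)
        finally show ?thesis using L1 unfolding exp_add expS by (simp add: field_simps)
      qed
      moreover have "C2 * ((1 + S) * (1 + D) / \<Lambda>) \<le> C2 * ((2 * S) * (1 + D) / \<Lambda>)"
        using C2(1) S D L1 by (intro mult_left_mono divide_right_mono mult_right_mono) auto
      moreover have "C2 * ((2 * S) * (1 + D) / \<Lambda>) = 2 * C2 * d" by (simp add: d_def)
      ultimately show ?thesis
        using C2(2)[of \<Lambda> D Y S \<delta>] L1 D Y lnY S \<delta> d0 unfolding H_def Q_def by linarith
    qed
    have LQ: "cmod (laplace_dickman (of_real S) - Q) \<le> 2 * d"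
      using laplace_dickman_approx_at_large[OF S(1)] d0(2) expS unfolding Q_def by linarith
    have LH: "cmod (laplace_dickman (of_real S) - H (of_real S)) \<le> c4 * d"
    proof -
      have "laplace_dickman (of_real S) - H (of_real S) = (laplace_dickman (of_real S) - Q) - (H (of_real S) - Q)" by simp
      also have "cmod \<dots> \<le> 2 * d + (2 * C2 * d + 3 * d)"
        by (rule order_trans[OF norm_triangle_ineq4 add_mono[OF LQ HQ]])
      finally show ?thesis by (simp add: c4_def algebra_simps)
    qed
    \<comment> \<open>\<open>Q\<close> is at least \<open>1 / (2 * S)\<close>, and
      \<open>c4 * \<eta> \<le> 1 / 4\<close> bounds the error by half of that.\<close>
    have H_ge: "cmod (H (of_real S)) \<ge> 1 / (4 * S)"
    proof -
      have half: "exp (-S) \<le> 1 / 2"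
      proof -
        have "exp (1 :: real) \<ge> 2" using exp_ge_add_one_self[of 1] by simp
        moreover have "exp 1 \<le> exp S" using S(1) by simp
        ultimately have "exp S \<ge> 2" by linarith
        thus ?thesis by (simp add: exp_minus field_simps)
      qed
      have "Q = of_real ((1 - exp (-S)) / S)" by (simp add: Q_def flip: exp_of_real)
      hence "cmod Q = \<bar>(1 - exp (-S)) / S\<bar>" by (simp only: norm_of_real)
      also have "\<dots> \<ge> (1 - exp (-S)) / S" by (rule abs_ge_self)
      finally have "cmod Q \<ge> (1 - exp (-S)) / S" .
      moreover have "(1 / 2) / S \<le> (1 - exp (-S)) / S" using half S(1) by (intro divide_right_mono) auto
      ultimately have "cmod Q \<ge> (1 / 2) / S" by linarith
      moreover have "cmod (H (of_real S) - Q) \<le> (1 / 4) / S"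
      proof -
        have "cmod (H (of_real S) - Q) \<le> c4 * d" using HQ d0 by (simp add: c4_def algebra_simps)
        also have "\<dots> = c4 * \<eta> / S" using S dS by (simp add: field_simps)
        also have "\<dots> \<le> (1 / 4) / S" using smalls S by (intro divide_right_mono) auto
        finally show ?thesis .
      qed
      moreover have "cmod Q \<le> cmod (H (of_real S)) + cmod (H (of_real S) - Q)"
        using norm_triangle_ineq4[of "H (of_real S)" "H (of_real S) - Q"] by simp
      ultimately show ?thesis by simp
    qed
    define T where "T = laplace_dickman (of_real S) / H (of_real S)"
    have T1: "cmod (T - 1) \<le> 4 * c4 * \<eta>"
    proof -
      have "T - 1 = (laplace_dickman (of_real S) - H (of_real S)) / H (of_real S)"
        using H_nz[OF SU] by (simp add: T_def field_simps)
      also have "cmod \<dots> \<le> c4 * d / (1 / (4 * S))"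
        unfolding norm_divide using LH H_ge pos d0 S by (intro frac_le) auto
      also have "\<dots> = 4 * c4 * \<eta>" using dS by (simp add: mult_ac)
      finally show ?thesis .
    qed
    have k1: "cmod (exp k - 1) \<le> 3 * c3 * \<eta>"
      using norm_exp_minus_1_le[of k] k_le smalls by simp
    have exp_k: "cmod (exp k) \<le> 3"
    proof -
      have "Re k \<le> 1" using complex_Re_le_cmod[of k] k_le smalls by linarith
      hence "exp (Re k) \<le> exp 1" by (subst exp_le_cancel_iff)
      thus ?thesis using exp_le unfolding norm_exp_eq_Re by linarith
    qed
    have Tw: "cmod (T * exp k - 1) \<le> c5 * \<eta>"
    proof -
      have "T * exp k - 1 = (T - 1) * exp k + (exp k - 1)" by (simp add: algebra_simps)
      also have "cmod \<dots> \<le> (4 * c4 * \<eta>) * 3 + 3 * c3 * \<eta>"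
      proof (rule order_trans[OF norm_triangle_ineq add_mono[OF _ k1]])
        show "cmod ((T - 1) * exp k) \<le> (4 * c4 * \<eta>) * 3"
          unfolding norm_mult using T1 exp_k pos \<eta>0 by (intro mult_mono) auto
      qed
      also have "\<dots> = c5 * \<eta>" by (simp add: c5_def algebra_simps)
      finally show ?thesis .
    qed
    have eq: "laplace_dickman w = T * exp k * H w"
      using k(1) H_nz[OF wU] by (simp add: T_def field_simps)
    \<comment> \<open>The quotient is within 1/2 of 1, so the bound \<open>K\<close> for the
      transform gives \<open>2 * K\<close> for \<open>H w\<close>; this turns the relative error
      into an absolute one.\<close>
    have "cmod (T * exp k) \<ge> 1 / 2"
      using norm_triangle_ineq2[of 1 "1 - T * exp k"] Tw smalls by (simp add: norm_minus_commute)
    hence "(1 / 2) * cmod (H w) \<le> cmod (T * exp k) * cmod (H w)" by (intro mult_right_mono) auto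
    also have "\<dots> = cmod (laplace_dickman w)" unfolding eq by (simp add: norm_mult)
    also have "\<dots> \<le> K" using w by (intro K) (simp add: dist_norm norm_minus_commute add.commute)
    finally have H_le: "cmod (H w) \<le> 2 * K" by simp
    have "H w - laplace_dickman w = - (T * exp k - 1) * H w" by (simp add: eq algebra_simps)
    also have "cmod \<dots> = cmod (T * exp k - 1) * cmod (H w)" by (simp only: norm_mult norm_minus_cancel)
    also have "\<dots> \<le> (c5 * \<eta>) * (2 * K)"
      using Tw H_le pos \<eta>0 by (intro mult_mono) auto
    also have "\<dots> \<le> C * \<eta>"
    proof -
      have "2 * K * c5 \<le> C" using K pos by (simp add: C_def)
      hence "2 * K * c5 * \<eta> \<le> C * \<eta>" using \<eta>0 by (intro mult_right_mono)
      thus ?thesis by (simp add: mult_ac)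
    qed
    finally show ?thesis by (simp add: H_def \<eta>_def)
  qed
  moreover have "C > 0" using K pos by (simp add: C_def add_pos_pos)
  ultimately show ?thesis using that by blast
qed

text \<open>Cauchy's inequality on the unit circle around \<open>- A\<close>, applied to the
  truncated series minus the transform. Up to a common sign the \<open>j\<close>-th derivatives
  there are the normalised moment sum and \<open>D_const j A\<close>; the error is multiplied by
  \<open>fact j\<close>.\<close>

lemma smooth_moment_lower_bound:
  fixes A :: real
  assumes "A > 0"
  obtains C where "C > 0" "\<And>\<Lambda> D Y S \<delta> X j. \<lbrakk>\<Lambda> \<ge> 4 * (A + 2); D \<ge> 0; Y > 0; ln (real Y) \<le> \<Lambda>; \<Lambda> \<le> ln (real Y) + D;
     0 \<le> \<delta>; \<delta> \<le> 1 / \<Lambda>\<^sup>2; S \<ge> 1; exp S = \<Lambda>; S * D \<le> \<Lambda>; C * (S\<^sup>2 * (1 + D) / \<Lambda>) \<le> 1; X \<ge> 1\<rbrakk> \<Longrightarrow>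
     (D_const j A - fact j * (C * (S\<^sup>2 * (1 + D) / \<Lambda>) + 8 ^ Y / sqrt (real X))) * \<Lambda> ^ (j + 1)
       \<le> (\<Sum>n=1..X. (ln (real n) ^ j * real n powr (-(1 - A / \<Lambda>))) * smooth_weight Y (1 - \<delta>) n)"
proof -
  obtain C where C: "C > 0" "\<And>\<Lambda> D Y S \<delta> w. \<lbrakk>\<Lambda> \<ge> 4 * (A + 2); D \<ge> 0; Y > 0; ln (real Y) \<le> \<Lambda>; \<Lambda> \<le> ln (real Y) + D;
     0 \<le> \<delta>; \<delta> \<le> 1 / \<Lambda>\<^sup>2; S \<ge> 1; exp S = \<Lambda>; S * D \<le> \<Lambda>; C * (S\<^sup>2 * (1 + D) / \<Lambda>) \<le> 1; cmod (w + of_real A) \<le> 1\<rbrakk> \<Longrightarrow>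
     cmod (smooth_zeta Y (1 - \<delta>) (1 + w / of_real \<Lambda>) / of_real \<Lambda> - laplace_dickman w) \<le> C * (S\<^sup>2 * (1 + D) / \<Lambda>)"
    using smooth_zeta_approx_laplace[OF assms] by blast
  have "(D_const j A - fact j * (C * (S\<^sup>2 * (1 + D) / \<Lambda>) + 8 ^ Y / sqrt (real X))) * \<Lambda> ^ (j + 1)
       \<le> (\<Sum>n=1..X. (ln (real n) ^ j * real n powr (-(1 - A / \<Lambda>))) * smooth_weight Y (1 - \<delta>) n)"
    if LB: "\<Lambda> \<ge> 4 * (A + 2)" and H: "D \<ge> 0" "Y > 0" "ln (real Y) \<le> \<Lambda>" "\<Lambda> \<le> ln (real Y) + D"
     "0 \<le> \<delta>" "\<delta> \<le> 1 / \<Lambda>\<^sup>2" "S \<ge> 1" "exp S = \<Lambda>" "S * D \<le> \<Lambda>" "C * (S\<^sup>2 * (1 + D) / \<Lambda>) \<le> 1" and X: "X \<ge> 1"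
    for \<Lambda> D Y S \<delta> X j
  proof -
    define err where "err = C * (S\<^sup>2 * (1 + D) / \<Lambda>) + 8 ^ Y / sqrt (real X)"
    define r where "r = smooth_weight Y (1 - \<delta>)"
    define M where "M = (\<Sum>n=1..X. (ln (real n) ^ j * real n powr (-(1 - A / \<Lambda>))) * r n)"
    have L1: "\<Lambda> \<ge> 1" using LB assms by simp
    have "1 / \<Lambda>\<^sup>2 \<le> 1" using L1 by simp
    hence \<delta>1: "\<delta> \<le> 1" using H by linarith
    \<comment> \<open>The truncated series at \<open>1 + w / \<Lambda>\<close>, divided by
      \<Lambda>. Each differentiation in \<open>w\<close> yields another
      \<open>1 / \<Lambda>\<close>, hence the power \<open>j + 1\<close>.\<close>
    define P where "P = (\<lambda>w. \<Sum>n=1..X. (of_real (r n) / of_real \<Lambda>) * of_nat n powr (-(1 + (1 / of_real \<Lambda>) * w)) :: complex)"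
    have P_holo: "P holomorphic_on UNIV" unfolding P_def by (intro holomorphic_intros) auto
    have "cmod ((deriv ^^ j) (\<lambda>w. P w - laplace_dickman w) (- of_real A)) \<le> fact j * err / 1 ^ j"
    proof (rule Cauchy_inequality)
      show "(\<lambda>w. P w - laplace_dickman w) holomorphic_on ball (- of_real A) 1"
        by (intro holomorphic_intros holomorphic_on_subset[OF P_holo] laplace_dickman_holomorphic) auto
      show "continuous_on (cball (- of_real A) 1) (\<lambda>w. P w - laplace_dickman w)"
        by (intro continuous_intros holomorphic_on_imp_continuous_on laplace_dickman_holomorphic
              holomorphic_on_subset[OF P_holo]) auto
      fix w assume "cmod (- of_real A - w) = 1"
      hence w: "cmod (w + of_real A) = 1" by (metis minus_diff_eq norm_minus_cancel diff_minus_eq_add)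
      have Re_w: "Re (1 + w / of_real \<Lambda>) \<ge> 3 / 4"
      proof -
        have "\<bar>Re (w + of_real A)\<bar> \<le> 1" using w abs_Re_le_cmod[of "w + of_real A"] by simp
        hence "Re w \<ge> - A - 1" by simp
        hence "4 * Re w \<ge> - \<Lambda>" using LB by simp
        thus ?thesis using L1 by (simp add: field_simps)
      qed
      define F where "F = smooth_zeta Y (1 - \<delta>) (1 + w / of_real \<Lambda>)"
      have P_eq: "P w = (\<Sum>n=1..X. of_real (r n) * of_nat n powr (-(1 + w / of_real \<Lambda>))) / of_real \<Lambda>"
        by (simp add: P_def sum_divide_distrib)
      have "cmod (F - (\<Sum>n=1..X. of_real (r n) * of_nat n powr (-(1 + w / of_real \<Lambda>)))) \<le> 8 ^ Y / sqrt (real X)"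
        unfolding F_def r_def using H \<delta>1 X by (intro smooth_zeta_truncation Re_w) auto
      also have "\<dots> \<le> 8 ^ Y / sqrt (real X) * \<Lambda>" using L1 mult_left_mono[OF L1, of "8 ^ Y / sqrt (real X)"] by simp
      finally have 1: "cmod (F / of_real \<Lambda> - P w) \<le> 8 ^ Y / sqrt (real X)"
        unfolding P_eq diff_divide_distrib[symmetric] norm_divide using L1 by (simp add: field_simps)
      have 2: "cmod (F / of_real \<Lambda> - laplace_dickman w) \<le> C * (S\<^sup>2 * (1 + D) / \<Lambda>)"
        unfolding F_def using w by (intro C(2) LB H) auto
      have "P w - laplace_dickman w = (F / of_real \<Lambda> - laplace_dickman w) - (F / of_real \<Lambda> - P w)" by simp
      also have "cmod \<dots> \<le> err" unfolding err_def
        by (rule order_trans[OF norm_triangle_ineq4 add_mono[OF 2 1]])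
      finally show "cmod (P w - laplace_dickman w) \<le> err" .
    qed auto
    also have "(deriv ^^ j) (\<lambda>w. P w - laplace_dickman w) (- of_real A) =
      (deriv ^^ j) P (- of_real A) - (deriv ^^ j) laplace_dickman (- of_real A)"
      by (intro higher_deriv_diff[of _ UNIV] P_holo laplace_dickman_holomorphic) auto
    also have "(deriv ^^ j) P (- of_real A) = (-1) ^ j * of_real (M / \<Lambda> ^ (j + 1))"
    proof -
      have "(deriv ^^ j) P (- of_real A) = (\<Sum>n=1..X. (of_real (r n) / of_real \<Lambda>) *
          (- (1 / of_real \<Lambda>) * of_real (ln (real n))) ^ j * of_nat n powr (-(1 + (1 / of_real \<Lambda>) * (- of_real A))))"
        unfolding P_def by (rule higher_deriv_dirichlet_poly) auto
      also have "\<dots> = (\<Sum>n=1..X. (-1) ^ j * of_real ((ln (real n) ^ j * real n powr (-(1 - A / \<Lambda>))) * r n / \<Lambda> ^ (j + 1)))"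
      proof (intro sum.cong refl)
        fix n assume "n \<in> {1..X}"
        have "of_nat n powr (-(1 + (1 / of_real \<Lambda>) * (- of_real A))) = complex_of_real (real n powr (-(1 - A / \<Lambda>)))"
          using powr_of_real[of "real n" "-(1 - A / \<Lambda>)"] by simp
        moreover have "(- (1 / complex_of_real \<Lambda>) * of_real (ln (real n))) ^ j = (-1) ^ j * of_real (ln (real n) ^ j / \<Lambda> ^ j)"
        proof -
          have "- (1 / complex_of_real \<Lambda>) * of_real (ln (real n)) = - of_real (ln (real n) / \<Lambda>)" by simp
          thus ?thesis
            by (simp only: power_minus[of "complex_of_real (ln (real n) / \<Lambda>)" j] of_real_power[symmetric] power_divide)
        qed
        ultimately show "(of_real (r n) / of_real \<Lambda>) *
          (- (1 / of_real \<Lambda>) * of_real (ln (real n))) ^ j * of_nat n powr (-(1 + (1 / of_real \<Lambda>) * (- of_real A)))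
          = (-1) ^ j * complex_of_real ((ln (real n) ^ j * real n powr (-(1 - A / \<Lambda>))) * r n / \<Lambda> ^ (j + 1))"
          by (simp only:) simp
      qed
      also have "\<dots> = (-1) ^ j * of_real (M / \<Lambda> ^ (j + 1))"
        unfolding M_def sum_divide_distrib of_real_sum sum_distrib_left ..
      finally show ?thesis .
    qed
    also have "(deriv ^^ j) laplace_dickman (- of_real A) = (-1) ^ j * of_real (D_const j A)"
      by (rule higher_deriv_laplace_dickman)
    also have "(-1) ^ j * of_real (M / \<Lambda> ^ (j + 1)) - (-1) ^ j * of_real (D_const j A) =
      (-1) ^ j * complex_of_real (M / \<Lambda> ^ (j + 1) - D_const j A)"
      by (simp add: right_diff_distrib)
    also have "cmod \<dots> = \<bar>M / \<Lambda> ^ (j + 1) - D_const j A\<bar>"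
      unfolding norm_mult norm_of_real by (simp add: norm_power)
    finally have "D_const j A - fact j * err \<le> M / \<Lambda> ^ (j + 1)" by simp
    hence "(D_const j A - fact j * err) * \<Lambda> ^ (j + 1) \<le> M"
      using L1 by (subst (asm) pos_le_divide_eq) auto
    thus ?thesis unfolding err_def M_def r_def .
  qed
  from that[OF C(1) this] show ?thesis .
qed

subsection \<open>The lower bound\<close>

definition zeta_deriv_max :: "real \<Rightarrow> real \<Rightarrow> nat \<Rightarrow> real \<Rightarrow> real" where
  "zeta_deriv_max \<alpha> A j N =
     Max ((\<lambda>l::int. cmod ((deriv ^^ j) riemann_zeta
              (of_real (1 - A / iter_ln 2 N) + \<i> * of_real \<alpha> * of_int l)))
           ` {l. sqrt N \<le> of_int l \<and> of_int l \<le> N})"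

text \<open>The error terms in \<open>x = log\<^sub>3 N\<close>: comparison with the Laplace transform, truncation of the
  smooth Dirichlet series at \<open>N\<^sup>2\<close>, approximation of zeta, and the points \<open>\<bar>l\<bar> < sqrt N\<close>.\<close>

definition loss :: "real \<Rightarrow> real \<Rightarrow> real \<Rightarrow> real \<Rightarrow> real" where
  "loss \<alpha> A C x =
     (x / ln x) powr (x / ln x) * (C * (x\<^sup>2 * (1 + 2 * x) / exp x))
     + (x / ln x) powr (x / ln x) * (8 powr (exp (exp x) / exp x) * (2 / exp (exp (exp x))))
     + (16 * (x / ln x)) powr (x / ln x) * (((2 * exp (exp (exp x))^2) powr (1/8)) * (2 / (\<alpha> * sqrt (exp (exp (exp x)))))
         + (\<alpha> * exp (exp (exp x)) + 2) * ((exp (exp (exp x)) / 2) powr (-7/4) * 2))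
     + (2 * sqrt (exp (exp (exp x))) + 1) * (2 / exp (exp (exp x))) * (2 * exp (exp x)) powr (x / ln x)
         * exp (exp (exp x)) powr (2 * A / exp x) * (1 + 2 * exp (exp x)) * (exp x) powr (4 * (exp (exp x)) / exp x)"

text \<open>With \<open>J = x / ln x\<close>,
  \<open>J powr J = exp (x - x * ln (ln x) / ln x)\<close> falls short of \<open>exp x\<close> by
  more than any power of \<open>x\<close>, which settles the first term. For
  \<open>N = exp (exp (exp x))\<close> the others are \<open>N^(-1 + o(1))\<close>,
  \<open>N^(-1/4 + o(1))\<close> and \<open>N^(-1/2 + o(1))\<close>.\<close>

lemma loss_tendsto_0:
  assumes "\<alpha> > 0" "A > 0"
  shows "(loss \<alpha> A C \<longlongrightarrow> 0) at_top"
proof -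
  have "((\<lambda>x::real. (x / ln x) powr (x / ln x) * (C * (x\<^sup>2 * (1 + 2 * x) / exp x))) \<longlongrightarrow> 0) at_top"
    by real_asymp
  moreover have "((\<lambda>x::real. (x / ln x) powr (x / ln x) * (8 powr (exp (exp x) / exp x) * (2 / exp (exp (exp x))))) \<longlongrightarrow> 0) at_top"
    by real_asymp
  moreover have "((\<lambda>x::real. (16 * (x / ln x)) powr (x / ln x) * (((2 * exp (exp (exp x))^2) powr (1/8)) * (2 / (\<alpha> * sqrt (exp (exp (exp x)))))
         + (\<alpha> * exp (exp (exp x)) + 2) * ((exp (exp (exp x)) / 2) powr (-7/4) * 2))) \<longlongrightarrow> 0) at_top"
    using assms by real_asymp
  moreover have "((\<lambda>x::real. (2 * sqrt (exp (exp (exp x))) + 1) * (2 / exp (exp (exp x))) * (2 * exp (exp x)) powr (x / ln x)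
         * exp (exp (exp x)) powr (2 * A / exp x) * (1 + 2 * exp (exp x)) * (exp x) powr (4 * (exp (exp x)) / exp x)) \<longlongrightarrow> 0) at_top"
    using assms by real_asymp
  ultimately have "((\<lambda>x. loss \<alpha> A C x) \<longlongrightarrow> 0 + 0 + 0 + 0) at_top"
    unfolding loss_def by (intro tendsto_add)
  thus ?thesis by simp
qed

section \<open>Assembly of the estimates\<close>

lemma powr_le_self_power:
  assumes "real j \<le> J" "1 \<le> c * J" "c \<ge> 0"
  shows "c ^ j * real j ^ j \<le> (c * J) powr J"
proof -
  have "c ^ j * real j ^ j = (c * real j) ^ j" by (simp add: power_mult_distrib)
  also have "\<dots> \<le> (c * J) ^ j" using assms by (intro power_mono mult_left_mono) auto
  also have "\<dots> = (c * J) powr real j" using assms by (intro powr_realpow[symmetric]) linarith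
  also have "\<dots> \<le> (c * J) powr J" using assms by (intro powr_mono) auto
  finally show ?thesis .
qed

lemma fact_le_real_power: "fact j \<le> real j ^ j"
  using fact_le_power[of j, where 'a = real] by simp

lemma dirichlet_term:
  assumes "n > 0"
  shows "(- of_real (ln (real n))) ^ j * of_nat n powr (-(of_real \<sigma> + \<i> * of_real \<alpha> * of_int l)) =
    (-1) ^ j * (of_real (ln (real n) ^ j * real n powr (-\<sigma>)) * cis (- \<alpha> * of_int l * ln (real n)))"
proof -
  have "of_nat n powr (-(of_real \<sigma> + \<i> * of_real \<alpha> * of_int l)) =
    exp (of_real (- \<sigma> * ln (real n)) + \<i> * of_real (- \<alpha> * of_int l * ln (real n)))"
    using assms by (simp add: of_nat_powr_eq_exp algebra_simps)
  also have "\<dots> = of_real (real n powr (-\<sigma>)) * cis (- \<alpha> * of_int l * ln (real n))"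
    using assms by (simp only: exp_add cis_conv_exp exp_of_real powr_def) simp
  finally show ?thesis
    by (simp only: power_minus[of "complex_of_real (ln (real n))"] of_real_mult of_real_power mult.assoc)
qed

lemma resonator_smooth_weight:
  assumes "0 \<le> c" "c < 1"
  shows "resonator (smooth_weight Y c)"
proof
  show "smooth_weight Y c summable_on UNIV"
    using smooth_weight_has_sum[OF assms] by (rule has_sum_imp_summable)
  show "0 \<le> smooth_weight Y c n" for n using assms by (intro smooth_weight_nonneg)
qed (auto simp: smooth_weight_def mult_ext_mult)

text \<open>Each prime up to \<open>Y\<close> contributes the factor \<open>1 / \<delta>\<close>,
  and \<open>Y\<close> bounds their number. With \<open>\<delta> = 1 / \<Lambda>\<^sup>2\<close> and
  \<open>Y\<close> about \<open>log N / \<Lambda>\<close> even this crude count gives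
  \<open>N^o(1)\<close>.\<close>

lemma infsum_smooth_weight_le:
  assumes "0 < \<delta>" "\<delta> \<le> 1"
  shows "infsum (smooth_weight Y (1 - \<delta>)) UNIV \<le> (1 / \<delta>) ^ Y"
proof -
  have "infsum (smooth_weight Y (1 - \<delta>)) UNIV = (\<Prod>p | prime p \<and> p \<le> Y. 1 / (1 - (1 - \<delta>)))"
    using assms by (intro infsumI smooth_weight_has_sum) auto
  also have "\<dots> = (1 / \<delta>) ^ card {p. prime p \<and> p \<le> Y}" by simp
  also have "\<dots> \<le> (1 / \<delta>) ^ Y"
  proof (intro power_increasing)
    have "card {p. prime p \<and> p \<le> Y} \<le> card {1..Y}" by (intro card_mono) (auto dest: prime_ge_1_nat)
    thus "card {p. prime p \<and> p \<le> Y} \<le> Y" by simp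
  qed (use assms in auto)
  finally show ?thesis .
qed

lemma zeta_deriv_max_ge:
  assumes "l \<in> {l. sqrt N \<le> of_int l \<and> of_int l \<le> N}"
  shows "cmod ((deriv ^^ j) riemann_zeta (of_real (1 - A / iter_ln 2 N) + \<i> * of_real \<alpha> * of_int l)) \<le> zeta_deriv_max \<alpha> A j N"
proof -
  have "{l. sqrt N \<le> of_int l \<and> of_int l \<le> N} \<subseteq> {\<lceil>sqrt N\<rceil>..\<lfloor>N\<rfloor>}" by (auto simp: ceiling_le_iff le_floor_iff)
  hence "finite {l. sqrt N \<le> of_int l \<and> of_int l \<le> N}" by (rule finite_subset) auto
  thus ?thesis unfolding zeta_deriv_max_def using assms by (intro Max_ge) auto
qed

text \<open>\<open>zeta_higher_deriv_approx\<close> at the points of the maximum: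
  \<open>\<Lambda> \<ge> 16 * A\<close> gives \<open>\<sigma> \<ge> 15 / 16\<close>, and the size of
  \<open>M\<close> turns \<open>M^(-7/8)\<close> into \<open>N^(-7/4)\<close> up to constants. The
  polynomial differs from the one approximating the derivative only by the sign
  \<open>(-1)^j\<close>.\<close>

lemma dirichlet_poly_le_max:
  fixes N \<alpha> A \<Lambda> :: real and l :: int
  defines "\<sigma> \<equiv> 1 - A / \<Lambda>"
  assumes \<Lambda>: "\<Lambda> = iter_ln 2 N" "\<Lambda> \<ge> 16 * A" "\<Lambda> > 0" and "A > 0" and \<alpha>: "\<alpha> > 0" "\<alpha> * sqrt N \<ge> 1"
    and l: "sqrt N \<le> of_int l" "of_int l \<le> N" and M: "M \<ge> 1" "real M + 1 \<le> 2 * N\<^sup>2" "real M \<ge> (N / 2)\<^sup>2" "N > 0"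
  shows "cmod (\<Sum>n=1..M. of_real (ln (real n) ^ j * real n powr (-\<sigma>)) * cis (- \<alpha> * of_int l * ln (real n))) \<le>
    zeta_deriv_max \<alpha> A j N + fact j * 16 ^ j * (((2 * N\<^sup>2) powr (1/8)) * (2 / (\<alpha> * sqrt N))
         + (\<alpha> * N + 2) * ((N / 2) powr (-7/4) * 2))"
proof -
  define s where "s = of_real \<sigma> + \<i> * of_real \<alpha> * of_int l"
  define P where "P = (\<Sum>n=1..M. of_real (ln (real n) ^ j * real n powr (-\<sigma>)) * cis (- \<alpha> * of_int l * ln (real n)))"
  have \<sigma>: "15 / 16 \<le> \<sigma>" "\<sigma> \<le> 1" using \<Lambda> \<open>A > 0\<close> by (auto simp: \<sigma>_def field_simps)
  have sqrt0: "sqrt N > 0" using M by simp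
  have l0: "real_of_int l > 0" using l sqrt0 by linarith
  have Re: "Re s = \<sigma>" and Im: "Im s = \<alpha> * of_int l" by (simp_all add: s_def)
  have Im_ge: "\<bar>Im s\<bar> \<ge> \<alpha> * sqrt N" unfolding Im using l \<alpha> l0 by (simp add: mult_left_mono)
  have s_le: "cmod s \<le> 1 + \<alpha> * N"
  proof -
    have "cmod s \<le> \<bar>Re s\<bar> + \<bar>Im s\<bar>" by (rule cmod_le)
    also have "\<bar>Im s\<bar> \<le> \<alpha> * N" unfolding Im using l \<alpha> l0 by (simp add: mult_left_mono)
    finally show ?thesis using \<sigma> by (simp add: Re)
  qed
  have "cmod ((deriv ^^ j) riemann_zeta s - (\<Sum>n=1..M. (- of_real (ln (real n))) ^ j * of_nat n powr (-s))) \<le>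
    fact j * 16 ^ j * (real (Suc M) powr (1 / 8) * (2 / \<bar>Im s\<bar>) + (cmod s + 1) * (real M powr (-7/8) * 2))"
    using \<sigma> Im_ge \<alpha> M by (intro zeta_higher_deriv_approx) (auto simp: Re)
  also have "\<dots> \<le> fact j * 16 ^ j * (((2 * N\<^sup>2) powr (1/8)) * (2 / (\<alpha> * sqrt N))
         + (\<alpha> * N + 2) * ((N / 2) powr (-7/4) * 2))"
  proof -
    have "real (Suc M) powr (1 / 8) \<le> (2 * N\<^sup>2) powr (1/8)" using M by (intro powr_mono2) auto
    moreover have "2 / \<bar>Im s\<bar> \<le> 2 / (\<alpha> * sqrt N)" using Im_ge \<alpha> sqrt0 by (intro divide_left_mono) auto
    moreover have "real M powr (-7/8) \<le> (N / 2) powr (-7/4)"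
    proof -
      have "real M powr (-7/8) \<le> ((N / 2)\<^sup>2) powr (-7/8)" using M by (intro powr_mono2') auto
      also have "(N / 2)\<^sup>2 = (N / 2) powr 2" using M by simp
      also have "\<dots> powr (-7/8) = (N / 2) powr (-7/4)" by (simp only: powr_powr) simp
      finally show ?thesis .
    qed
    moreover have "cmod s + 1 \<le> \<alpha> * N + 2" using s_le by simp
    ultimately show ?thesis using \<alpha> M sqrt0
      by (intro mult_left_mono add_mono[OF mult_mono mult_mono] mult_right_mono) auto
  qed
  also have "(\<Sum>n=1..M. (- of_real (ln (real n))) ^ j * of_nat n powr (-s)) = (-1) ^ j * P"
    unfolding P_def s_def sum_distrib_left by (intro sum.cong refl dirichlet_term) auto
  finally have 1: "cmod ((deriv ^^ j) riemann_zeta s - (-1) ^ j * P) \<le> fact j * 16 ^ j * (((2 * N\<^sup>2) powr (1/8)) * (2 / (\<alpha> * sqrt N))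
         + (\<alpha> * N + 2) * ((N / 2) powr (-7/4) * 2))" .
  have 2: "cmod ((deriv ^^ j) riemann_zeta s) \<le> zeta_deriv_max \<alpha> A j N"
    unfolding s_def \<sigma>_def \<Lambda>(1) using l by (intro zeta_deriv_max_ge) auto
  have "cmod P = cmod ((-1) ^ j * P)" by (simp add: norm_mult norm_power)
  also have "\<dots> = cmod ((deriv ^^ j) riemann_zeta s - ((deriv ^^ j) riemann_zeta s - (-1) ^ j * P))" by simp
  also have "\<dots> \<le> cmod ((deriv ^^ j) riemann_zeta s) + cmod ((deriv ^^ j) riemann_zeta s - (-1) ^ j * P)"
    by (rule norm_triangle_ineq4)
  finally show ?thesis using 1 2 unfolding P_def by linarith
qed

text \<open>A crude bound from \<open>ln n \<le> 2 * ln N\<close> and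
  \<open>n \<le> N\<^sup>2\<close>. It is spent only on the close pairs, where a factor of order
  \<open>N^(-1/2)\<close> is to spare.\<close>

lemma dirichlet_coeff_sum_le:
  fixes N :: real
  assumes "N \<ge> 1" "real M \<le> N\<^sup>2" "\<Lambda> > 0" "A > 0" "M \<ge> 1"
  shows "(\<Sum>n=1..M. ln (real n) ^ j * real n powr (-(1 - A / \<Lambda>))) \<le> (2 * ln N) ^ j * N powr (2 * A / \<Lambda>) * (1 + 2 * ln N)"
proof -
  have lnM: "ln (real n) \<le> 2 * ln N" if "n \<in> {1..M}" for n
  proof -
    have "real n \<le> real M" using that by simp
    hence "ln (real n) \<le> ln (N\<^sup>2)" using that assms by (subst ln_le_cancel_iff) auto
    thus ?thesis using assms by (simp add: ln_realpow)
  qed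
  have "(\<Sum>n=1..M. ln (real n) ^ j * real n powr (-(1 - A / \<Lambda>))) \<le> (\<Sum>n=1..M. (2 * ln N) ^ j * (N powr (2 * A / \<Lambda>) * (1 / real n)))"
  proof (intro sum_mono mult_mono)
    fix n assume n: "n \<in> {1..M}"
    show "ln (real n) ^ j \<le> (2 * ln N) ^ j" using n lnM[OF n] by (intro power_mono) auto
    have "real n powr (-(1 - A / \<Lambda>)) = real n powr (A / \<Lambda> + - 1)" by simp
    also have "\<dots> = real n powr (A / \<Lambda>) * real n powr (-1)" by (rule powr_add)
    also have "real n powr (-1) = 1 / real n" using n by (simp add: powr_minus_divide)
    also have "real n powr (A / \<Lambda>) \<le> N powr (2 * A / \<Lambda>)"
    proof -
      have "real n \<le> real M" using n by simp
      hence "real n \<le> N\<^sup>2" using assms by linarith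
      hence "real n powr (A / \<Lambda>) \<le> (N\<^sup>2) powr (A / \<Lambda>)" using assms by (intro powr_mono2) auto
      also have "N\<^sup>2 = N powr 2" using assms by simp
      also have "\<dots> powr (A / \<Lambda>) = N powr (2 * A / \<Lambda>)" by (simp only: powr_powr) simp
      finally show ?thesis .
    qed
    finally show "real n powr (-(1 - A / \<Lambda>)) \<le> N powr (2 * A / \<Lambda>) * (1 / real n)" by (simp add: divide_right_mono)
  qed (use assms in auto)
  also have "\<dots> = (2 * ln N) ^ j * N powr (2 * A / \<Lambda>) * (\<Sum>n=1..M. 1 / real n)"
    by (simp add: sum_distrib_left mult.assoc)
  also have "\<dots> \<le> (2 * ln N) ^ j * N powr (2 * A / \<Lambda>) * (1 + 2 * ln N)"
    using sum_inverse_le[of M] lnM[of M] assms by (intro mult_left_mono) auto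
  finally show ?thesis .
qed

text \<open>The parameter is \<open>x = log\<^sub>3 N\<close>: then
  \<open>\<Lambda> = exp x\<close>, \<open>log N = exp (exp x)\<close>, and every size condition
  becomes an asymptotic inequality between explicit functions of \<open>x\<close>.\<close>

lemma zeta_deriv_max_lower_bound:
  assumes \<alpha>: "\<alpha> > 0" and A: "A > 0"
  obtains C where "\<forall>\<^sub>F x in at_top. \<forall>j\<ge>1. real j \<le> x / ln x \<longrightarrow>
     (D_const j A - loss \<alpha> A C x) * exp x ^ (j + 1) \<le> zeta_deriv_max \<alpha> A j (exp (exp (exp x)))"
proof -
  obtain C where C: "C > 0" "\<And>\<Lambda> D Y S \<delta> X j. \<lbrakk>\<Lambda> \<ge> 4 * (A + 2); D \<ge> 0; Y > 0; ln (real Y) \<le> \<Lambda>; \<Lambda> \<le> ln (real Y) + D;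
     0 \<le> \<delta>; \<delta> \<le> 1 / \<Lambda>\<^sup>2; S \<ge> 1; exp S = \<Lambda>; S * D \<le> \<Lambda>; C * (S\<^sup>2 * (1 + D) / \<Lambda>) \<le> 1; X \<ge> 1\<rbrakk> \<Longrightarrow>
     (D_const j A - fact j * (C * (S\<^sup>2 * (1 + D) / \<Lambda>) + 8 ^ Y / sqrt (real X))) * \<Lambda> ^ (j + 1)
       \<le> (\<Sum>n=1..X. (ln (real n) ^ j * real n powr (-(1 - A / \<Lambda>))) * smooth_weight Y (1 - \<delta>) n)"
    using smooth_moment_lower_bound[OF A] by blast
  have ev: "\<forall>\<^sub>F x in at_top. exp x \<ge> 16 * (A + 2)" "\<forall>\<^sub>F x in at_top. x \<ge> (1::real)"
    "\<forall>\<^sub>F x in at_top. x * (2 * x) \<le> exp (x::real)" "\<forall>\<^sub>F x in at_top. C * (x\<^sup>2 * (1 + 2 * x) / exp x) \<le> (1 :: real)"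
    "\<forall>\<^sub>F x in at_top. exp (exp (exp x)) \<ge> (4 :: real)"
    "\<forall>\<^sub>F x in at_top. exp (exp x) / exp x - 1 \<ge> exp (exp x) / (exp x :: real)\<^sup>2"
    "\<forall>\<^sub>F x in at_top. x / ln x \<ge> (1 :: real)" "\<forall>\<^sub>F x in at_top. \<alpha> * sqrt (exp (exp (exp x))) \<ge> 1"
    using \<alpha> by (real_asymp, real_asymp, real_asymp, real_asymp, real_asymp, real_asymp, real_asymp, real_asymp)
  have "\<forall>\<^sub>F x in at_top. \<forall>j\<ge>1. real j \<le> x / ln x \<longrightarrow>
     (D_const j A - loss \<alpha> A C x) * exp x ^ (j + 1) \<le> zeta_deriv_max \<alpha> A j (exp (exp (exp x)))"
    using ev
  proof eventually_elim
    case (elim x)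
    show ?case
    proof (intro allI impI)
      fix j :: nat assume j: "1 \<le> j" "real j \<le> x / ln x"
      define N where "N = exp (exp (exp x))"
      define \<Lambda> where "\<Lambda> = exp x"
      define J where "J = x / ln x"
      define \<sigma> where "\<sigma> = 1 - A / \<Lambda>"
      \<comment> \<open>Rounding down costs less than another factor \<Lambda>:
        \<open>Y \<ge> exp \<Lambda> / \<Lambda>\<^sup>2\<close>, so
        \<open>ln Y \<ge> \<Lambda> - 2 * x\<close>, and \<open>D\<close> is taken to be
        \<open>2 * x\<close>.\<close>
      define Y where "Y = nat \<lfloor>exp \<Lambda> / \<Lambda>\<rfloor>"
      define L where "L = nat \<lfloor>N\<rfloor>"
      \<comment> \<open>A perfect square, so that the truncation error \<open>8 ^ Y / sqrt M\<close>
        is exactly \<open>8 ^ Y / L\<close>.\<close>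
      define M where "M = L\<^sup>2"
      define \<delta> where "\<delta> = 1 / \<Lambda>\<^sup>2"
      define r where "r = smooth_weight Y (1 - \<delta>)"
      define a where "a = (\<lambda>n. ln (real n) ^ j * real n powr (-\<sigma>))"
      define E where "E = ((2 * N\<^sup>2) powr (1/8)) * (2 / (\<alpha> * sqrt N)) + (\<alpha> * N + 2) * ((N / 2) powr (-7/4) * 2)"
      define V where "V = zeta_deriv_max \<alpha> A j N + fact j * 16 ^ j * E"
      have x1: "x \<ge> 1" and J1: "J \<ge> 1" "real j \<le> J" and \<alpha>N: "\<alpha> * sqrt N \<ge> 1" and N4: "N \<ge> 4"
        using elim j by (simp_all add: J_def N_def)
      have L16: "\<Lambda> \<ge> 16 * (A + 2)" using elim(1) by (simp add: \<Lambda>_def)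
      hence L1: "\<Lambda> \<ge> 1" using A by simp
      have lnN: "ln N = exp \<Lambda>" "iter_ln 2 N = \<Lambda>" by (simp_all add: N_def \<Lambda>_def iter_ln_def numeral_2_eq_2)
      have Y_le: "real Y \<le> exp \<Lambda> / \<Lambda>" using L1 by (simp add: Y_def of_nat_nat)
      have Y_ge: "real Y \<ge> exp \<Lambda> / \<Lambda>\<^sup>2"
      proof -
        have "real Y > exp \<Lambda> / \<Lambda> - 1" unfolding Y_def by linarith
        moreover have "exp \<Lambda> / \<Lambda> - 1 \<ge> exp \<Lambda> / \<Lambda>\<^sup>2" using elim(6) by (simp add: \<Lambda>_def)
        ultimately show ?thesis by linarith
      qed
      have Y0: "Y > 0"
      proof -
        have "real Y > 0" by (rule less_le_trans[OF _ Y_ge]) (use L1 in auto)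
        thus ?thesis by simp
      qed
      have lnY: "ln (real Y) \<le> \<Lambda>" "\<Lambda> \<le> ln (real Y) + 2 * x"
      proof -
        have "exp \<Lambda> / \<Lambda> \<le> exp \<Lambda>" using L1 by (simp add: field_simps)
        hence "ln (real Y) \<le> ln (exp \<Lambda>)" using Y0 Y_le by (subst ln_le_cancel_iff) auto
        thus "ln (real Y) \<le> \<Lambda>" by simp
        have "ln (exp \<Lambda> / \<Lambda>\<^sup>2) \<le> ln (real Y)" using Y0 Y_ge L1 by (subst ln_le_cancel_iff) auto
        moreover have "ln (exp \<Lambda> / \<Lambda>\<^sup>2) = \<Lambda> - 2 * x" using L1 by (simp add: ln_div ln_realpow \<Lambda>_def)
        ultimately show "\<Lambda> \<le> ln (real Y) + 2 * x" by linarith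
      qed
      have L: "real L \<le> N" "real L \<ge> N / 2" "sqrt N \<le> real L" "L > 0"
      proof -
        have Lf: "real L \<le> N" "real L > N - 1" unfolding L_def using N4 by linarith+
        thus "real L \<le> N" "real L \<ge> N / 2" using N4 by linarith+
        have "sqrt N \<le> N / 2" using N4 by (intro real_le_lsqrt) (auto simp: power2_eq_square field_simps)
        thus "sqrt N \<le> real L" using \<open>real L \<ge> N / 2\<close> by linarith
        show "L > 0" using Lf N4 by simp
      qed
      have M: "M \<ge> 1" "real M + 1 \<le> 2 * N\<^sup>2" "real M \<ge> (N / 2)\<^sup>2" "real M \<le> N\<^sup>2" "sqrt (real M) = real L"
      proof -
        show "M \<ge> 1" using L(4) by (simp add: M_def Suc_le_eq)
        show M_le: "real M \<le> N\<^sup>2" using L by (simp add: M_def power_mono)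
        have "1 * 1 \<le> N * N" using N4 by (intro mult_mono) auto
        thus "real M + 1 \<le> 2 * N\<^sup>2" using M_le by (simp add: power2_eq_square)
        show "real M \<ge> (N / 2)\<^sup>2" using L N4 unfolding M_def of_nat_power by (intro power_mono) auto
        show "sqrt (real M) = real L" by (simp add: M_def)
      qed
      have \<delta>: "0 < \<delta>" "\<delta> \<le> 1" using L1 by (simp_all add: \<delta>_def)
      have moment: "(D_const j A - fact j * (C * (x\<^sup>2 * (1 + 2 * x) / \<Lambda>) + 8 ^ Y / sqrt (real M))) * \<Lambda> ^ (j + 1)
         \<le> (\<Sum>n=1..M. a n * r n)"
        unfolding a_def r_def \<sigma>_def
        using L16 A x1 Y0 lnY \<delta> elim(3,4) M by (intro C(2)) (auto simp: \<delta>_def \<Lambda>_def)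
      interpret resonator r \<alpha>
        unfolding r_def using \<delta> by (intro resonator_smooth_weight) auto
      have poly: "cmod (\<Sum>n=1..M. of_real (a n) * cis (- \<alpha> * of_int l * ln (real n))) \<le> V"
        if "sqrt N \<le> of_int l" "of_int l \<le> N" for l
        unfolding a_def \<sigma>_def V_def E_def
        using that L16 L1 A \<alpha> \<alpha>N M N4 lnN by (intro dirichlet_poly_le_max) auto
      \<comment> \<open>It bounds a norm at the admissible point \<open>l = L\<close>.\<close>
      have V0: "V \<ge> 0"
        using poly[of "int L"] L by (intro order_trans[OF norm_ge_zero]) auto
      have a0: "a n \<ge> 0" for n unfolding a_def by (cases "n = 0") auto
      have res: "(\<Sum>n=1..M. a n * r n) \<le> V + (2 * sqrt N + 1) / real L * (\<Sum>n=1..M. a n) * (infsum r UNIV)\<^sup>2"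
      proof (rule resonance_inequality)
        fix l :: int assume l: "sqrt N \<le> \<bar>of_int l\<bar>" "\<bar>l\<bar> < int L"
        have "of_int \<bar>l\<bar> < real L" using l(2) by linarith
        hence lN: "\<bar>of_int l\<bar> \<le> N" using L by simp
        show "cmod (\<Sum>n=1..M. of_real (a n) * cis (- \<alpha> * of_int l * ln (real n))) \<le> V"
        proof (cases "l \<ge> 0")
          case True
          thus ?thesis using l lN by (intro poly) auto
        next
          \<comment> \<open>Negative differences \<open>k - k'\<close> reduce to positive ones by
            complex conjugation.\<close>
          case False
          have "(\<Sum>n=1..M. of_real (a n) * cis (- \<alpha> * of_int l * ln (real n))) =
            cnj (\<Sum>n=1..M. of_real (a n) * cis (- \<alpha> * of_int (-l) * ln (real n)))"
            by (simp add: cis_cnj)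
          thus ?thesis using poly[of "-l"] False l lN by (simp only: complex_mod_cnj)
        qed
      qed (use a0 L V0 N4 in auto)
      have fact_le: "fact j \<le> J powr J" "fact j * 16 ^ j \<le> (16 * J) powr J"
      proof -
        show "fact j \<le> J powr J"
          using powr_le_self_power[of j J 1] fact_le_real_power[of j] J1 by simp
        have "fact j * 16 ^ j \<le> 16 ^ j * real j ^ j" using fact_le_real_power[of j] by (simp add: mult.commute)
        also have "\<dots> \<le> (16 * J) powr J" using J1 by (intro powr_le_self_power) auto
        finally show "fact j * 16 ^ j \<le> (16 * J) powr J" .
      qed
      have \<Lambda>j: "\<Lambda> ^ (j + 1) \<ge> 1" using L1 by (intro one_le_power)
      have l1: "fact j * (C * (x\<^sup>2 * (1 + 2 * x) / \<Lambda>)) \<le> J powr J * (C * (x\<^sup>2 * (1 + 2 * x) / \<Lambda>))"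
        using fact_le C(1) x1 L1 by (intro mult_right_mono) auto
      have l2: "fact j * (8 ^ Y / sqrt (real M)) \<le> J powr J * (8 powr (exp \<Lambda> / \<Lambda>) * (2 / N))"
      proof (intro mult_mono fact_le)
        have "8 ^ Y = 8 powr real Y" by (simp add: powr_realpow)
        also have "\<dots> \<le> 8 powr (exp \<Lambda> / \<Lambda>)" using Y_le by (intro powr_mono) auto
        finally have "(8 :: real) ^ Y \<le> 8 powr (exp \<Lambda> / \<Lambda>)" .
        moreover have "1 / real L \<le> 2 / N" using L N4 by (simp add: field_simps)
        ultimately have "8 ^ Y * (1 / real L) \<le> 8 powr (exp \<Lambda> / \<Lambda>) * (2 / N)" by (intro mult_mono) auto
        thus "8 ^ Y / sqrt (real M) \<le> 8 powr (exp \<Lambda> / \<Lambda>) * (2 / N)" using M by simp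
      qed auto
      have E0: "E \<ge> 0" unfolding E_def using \<alpha> N4 by (intro add_nonneg_nonneg mult_nonneg_nonneg) auto
      have l3: "fact j * 16 ^ j * E \<le> (16 * J) powr J * E"
        using fact_le E0 by (intro mult_right_mono)
      have l4: "(2 * sqrt N + 1) / real L * (\<Sum>n=1..M. a n) * (infsum r UNIV)\<^sup>2 \<le>
        (2 * sqrt N + 1) * (2 / N) * (2 * exp \<Lambda>) powr J * N powr (2 * A / \<Lambda>) * (1 + 2 * exp \<Lambda>) * \<Lambda> powr (4 * exp \<Lambda> / \<Lambda>)"
      proof -
        have 1: "(2 * sqrt N + 1) / real L \<le> (2 * sqrt N + 1) * (2 / N)"
        proof -
          have "1 / real L \<le> 2 / N" using L N4 by (simp add: field_simps)
          hence "(2 * sqrt N + 1) * (1 / real L) \<le> (2 * sqrt N + 1) * (2 / N)" using N4 by (intro mult_left_mono) auto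
          thus ?thesis by simp
        qed
        have "(\<Sum>n=1..M. a n) \<le> (2 * ln N) ^ j * N powr (2 * A / \<Lambda>) * (1 + 2 * ln N)"
          unfolding a_def \<sigma>_def using N4 M L1 A by (intro dirichlet_coeff_sum_le) auto
        also have "\<dots> = (2 * exp \<Lambda>) ^ j * (N powr (2 * A / \<Lambda>) * (1 + 2 * exp \<Lambda>))" by (simp add: lnN)
        also have "(2 * exp \<Lambda>) ^ j \<le> (2 * exp \<Lambda>) powr J"
        proof -
          have "exp \<Lambda> \<ge> 1" using L1 by simp
          hence "(2 * exp \<Lambda>) powr real j \<le> (2 * exp \<Lambda>) powr J" using J1 by (intro powr_mono) linarith+
          thus ?thesis by (simp add: powr_realpow)
        qed
        finally have 2: "(\<Sum>n=1..M. a n) \<le> (2 * exp \<Lambda>) powr J * (N powr (2 * A / \<Lambda>) * (1 + 2 * exp \<Lambda>))"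
          by (simp add: mult_right_mono)
        have 3: "(infsum r UNIV)\<^sup>2 \<le> \<Lambda> powr (4 * exp \<Lambda> / \<Lambda>)"
        proof -
          have "infsum r UNIV \<le> (1 / \<delta>) ^ Y" unfolding r_def by (rule infsum_smooth_weight_le[OF \<delta>])
          moreover have "infsum r UNIV \<ge> 0" by (intro infsum_nonneg r_nonneg)
          ultimately have "(infsum r UNIV)\<^sup>2 \<le> ((1 / \<delta>) ^ Y)\<^sup>2" by (intro power_mono)
          also have "\<dots> = \<Lambda> ^ (4 * Y)" by (simp add: \<delta>_def power_mult[symmetric] mult.commute)
          also have "\<dots> = \<Lambda> powr real (4 * Y)" using L1 by (intro powr_realpow[symmetric]) linarith
          also have "\<dots> \<le> \<Lambda> powr (4 * exp \<Lambda> / \<Lambda>)" using L1 Y_le by (intro powr_mono) auto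
          finally show ?thesis .
        qed
        have "(2 * sqrt N + 1) / real L * (\<Sum>n=1..M. a n) * (infsum r UNIV)\<^sup>2 \<le>
          (2 * sqrt N + 1) * (2 / N) * ((2 * exp \<Lambda>) powr J * (N powr (2 * A / \<Lambda>) * (1 + 2 * exp \<Lambda>))) * \<Lambda> powr (4 * exp \<Lambda> / \<Lambda>)"
          using 1 2 3 N4 a0 by (intro mult_mono mult_nonneg_nonneg sum_nonneg) auto
        thus ?thesis by (simp only: mult.assoc)
      qed
      define t1 where "t1 = J powr J * (C * (x\<^sup>2 * (1 + 2 * x) / \<Lambda>))"
      define t2 where "t2 = J powr J * (8 powr (exp \<Lambda> / \<Lambda>) * (2 / N))"
      define t3 where "t3 = (16 * J) powr J * E"
      define t4 where "t4 = (2 * sqrt N + 1) * (2 / N) * (2 * exp \<Lambda>) powr J * N powr (2 * A / \<Lambda>) * (1 + 2 * exp \<Lambda>) * \<Lambda> powr (4 * exp \<Lambda> / \<Lambda>)"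
      have loss_eq: "loss \<alpha> A C x = t1 + t2 + t3 + t4"
        by (simp only: loss_def t1_def t2_def t3_def t4_def E_def N_def \<Lambda>_def J_def)
      \<comment> \<open>\<open>t3\<close> and \<open>t4\<close> arise without the factor
        \<open>\<Lambda> ^ (j + 1)\<close>, whereas \<open>loss\<close> is multiplied by it; as the
        factor is at least 1, including them there only weakens the bound.\<close>
      have t: "t3 \<le> t3 * \<Lambda> ^ (j + 1)" "t4 \<le> t4 * \<Lambda> ^ (j + 1)"
      proof -
        have "t3 \<ge> 0" "t4 \<ge> 0" using E0 N4 by (auto simp: t3_def t4_def)
        thus "t3 \<le> t3 * \<Lambda> ^ (j + 1)" "t4 \<le> t4 * \<Lambda> ^ (j + 1)"
          using mult_left_mono[OF \<Lambda>j] by fastforce+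
      qed
      have "(D_const j A - loss \<alpha> A C x) * \<Lambda> ^ (j + 1) = (D_const j A - (t1 + t2)) * \<Lambda> ^ (j + 1) - (t3 * \<Lambda> ^ (j + 1) + t4 * \<Lambda> ^ (j + 1))"
        unfolding loss_eq by (simp add: ring_distribs)
      also have "\<dots> \<le> (D_const j A - (t1 + t2)) * \<Lambda> ^ (j + 1) - (t3 + t4)" using t by linarith
      also have "(D_const j A - (t1 + t2)) * \<Lambda> ^ (j + 1) \<le>
        (D_const j A - fact j * (C * (x\<^sup>2 * (1 + 2 * x) / \<Lambda>) + 8 ^ Y / sqrt (real M))) * \<Lambda> ^ (j + 1)"
      proof (rule mult_right_mono)
        show "D_const j A - (t1 + t2) \<le> D_const j A - fact j * (C * (x\<^sup>2 * (1 + 2 * x) / \<Lambda>) + 8 ^ Y / sqrt (real M))"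
        proof -
          have "fact j * (C * (x\<^sup>2 * (1 + 2 * x) / \<Lambda>) + 8 ^ Y / sqrt (real M)) \<le> t1 + t2"
            using add_mono[OF l1 l2] by (simp only: t1_def t2_def distrib_left[of "fact j :: real"])
          thus ?thesis by linarith
        qed
      qed (use L1 in auto)
      also note moment
      also note res
      finally have "(D_const j A - loss \<alpha> A C x) * \<Lambda> ^ (j + 1) \<le>
        V + (2 * sqrt N + 1) / real L * (\<Sum>n=1..M. a n) * (infsum r UNIV)\<^sup>2 - (t3 + t4)" by simp
      hence "(D_const j A - loss \<alpha> A C x) * \<Lambda> ^ (j + 1) \<le> zeta_deriv_max \<alpha> A j N"
        using l3 l4 unfolding V_def t3_def[symmetric] t4_def[symmetric] by linarith
      thus "(D_const j A - loss \<alpha> A C x) * exp x ^ (j + 1) \<le> zeta_deriv_max \<alpha> A j (exp (exp (exp x)))"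
        by (simp only: \<Lambda>_def N_def)
    qed
  qed
  thus ?thesis using that by blast
qed

theorem theorem2:
  fixes \<alpha> A :: real
  assumes "\<alpha> > 0" and "A > 0"
  shows "\<exists>e :: nat \<Rightarrow> real \<Rightarrow> real.
    (\<forall>\<epsilon>>0. \<forall>\<^sub>F N in at_top. \<forall>j\<ge>1. real j \<le> iter_ln 3 N / iter_ln 4 N \<longrightarrow> \<bar>e j N\<bar> < \<epsilon>) \<and>
    (\<forall>\<^sub>F N in at_top. \<forall>j\<ge>1. real j \<le> iter_ln 3 N / iter_ln 4 N \<longrightarrow>
      Max ((\<lambda>l::int. cmod ((deriv ^^ j) riemann_zeta
              (of_real (1 - A / iter_ln 2 N) + \<i> * of_real \<alpha> * of_int l)))
           ` {l. sqrt N \<le> of_int l \<and> of_int l \<le> N})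
      \<ge> (D_const j A + e j N) * iter_ln 2 N ^ (j + 1))"
proof -
  obtain C where C: "\<forall>\<^sub>F x in at_top. \<forall>j\<ge>1. real j \<le> x / ln x \<longrightarrow>
     (D_const j A - loss \<alpha> A C x) * exp x ^ (j + 1) \<le> zeta_deriv_max \<alpha> A j (exp (exp (exp x)))"
    using zeta_deriv_max_lower_bound[OF assms] by blast
  \<comment> \<open>Independent of \<open>j\<close>, hence uniform. The absolute value puts
    \<open>e\<close> below \<open>- loss\<close> whatever the sign of \<open>loss\<close>.\<close>
  define e where "e = (\<lambda>(j::nat) N. - \<bar>loss \<alpha> A C (iter_ln 3 N)\<bar>)"
  have lim: "filterlim (iter_ln 3) at_top at_top"
    unfolding iter_ln_def [abs_def] by (simp add: numeral_3_eq_3 o_def) real_asymp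
  have e_small: "\<forall>\<^sub>F N in at_top. \<forall>j\<ge>1. real j \<le> iter_ln 3 N / iter_ln 4 N \<longrightarrow> \<bar>e j N\<bar> < \<epsilon>" if "\<epsilon> > 0" for \<epsilon>
  proof -
    have "((\<lambda>N. loss \<alpha> A C (iter_ln 3 N)) \<longlongrightarrow> 0) at_top"
      by (rule filterlim_compose[OF loss_tendsto_0[OF assms] lim])
    hence "\<forall>\<^sub>F N in at_top. \<bar>loss \<alpha> A C (iter_ln 3 N)\<bar> < \<epsilon>"
      using that by (simp add: tendsto_iff dist_real_def)
    thus ?thesis by (rule eventually_mono) (simp add: e_def)
  qed
  have "\<forall>\<^sub>F N in at_top. \<forall>j\<ge>1. real j \<le> iter_ln 3 N / iter_ln 4 N \<longrightarrow>
      (D_const j A + e j N) * iter_ln 2 N ^ (j + 1) \<le> zeta_deriv_max \<alpha> A j N"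
    \<comment> \<open>\<open>N > exp (exp 1)\<close> makes \<open>ln N\<close> and
      \<open>ln (ln N)\<close> positive, so that \<open>exp\<close> undoes all three
      logarithms.\<close>
    using eventually_compose_filterlim[OF C lim] eventually_gt_at_top[of "exp (exp 1)"]
  proof eventually_elim
    case (elim N)
    have "ln N > ln (exp (exp 1))" using elim(2) by (subst ln_less_cancel_iff) (auto intro: less_trans[OF exp_gt_zero])
    hence lnN: "ln N > exp 1" by simp
    hence "ln (ln N) > ln (exp 1)" by (subst ln_less_cancel_iff) (auto intro: less_trans[OF exp_gt_zero])
    hence ln2N: "ln (ln N) > 1" by simp
    have N0: "N > 0" using elim(2) less_trans[OF exp_gt_zero] by blast
    have lnN0: "ln N > 0" using lnN less_trans[OF exp_gt_zero] by blast
    have iter: "iter_ln 2 N = exp (iter_ln 3 N)" "N = exp (exp (exp (iter_ln 3 N)))" "iter_ln 4 N = ln (iter_ln 3 N)"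
    proof -
      have "exp (ln N) = N" "exp (ln (ln N)) = ln N" "exp (ln (ln (ln N))) = ln (ln N)"
        using N0 lnN0 ln2N by (simp_all only: exp_ln_iff)
      thus "iter_ln 2 N = exp (iter_ln 3 N)" "N = exp (exp (exp (iter_ln 3 N)))" "iter_ln 4 N = ln (iter_ln 3 N)"
        by (simp_all add: iter_ln_def eval_nat_numeral)
    qed
    show ?case
    proof (intro allI impI)
      fix j :: nat assume j: "1 \<le> j" "real j \<le> iter_ln 3 N / iter_ln 4 N"
      have "(D_const j A + e j N) * iter_ln 2 N ^ (j + 1) \<le> (D_const j A - loss \<alpha> A C (iter_ln 3 N)) * exp (iter_ln 3 N) ^ (j + 1)"
        unfolding iter(1) e_def by (intro mult_right_mono) auto
      also have "\<dots> \<le> zeta_deriv_max \<alpha> A j (exp (exp (exp (iter_ln 3 N))))"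
        using elim(1) j by (simp only: iter(3))
      finally show "(D_const j A + e j N) * iter_ln 2 N ^ (j + 1) \<le> zeta_deriv_max \<alpha> A j N"
        using iter(2) by simp
    qed
  qed
  thus ?thesis using e_small unfolding zeta_deriv_max_def by blast
qed

end
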